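(* For any $0<p_0,q_0,r_0\le\infty$ we have the following (strong) factorizations: $F_1)$ $T^{p_0,r_0}_{q_0}\rightarrow T^{p_0,\infty}_{q_0}\cdot T^{\infty,r_0}_\infty$; $F_2)$ $T^{p_0,r_0}_{q_0}\rightarrow T^{p_0,\infty}_{\infty}\cdot T^{\infty,r_0}_{q_0}$; $F_3)$ $T^{p_0,r_0}_{q_0}\rightarrow T^{p_0,\infty}_{\infty}\cdot T^{\infty,\infty}_{q_0}\cdot T^{\infty,r_0}_{\infty}$.
   Context: Let $\mathbb{R}^{n+1}_+=\mathbb{R}^n\times(0,\infty)$ with Lebesgue measure; functions are complex-valued measurable, identified a.e. For $(y,t)\in\mathbb{R}^{n+1}_+$, $B(y,t)=\{z\in\mathbb{R}^n:|z-y|<t\}$, $\Gamma(x)=\{(y,t):|y-x|<t\}$, and $\widehat{B}=\{(y,t):B(y,t)\subset B\}$ for an open ball $B$. Fix Whitney parameters $0<\alpha_1<\alpha_2^{-1}<1$ and $W(y,t)=\{(z,s):|z-y|<\alpha_1t,\ \alpha_2^{-1}t<s<\alpha_2t\}$; $\mathcal{W}_r(f)(y,t)=|W(y,t)|^{-1/r}\|f\|_{L^r(W(y,t))}$ ($0<r<\infty$), $\mathcal{W}_\infty(f)(y,t)=\operatorname{ess\,sup}_{W(y,t)}|f|$. Tent spaces $T^p_q$: (A) $p,q<\infty$: $\|g\|=\|(\iint_{\Gamma(x)}|g|^q\,dy\,dt/t^{n+1})^{1/q}\|_{L^p(dx)}$; (B) $q<p=\infty$: $\|g\|=\sup_x\sup_{B\ni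 x}|B|^{-1/q}(\iint_{\widehat B}|g|^q\,dy\,dt/t)^{1/q}$; (C) $p<q=\infty$: $\|g\|=\|\sup_{(y,t)\in\Gamma(x)}|g(y,t)|\|_{L^p(dx)}$; (D) $T^\infty_\infty=L^\infty$. $T^{p,r}_q$ is the space of $f$ with $\|f\|_{T^{p,r}_q}=\|\mathcal{W}_r(f)\|_{T^p_q}<\infty$. Factorization: $X_0\rightarrow X_1\cdots X_m$ means that for every $f_0\in X_0$ there exist $f_i\in X_i$ ($1\le i\le m$) with $|f_0|=|f_1|\cdots|f_m|$ a.e. and $\|f_1\|_{X_1}\cdots\|f_m\|_{X_m}\le C\|f_0\|_{X_0}$ with $C$ independent of the functions. *)

theory Defs
  imports "HOL-Analysis.Analysis"
begin

text \<open>Points of the upper half space are pairs (y,t) :: (real^'n) \<times> real; only t > 0 matters.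
  Exponents in (0,\<infinity>] are ennreal values, top meaning \<infinity>.
  Norms are ennreal-valued (possibly top).\<close>

definition epow :: "ennreal \<Rightarrow> real \<Rightarrow> ennreal" where
  "epow x a = (if x = top then top else ennreal (enn2real x powr a))"

definition ess_sup_on :: "('a::euclidean_space) set \<Rightarrow> ('a \<Rightarrow> ennreal) \<Rightarrow> ennreal" where
  "ess_sup_on A g = Inf {c. AE z in lebesgue. z \<in> A \<longrightarrow> g z \<le> c}"

definition cone :: "real^'n \<Rightarrow> ((real^'n) \<times> real) set" where
  "cone x = {(y,t). 0 < t \<and> dist y x < t}"

definition tent :: "(real^'n) set \<Rightarrow> ((real^'n) \<times> real) set" where
  "tent B = {(y,t). 0 < t \<and> ball y t \<subseteq> B}"

definition whitney :: "real \<Rightarrow> real \<Rightarrow> (real^'n) \<times> real \<Rightarrow> ((real^'n) \<times> real) set" where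
  "whitney a1 a2 yt = {(z,s). dist z (fst yt) < a1 * snd yt \<and>
       snd yt / a2 < s \<and> s < a2 * snd yt}"

definition whitney_avg :: "real \<Rightarrow> real \<Rightarrow> ennreal \<Rightarrow> ((real^'n) \<times> real \<Rightarrow> complex)
    \<Rightarrow> (real^'n) \<times> real \<Rightarrow> ennreal" where
  "whitney_avg a1 a2 r f yt =
    (if r = top then ess_sup_on (whitney a1 a2 yt) (\<lambda>z. ennreal (cmod (f z)))
     else epow ((\<integral>\<^sup>+ z. indicator (whitney a1 a2 yt) z * ennreal (cmod (f z) powr enn2real r) \<partial>lebesgue)
                 / emeasure lebesgue (whitney a1 a2 yt)) (1 / enn2real r))"

definition tent_norm :: "ennreal \<Rightarrow> ennreal \<Rightarrow> ((real^'n) \<times> real \<Rightarrow> ennreal) \<Rightarrow> ennreal" where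
  "tent_norm p q g =
    (if p = top \<and> q = top then ess_sup_on {yt. 0 < snd yt} g
     else if q = top then
       epow (\<integral>\<^sup>+ x. epow (SUP yt\<in>cone x. g yt) (enn2real p) \<partial>lebesgue) (1 / enn2real p)
     else if p = top then
       (SUP x. SUP B\<in>{ball c \<rho> | c \<rho>. 0 < \<rho> \<and> x \<in> ball c \<rho>}.
          epow (\<integral>\<^sup>+ yt. indicator (tent B) yt * epow (g yt) (enn2real q) * ennreal (1 / snd yt) \<partial>lebesgue)
               (1 / enn2real q)
          / epow (emeasure lebesgue B) (1 / enn2real q))
     else
       epow (\<integral>\<^sup>+ x. epow (\<integral>\<^sup>+ yt. indicator (cone x) yt * epow (g yt) (enn2real q)
                              * ennreal (1 / snd yt ^ (CARD('n) + 1)) \<partial>lebesgue)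
                        (enn2real p / enn2real q) \<partial>lebesgue) (1 / enn2real p))"

definition Tnorm :: "real \<Rightarrow> real \<Rightarrow> ennreal \<Rightarrow> ennreal \<Rightarrow> ennreal \<Rightarrow> ((real^'n) \<times> real \<Rightarrow> complex) \<Rightarrow> ennreal" where
  "Tnorm a1 a2 p q r f = tent_norm p q (whitney_avg a1 a2 r f)"

definition factorizes2 :: "(('a::euclidean_space \<Rightarrow> complex) \<Rightarrow> ennreal) \<Rightarrow> (('a \<Rightarrow> complex) \<Rightarrow> ennreal)
    \<Rightarrow> (('a \<Rightarrow> complex) \<Rightarrow> ennreal) \<Rightarrow> ('a \<Rightarrow> bool) \<Rightarrow> bool" where
  "factorizes2 N0 N1 N2 D \<longleftrightarrow> (\<exists>C::real. \<forall>f0. f0 \<in> borel_measurable lebesgue \<and> N0 f0 < top \<longrightarrow>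
     (\<exists>f1 f2. f1 \<in> borel_measurable lebesgue \<and> f2 \<in> borel_measurable lebesgue \<and>
        N1 f1 < top \<and> N2 f2 < top \<and>
        (AE z in lebesgue. D z \<longrightarrow> cmod (f0 z) = cmod (f1 z) * cmod (f2 z)) \<and>
        N1 f1 * N2 f2 \<le> ennreal C * N0 f0))"

definition factorizes3 :: "(('a::euclidean_space \<Rightarrow> complex) \<Rightarrow> ennreal) \<Rightarrow> (('a \<Rightarrow> complex) \<Rightarrow> ennreal)
    \<Rightarrow> (('a \<Rightarrow> complex) \<Rightarrow> ennreal) \<Rightarrow> (('a \<Rightarrow> complex) \<Rightarrow> ennreal) \<Rightarrow> ('a \<Rightarrow> bool) \<Rightarrow> bool" where
  "factorizes3 N0 N1 N2 N3 D \<longleftrightarrow> (\<exists>C::real. \<forall>f0. f0 \<in> borel_measurable lebesgue \<and> N0 f0 < top \<longrightarrow>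
     (\<exists>f1 f2 f3. f1 \<in> borel_measurable lebesgue \<and> f2 \<in> borel_measurable lebesgue \<and>
        f3 \<in> borel_measurable lebesgue \<and> N1 f1 < top \<and> N2 f2 < top \<and> N3 f3 < top \<and>
        (AE z in lebesgue. D z \<longrightarrow> cmod (f0 z) = cmod (f1 z) * cmod (f2 z) * cmod (f3 z)) \<and>
        N1 f1 * N2 f2 * N3 f3 \<le> ennreal C * N0 f0))"

end

theory Submission
  imports Defs
begin

text \<open>Write \<open>\<W>\<close> for the Whitney average of \<open>|f|\<close>. Given a function \<open>k\<close> on the half space, let
  \<open>S k \<zeta>\<close> be the supremum of \<open>k\<close> over all \<open>z\<close> whose Whitney region contains \<open>\<zeta>\<close>, and factor
  \<open>|f| = S k \<cdot> (|f| / S k)\<close>. Since \<open>S k \<ge> k z\<close> on the Whitney region of \<open>z\<close>, the Whitney average of the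
  second factor at \<open>z\<close> is at most \<open>\<W> z / k z\<close>.

  For \<open>F\<^sub>1\<close> take \<open>k = \<W>\<close>: the second factor is bounded by 1, and the first one is controlled
  because \<open>\<W>\<^sup>q\<close> at a point is at most its average over an enlarged Whitney region, which costs only a
  change of aperture in the area function. For \<open>F\<^sub>2\<close> let \<open>A\<close> be the area function of \<open>\<W>\<close> and \<open>k (y,t)\<close>
  the median of \<open>A\<close> over the ball \<open>B(y,t)\<close>. The maximal function of \<open>k\<close> is controlled by the weak (1,1)
  inequality (Vitali covering), and on at least half of \<open>B(y,t)\<close> we have \<open>A \<le> k (y,t)\<close>, so that
  Tonelli's theorem turns the Carleson condition for \<open>\<W> / k\<close> into the trivial bound for
  the area function of \<open>\<W>\<close> divided by \<open>A\<close>. \<open>F\<^sub>3\<close> is \<open>F\<^sub>1\<close> followed by \<open>F\<^sub>2\<close>.\<close>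

section \<open>Real powers in the extended half line\<close>

text \<open>The exponents fill all of (0,\<infinity>], so the boundedness of the maximal operator on
  L^p, which fails for p <= 1, cannot be applied to the area function A itself. This is why medians
  replace averages: a median above l over a ball says exactly that \<open>{x. l < A x}\<close> has
  density above 1/2 there. Maximal functions are thus needed only for indicator functions, and
  strong bounds follow by integrating estimates of level sets, whatever the exponent. The same
  device proves the change of aperture, where p/q may be any positive number. The supremum in
  \<open>S k\<close> runs over an open fiber, so \<open>S k\<close> is lower semicontinuous and
  Borel for arbitrary k. Its Whitney supremum at z is at most \<open>H k z\<close>, the supremum of
  k over all points whose Whitney region meets that of z, so estimates for the first factor become
  estimates for \<open>H k\<close>. An exact product needs two qualitative facts as well:
  \<open>S k\<close> is finite a.e., and f vanishes a.e. where \<open>S k\<close> does. Both come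
  from Tonelli and the openness of cones, balls and Whitney regions.\<close>

lemma epow_mono: "x \<le> y \<Longrightarrow> 0 \<le> a \<Longrightarrow> epow x a \<le> epow y a"
  unfolding epow_def
  by (auto simp: top_unique less_top intro!: ennreal_leI powr_mono2 enn2real_mono)

lemma epow_0 [simp]: "epow 0 a = 0"
  by (simp add: epow_def)

lemma epow_top [simp]: "epow top a = top"
  by (simp add: epow_def)

lemma epow_ennreal: "0 \<le> x \<Longrightarrow> epow (ennreal x) a = ennreal (x powr a)"
  by (simp add: epow_def)

lemma epow_one [simp]: "epow 1 a = 1"
  using epow_ennreal[of 1 a] by simp

lemma epow_exp_one [simp]: "epow x 1 = x"
  by (cases x) (auto simp: epow_ennreal)

lemma epow_epow: "epow (epow x a) b = epow x (a * b)"
  by (cases x) (auto simp: epow_ennreal powr_powr)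

lemma epow_inverse_exp [simp]:
  "0 < a \<Longrightarrow> epow (epow x a) (1 / a) = x" "0 < a \<Longrightarrow> epow (epow x (1 / a)) a = x"
  by (simp_all add: epow_epow)

lemma epow_eq_0_iff [simp]: "epow x a = 0 \<longleftrightarrow> x = 0"
  by (cases x) (auto simp: epow_ennreal)

lemma epow_eq_top_iff [simp]: "epow x a = top \<longleftrightarrow> x = top"
  by (cases x) (auto simp: epow_ennreal)

lemma epow_less_top_iff [simp]: "epow x a < top \<longleftrightarrow> x < top"
  by (simp add: less_top[symmetric])

text \<open>Valid for every real exponent because \<open>epow\<close> fixes both 0 and top whatever
  the exponent, in agreement with 0 * top = 0.\<close>

lemma epow_mult: "epow (x * y) a = epow x a * epow y a"
proof (cases "x = top \<or> y = top")
  case True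
  then show ?thesis
    by (cases "x = 0 \<or> y = 0") (auto simp: ennreal_top_mult ennreal_mult_top)
next
  case False
  then obtain r s where "x = ennreal r" "y = ennreal s" "0 \<le> r" "0 \<le> s"
    by (cases x; cases y) auto
  then show ?thesis
    by (simp add: epow_ennreal powr_mult flip: ennreal_mult)
qed

lemma epow_le_iff: "0 < a \<Longrightarrow> epow x a \<le> y \<longleftrightarrow> x \<le> epow y (1 / a)"
  using epow_mono[of "epow x a" y "1 / a"] epow_mono[of x "epow y (1 / a)" a] by auto

lemma less_epow_iff: "0 < a \<Longrightarrow> x < epow y a \<longleftrightarrow> epow x (1 / a) < y"
  using epow_le_iff[of "1 / a" x y] epow_le_iff[of a y x] by (simp add: not_le[symmetric])

lemma borel_measurable_epow [measurable (raw)]: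
  assumes [measurable]: "f \<in> borel_measurable M"
  shows "(\<lambda>x. epow (f x) a) \<in> borel_measurable M"
  unfolding epow_def by (intro measurable_If measurable_compose[OF _ measurable_ennreal]) measurable

lemma nn_integral_lebesgue [simp]: "nn_integral lebesgue f = nn_integral lborel f"
  by (rule nn_integral_completion)

section \<open>Layer cake estimates\<close>

lemma lborel_swap:
  fixes f :: "'a::euclidean_space \<Rightarrow> 'b::euclidean_space \<Rightarrow> ennreal"
  assumes [measurable]: "case_prod f \<in> borel_measurable (borel \<Otimes>\<^sub>M borel)"
  shows "(\<integral>\<^sup>+x. \<integral>\<^sup>+y. f x y \<partial>lborel \<partial>lborel) = (\<integral>\<^sup>+y. \<integral>\<^sup>+x. f x y \<partial>lborel \<partial>lborel)"
  by (rule lborel_pair.Fubini'[symmetric]) measurable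

lemma emeasure_lborel_less_ennreal:
  "emeasure lborel {\<mu>::real. 0 < \<mu> \<and> ennreal \<mu> < c} = c"
proof (cases c)
  case (real r)
  then have "{\<mu>::real. 0 < \<mu> \<and> ennreal \<mu> < c} = {0<..<r}"
    by (auto simp: ennreal_less_iff)
  then show ?thesis using real by simp
next
  case top
  have "{\<mu>::real. 0 < \<mu> \<and> ennreal \<mu> < c} = {0<..}"
    using top by auto
  moreover have "emeasure lborel {0::real<..} = top"
  proof (rule ccontr)
    assume "\<not> ?thesis"
    then obtain r where r: "emeasure lborel {0::real<..} = ennreal r" "0 \<le> r"
      by (cases "emeasure lborel {0::real<..}") auto
    have "emeasure lborel {0<..<r + 1} \<le> emeasure lborel {0::real<..}"
      by (intro emeasure_mono) auto
    with r show False by (simp add: ennreal_le_iff)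
  qed
  ultimately show ?thesis using top by simp
qed

text \<open>\<open>u x\<close> is the length of the interval of positive levels below it; Tonelli
  then exchanges points and levels.\<close>

lemma nn_integral_layer_cake:
  fixes u :: "'a::euclidean_space \<Rightarrow> ennreal"
  assumes [measurable]: "u \<in> borel_measurable borel"
  shows "(\<integral>\<^sup>+x. u x \<partial>lborel) =
    (\<integral>\<^sup>+\<mu>. indicator {0<..} \<mu> * emeasure lborel {x. ennreal \<mu> < u x} \<partial>lborel)"
proof -
  have "(\<integral>\<^sup>+x. u x \<partial>lborel) =
      (\<integral>\<^sup>+x. \<integral>\<^sup>+\<mu>. indicator {\<mu>. 0 < \<mu> \<and> ennreal \<mu> < u x} \<mu> \<partial>lborel \<partial>lborel)"
    by (intro nn_integral_cong) (simp add: emeasure_lborel_less_ennreal)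
  also have "\<dots> = (\<integral>\<^sup>+x. \<integral>\<^sup>+\<mu>. indicator {0<..} \<mu> * indicator {x. ennreal \<mu> < u x} x \<partial>lborel \<partial>lborel)"
    by (intro nn_integral_cong) (auto simp: indicator_def)
  also have "\<dots> = (\<integral>\<^sup>+\<mu>. \<integral>\<^sup>+x. indicator {0<..} \<mu> * indicator {x. ennreal \<mu> < u x} x \<partial>lborel \<partial>lborel)"
    by (rule lborel_swap) measurable
  also have "\<dots> = (\<integral>\<^sup>+\<mu>. indicator {0<..} \<mu> * emeasure lborel {x. ennreal \<mu> < u x} \<partial>lborel)"
    by (simp add: nn_integral_cmult)
  finally show ?thesis .
qed

text \<open>For finite v the levels up to v contribute v, and the tail contributes v^2 * (1/v) = v.
  The truncation gives integrability near 0, the square gives it at infinity.\<close>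

lemma nn_integral_min_square:
  "(\<integral>\<^sup>+\<mu>. indicator {0<..} \<mu> * epow (min 1 (v / ennreal \<mu>)) 2 \<partial>lborel) \<le> 2 * v"
proof (cases v)
  case top then show ?thesis by (simp add: ennreal_mult_top)
next
  case (real r)
  show ?thesis
  proof (cases "r = 0")
    case True then show ?thesis using real by simp
  next
    case False
    with real have r: "0 < r" by simp
    have "((\<lambda>x. x powr -2) has_integral -(r powr (-2 + 1)) / (-2 + 1)) {r..}"
      using r by (intro has_integral_powr_to_inf) auto
    then have I: "((\<lambda>x. r\<^sup>2 * x powr -2) has_integral r\<^sup>2 * (r powr -1)) {r..}"
      by (intro has_integral_mult_right) simp
    have "r\<^sup>2 * r powr -1 = r"
      using r by (simp add: powr_minus_divide power2_eq_square)
    with I have *: "(\<integral>\<^sup>+x. indicator {r..} x * ennreal (r\<^sup>2 * x powr -2) \<partial>lborel) = ennreal r"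
      using nn_integral_has_integral_lebesgue[OF _ I] by (simp add: ennreal_mult' ennreal_indicator)
    have "(\<integral>\<^sup>+\<mu>. indicator {0<..} \<mu> * epow (min 1 (v / ennreal \<mu>)) 2 \<partial>lborel)
        \<le> (\<integral>\<^sup>+\<mu>. indicator {0..r} \<mu> + indicator {r..} \<mu> * ennreal (r\<^sup>2 * \<mu> powr -2) \<partial>lborel)"
    proof (intro nn_integral_mono)
      fix \<mu> :: real
      show "indicator {0<..} \<mu> * epow (min 1 (v / ennreal \<mu>)) 2
         \<le> indicator {0..r} \<mu> + indicator {r..} \<mu> * ennreal (r\<^sup>2 * \<mu> powr -2)"
      proof (cases "0 < \<mu> \<and> r < \<mu>")
        case True
        have "epow (min 1 (v / ennreal \<mu>)) 2 \<le> epow (v / ennreal \<mu>) 2"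
          by (intro epow_mono) auto
        also have "\<dots> = ennreal (r\<^sup>2 * \<mu> powr -2)"
          using True real r by (simp add: divide_ennreal epow_ennreal powr_minus_divide power_divide)
        finally show ?thesis using True r by simp
      next
        case False
        have "epow (min 1 (v / ennreal \<mu>)) 2 \<le> epow 1 2"
          by (intro epow_mono) auto
        with False show ?thesis by (auto simp: indicator_def intro: add_increasing2)
      qed
    qed
    also have "\<dots> = 2 * v"
      using r real by (simp add: nn_integral_add * mult_2)
    finally show ?thesis .
  qed
qed

text \<open>Plays the part of interpolation: a level set bound against a truncated square integrates
  over all levels to a strong bound. The 2 is that of \<open>nn_integral_min_square\<close>.\<close>

lemma nn_integral_le_by_levels:
  fixes u v :: "'a::euclidean_space \<Rightarrow> ennreal" and K :: ennreal
  assumes [measurable]: "u \<in> borel_measurable borel" "v \<in> borel_measurable borel"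
    and levels: "\<And>\<mu>. 0 < \<mu> \<Longrightarrow>
      emeasure lborel {x. ennreal \<mu> < u x} \<le> K * (\<integral>\<^sup>+x. epow (min 1 (v x / ennreal \<mu>)) 2 \<partial>lborel)"
  shows "(\<integral>\<^sup>+x. u x \<partial>lborel) \<le> 2 * K * (\<integral>\<^sup>+x. v x \<partial>lborel)"
proof -
  have "(\<integral>\<^sup>+x. u x \<partial>lborel) =
      (\<integral>\<^sup>+\<mu>. indicator {0<..} \<mu> * emeasure lborel {x. ennreal \<mu> < u x} \<partial>lborel)"
    by (rule nn_integral_layer_cake) fact
  also have "\<dots> \<le> (\<integral>\<^sup>+\<mu>. indicator {0<..} \<mu> * (K * (\<integral>\<^sup>+x. epow (min 1 (v x / ennreal \<mu>)) 2 \<partial>lborel)) \<partial>lborel)"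
    by (intro nn_integral_mono) (auto simp: indicator_def levels)
  also have "\<dots> = K * (\<integral>\<^sup>+\<mu>. \<integral>\<^sup>+x. indicator {0<..} \<mu> * epow (min 1 (v x / ennreal \<mu>)) 2 \<partial>lborel \<partial>lborel)"
    by (simp add: nn_integral_cmult mult.left_commute)
  also have "\<dots> = K * (\<integral>\<^sup>+x. \<integral>\<^sup>+\<mu>. indicator {0<..} \<mu> * epow (min 1 (v x / ennreal \<mu>)) 2 \<partial>lborel \<partial>lborel)"
    by (intro arg_cong[where f="(*) K"] lborel_swap) measurable
  also have "\<dots> \<le> K * (\<integral>\<^sup>+x. 2 * v x \<partial>lborel)"
    by (intro mult_left_mono nn_integral_mono nn_integral_min_square) auto
  finally show ?thesis
    by (simp add: nn_integral_cmult nn_integral_multc mult_ac)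
qed

section \<open>Densities, medians and the maximal function\<close>

lemma borel_measurable_fst_snd [measurable]:
  "fst \<in> borel_measurable (borel :: ('a::second_countable_topology \<times> 'b::second_countable_topology) measure)"
  "snd \<in> borel_measurable (borel :: ('a \<times> 'b) measure)"
  by (simp_all flip: borel_prod)

lemma emeasure_ball_scale:
  fixes y y' :: "real^'n"
  assumes "0 \<le> b" "0 \<le> t"
  shows "emeasure lborel (ball y' (b * t)) = ennreal (b ^ CARD('n)) * emeasure lborel (ball y t)"
  using assms by (simp add: emeasure_ball power_mult_distrib ennreal_mult' mult_ac)

lemma emeasure_ball_pos: "0 < t \<Longrightarrow> 0 < emeasure lborel (ball (y::real^'n) t)"
  by (simp add: emeasure_ball)

lemma emeasure_ball_finite [simp]: "emeasure lborel (ball (y::'a::euclidean_space) t) < top"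
  using emeasure_lborel_ball_finite[of y t] by (simp add: less_top)

text \<open>Density form of the weak (1,1) bound for the maximal function: the balls are only required to
  come within \<open>b\<close> times their radius of the point.\<close>

lemma emeasure_high_density_le:
  fixes U :: "(real^'n) set"
  assumes U [measurable]: "U \<in> sets borel" and b: "1 \<le> b" and c: "0 < c"
  shows "emeasure lborel {x. \<exists>z. 0 < snd z \<and> dist x (fst z) < b * snd z \<and>
      ennreal c * emeasure lborel (ball (fst z) (snd z)) < emeasure lborel (U \<inter> ball (fst z) (snd z))}
    \<le> ennreal ((5 * b) ^ CARD('n) / c) * emeasure lborel U" (is "emeasure _ ?S \<le> _")
proof (cases "emeasure lborel U = top")
  case True
  then show ?thesis using b c by (simp add: ennreal_mult_top)
next
  case False
  define \<omega> where "\<omega> = unit_ball_vol (CARD('n))"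
  have \<omega>: "0 < \<omega>" unfolding \<omega>_def by (simp add: unit_ball_vol_pos)
  define u where "u = measure lborel U"
  have u: "emeasure lborel U = ennreal u" "0 \<le> u"
    using False by (auto simp: u_def emeasure_eq_ennreal_measure)
  define K :: "((real^'n) \<times> real) set" where "K = {z. 0 < snd z \<and>
    ennreal c * emeasure lborel (ball (fst z) (snd z)) < emeasure lborel (U \<inter> ball (fst z) (snd z))}"
  \<comment> \<open>A ball in which U has density above c has volume below |U|/c, so the radii are
    bounded, as the covering lemma requires. The maximum with 1 avoids an n-th root, since t <= t^n
    for t >= 1.\<close>
  have rad: "snd z \<le> max 1 (u / (c * \<omega>))" if "z \<in> K" for z
  proof -
    have z: "0 < snd z" using that by (simp add: K_def)
    have "ennreal c * emeasure lborel (ball (fst z) (snd z)) < emeasure lborel (U \<inter> ball (fst z) (snd z))"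
      using that by (simp add: K_def)
    also have "\<dots> \<le> ennreal u"
      unfolding u(1)[symmetric] by (intro emeasure_mono) auto
    finally have "c * (\<omega> * snd z ^ CARD('n)) < u"
      using c z \<omega> u by (simp add: emeasure_ball \<omega>_def[symmetric] ennreal_less_iff flip: ennreal_mult)
    then have *: "snd z ^ CARD('n) \<le> u / (c * \<omega>)"
      using c \<omega> by (simp add: field_simps)
    show ?thesis
    proof (cases "snd z \<le> 1")
      case False
      then have "snd z \<le> snd z ^ CARD('n)"
        by (intro self_le_power) auto
      with * show ?thesis by simp
    qed simp
  qed
  \<comment> \<open>The covering lemma is applied to the dilated balls. Their disjointness passes to
    the original balls because b >= 1, and the fivefold enlargement has (5 * b)^n times the original
    volume.\<close>
  have "?S \<subseteq> (\<Union>z\<in>K. ball (fst z) (b * snd z))"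
    by (force simp: K_def dist_commute)
  moreover have "0 < b * snd z \<and> b * snd z \<le> b * max 1 (u / (c * \<omega>))" if "z \<in> K" for z
    using rad[OF that] that b by (auto simp: K_def intro!: mult_left_mono)
  ultimately obtain C where C: "countable C" "C \<subseteq> K"
     "pairwise (\<lambda>i j. disjnt (ball (fst i) (b * snd i)) (ball (fst j) (b * snd j))) C"
     "?S \<subseteq> (\<Union>i\<in>C. ball (fst i) (5 * (b * snd i)))"
    by (rule Vitali_covering_lemma_balls[where K=K and a=fst and r="\<lambda>z. b * snd z"])
  \<comment> \<open>Slices with at most one member each: indexing by natural numbers with possibly
    empty slices treats finite and infinite families alike.\<close>
  define D where "D k = {z \<in> C. to_nat_on C z = k}" for k
  have D: "z = z'" if "z \<in> D k" "z' \<in> D k" for z z' k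
    using that C(1) by (auto simp: D_def)
  define E where "E k = (\<Union>z\<in>D k. U \<inter> ball (fst z) (snd z))" for k
  define F where "F k = (\<Union>z\<in>D k. ball (fst z) (5 * b * snd z))" for k
  have sets: "E k \<in> sets borel" "F k \<in> sets borel" for k
    using C(1) by (auto simp: E_def F_def D_def intro!: sets.countable_UN'')
  have EF: "emeasure lborel (F k) \<le> ennreal ((5 * b) ^ CARD('n) / c) * emeasure lborel (E k)" for k
  proof (cases "D k = {}")
    case True
    then show ?thesis by (simp add: F_def)
  next
    case False
    then obtain z where z: "z \<in> D k" by auto
    with D[OF _ z] have Dk: "D k = {z}" by blast
    have zK: "z \<in> K" using z C(2) by (auto simp: D_def)
    have "emeasure lborel (F k) = ennreal ((5 * b) ^ CARD('n)) * emeasure lborel (ball (fst z) (snd z))"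
      using b zK emeasure_ball_scale[of "5 * b" "snd z" "fst z" "fst z"] by (simp add: F_def Dk K_def)
    also have "\<dots> = ennreal ((5 * b) ^ CARD('n) / c) * (ennreal c * emeasure lborel (ball (fst z) (snd z)))"
      using b c by (simp add: mult.assoc[symmetric] flip: ennreal_mult)
    also have "\<dots> \<le> ennreal ((5 * b) ^ CARD('n) / c) * emeasure lborel (E k)"
      using zK by (intro mult_left_mono) (auto simp: E_def Dk K_def)
    finally show ?thesis .
  qed
  have disj: "disjoint_family E"
    unfolding disjoint_family_on_def
  proof (intro ballI impI)
    fix k l :: nat assume "k \<noteq> l"
    show "E k \<inter> E l = {}"
    proof (rule ccontr)
      assume "E k \<inter> E l \<noteq> {}"
      then obtain x z z' where x: "z \<in> D k" "z' \<in> D l" "x \<in> ball (fst z) (snd z)" "x \<in> ball (fst z') (snd z')"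
        by (auto simp: E_def)
      have "snd z \<le> b * snd z" "snd z' \<le> b * snd z'"
        using x(1,2) C(2) b by (auto simp: D_def K_def intro!: mult_le_cancel_right1[THEN iffD2])
      then have "x \<in> ball (fst z) (b * snd z)" "x \<in> ball (fst z') (b * snd z')"
        using x by auto
      moreover have "z \<noteq> z'" "z \<in> C" "z' \<in> C" using x \<open>k \<noteq> l\<close> by (auto simp: D_def)
      ultimately show False
        using C(3) unfolding pairwise_def disjnt_def by blast
    qed
  qed
  have "?S \<subseteq> (\<Union>k. F k)"
  proof
    fix x assume "x \<in> ?S"
    then obtain z where "z \<in> C" "x \<in> ball (fst z) (5 * (b * snd z))"
      using C(4) by blast
    then show "x \<in> (\<Union>k. F k)"
      unfolding F_def D_def UN_iff by (intro bexI[of _ "to_nat_on C z"] bexI[of _ z]) (auto simp: mult.assoc)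
  qed
  then have "emeasure lborel ?S \<le> emeasure lborel (\<Union>k. F k)"
    by (intro emeasure_mono) (use sets in auto)
  also have "\<dots> \<le> (\<Sum>k. emeasure lborel (F k))"
    by (intro emeasure_subadditive_countably) (use sets in auto)
  also have "\<dots> \<le> (\<Sum>k. ennreal ((5 * b) ^ CARD('n) / c) * emeasure lborel (E k))"
    by (intro suminf_le EF) auto
  also have "\<dots> = ennreal ((5 * b) ^ CARD('n) / c) * (\<Sum>k. emeasure lborel (E k))"
    by simp
  also have "(\<Sum>k. emeasure lborel (E k)) = emeasure lborel (\<Union>k. E k)"
    by (intro suminf_emeasure disj) (use sets in auto)
  also have "ennreal ((5 * b) ^ CARD('n) / c) * \<dots> \<le> ennreal ((5 * b) ^ CARD('n) / c) * emeasure lborel U"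
    by (intro mult_left_mono emeasure_mono) (auto simp: E_def)
  finally show ?thesis .
qed

section \<open>Medians over balls\<close>

definition half_median :: "(real^'n \<Rightarrow> ennreal) \<Rightarrow> (real^'n) \<times> real \<Rightarrow> ennreal" where
  "half_median A z = Inf {l. 2 * emeasure lborel ({x. l < A x} \<inter> ball (fst z) (snd z))
      \<le> emeasure lborel (ball (fst z) (snd z))}"

text \<open>The infimum is attained: \<open>{x. l < A x}\<close> is the increasing union of the
  superlevel sets at l + 1/(k+1), and the half-volume bound passes to the limit by continuity from
  below.\<close>

lemma half_median_le_iff:
  assumes [measurable]: "A \<in> borel_measurable borel"
  shows "half_median A z \<le> l \<longleftrightarrow> 2 * emeasure lborel ({x. l < A x} \<inter> ball (fst z) (snd z))
      \<le> emeasure lborel (ball (fst z) (snd z))"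
proof
  assume "half_median A z \<le> l"
  show "2 * emeasure lborel ({x. l < A x} \<inter> ball (fst z) (snd z)) \<le> emeasure lborel (ball (fst z) (snd z))"
  proof (cases l)
    case (real r)
    define F where "F k = {x. ennreal (r + 1 / Suc k) < A x} \<inter> ball (fst z) (snd z)" for k
    have "2 * emeasure lborel (F k) \<le> emeasure lborel (ball (fst z) (snd z))" for k
    proof -
      have "l < ennreal (r + 1 / Suc k)"
        using real by (simp add: ennreal_less_iff)
      then have "half_median A z < ennreal (r + 1 / Suc k)"
        using \<open>half_median A z \<le> l\<close> by simp
      then obtain l' where l': "l' < ennreal (r + 1 / Suc k)"
          "2 * emeasure lborel ({x. l' < A x} \<inter> ball (fst z) (snd z)) \<le> emeasure lborel (ball (fst z) (snd z))"
        by (auto simp: half_median_def Inf_less_iff)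
      have "emeasure lborel (F k) \<le> emeasure lborel ({x. l' < A x} \<inter> ball (fst z) (snd z))"
        using l'(1) by (intro emeasure_mono) (auto simp: F_def)
      then have "2 * emeasure lborel (F k) \<le> 2 * emeasure lborel ({x. l' < A x} \<inter> ball (fst z) (snd z))"
        by (intro mult_left_mono) auto
      with l'(2) show ?thesis by simp
    qed
    then have "2 * (SUP k. emeasure lborel (F k)) \<le> emeasure lborel (ball (fst z) (snd z))"
      by (simp add: SUP_mult_left_ennreal SUP_le_iff)
    moreover have "incseq F"
    proof (rule incseq_SucI)
      fix k
      have "ennreal (r + 1 / Suc (Suc k)) \<le> ennreal (r + 1 / Suc k)"
        by (intro ennreal_leI add_left_mono divide_left_mono) auto
      then show "F k \<subseteq> F (Suc k)"
        unfolding F_def using le_less_trans by blast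
    qed
    moreover have "range F \<subseteq> sets lborel"
      by (auto simp: F_def)
    ultimately have "2 * emeasure lborel (\<Union>k. F k) \<le> emeasure lborel (ball (fst z) (snd z))"
      by (simp add: SUP_emeasure_incseq)
    moreover have "(\<Union>k. F k) = {x. l < A x} \<inter> ball (fst z) (snd z)"
    proof (intro equalityI subsetI)
      fix x assume x: "x \<in> {x. l < A x} \<inter> ball (fst z) (snd z)"
      obtain c where c: "r < c" "ennreal c \<le> A x"
      proof (cases "A x")
        case (real a)
        then show ?thesis using x \<open>l = ennreal r\<close> \<open>0 \<le> r\<close> that[of a] by (simp add: ennreal_less_iff)
      next
        case top
        then show ?thesis using that[of "r + 1"] by simp
      qed
      obtain k where "1 / Suc k < c - r"
        using nat_approx_posE[of "c - r"] c(1) by auto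
      then have "ennreal (r + 1 / Suc k) < ennreal c"
        using real c(1) by (intro ennreal_lessI) auto
      with c(2) x show "x \<in> (\<Union>k. F k)" unfolding F_def using less_le_trans by blast
    next
      fix x assume "x \<in> (\<Union>k. F k)"
      then obtain k where "ennreal (r + 1 / Suc k) < A x" "x \<in> ball (fst z) (snd z)"
        by (auto simp: F_def)
      moreover have "l \<le> ennreal (r + 1 / Suc k)"
        using real by (auto intro: ennreal_leI)
      ultimately show "x \<in> {x. l < A x} \<inter> ball (fst z) (snd z)" by auto
    qed
    ultimately show ?thesis by simp
  qed simp
qed (auto simp: half_median_def intro: Inf_lower)

lemma less_half_median_iff:
  assumes "A \<in> borel_measurable borel"
  shows "l < half_median A z \<longleftrightarrow> emeasure lborel (ball (fst z) (snd z))
      < 2 * emeasure lborel ({x. l < A x} \<inter> ball (fst z) (snd z))"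
  using half_median_le_iff[OF assms, of z l] by (simp add: not_le[symmetric])

text \<open>A superlevel set compares two integrals over x that depend measurably on z. The ball is
  encoded by the sign of \<open>snd z - dist (fst z) x\<close>, which makes the integrands jointly
  measurable.\<close>

lemma borel_measurable_half_median [measurable]:
  fixes A :: "real^'n \<Rightarrow> ennreal"
  assumes [measurable]: "A \<in> borel_measurable borel"
  shows "half_median A \<in> borel_measurable borel"
proof (rule borel_measurableI_greater)
  fix l
  have "emeasure lborel ({x. P x} \<inter> ball (fst z) (snd z)) =
      (\<integral>\<^sup>+x. indicator {x. P x} x * indicator {0<..} (snd z - dist (fst z) x) \<partial>lborel)"
    if [measurable]: "{x. P x} \<in> sets borel" for P and z :: "(real^'n) \<times> real"
  proof -
    have "emeasure lborel ({x. P x} \<inter> ball (fst z) (snd z)) =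
        (\<integral>\<^sup>+x. indicator ({x. P x} \<inter> ball (fst z) (snd z)) x \<partial>lborel)"
      by (subst nn_integral_indicator) auto
    also have "\<dots> = (\<integral>\<^sup>+x. indicator {x. P x} x * indicator {0<..} (snd z - dist (fst z) x) \<partial>lborel)"
      by (intro nn_integral_cong) (auto simp: indicator_def)
    finally show ?thesis .
  qed
  from this[of "\<lambda>_. True"] this[of "\<lambda>x. l < A x"]
  have "{z. l < half_median A z} =
    {z. (\<integral>\<^sup>+x. indicator {0<..} (snd z - dist (fst z) x) \<partial>lborel) <
      2 * (\<integral>\<^sup>+x. indicator {x. l < A x} x * indicator {0<..} (snd z - dist (fst z) x) \<partial>lborel)}"
    by (simp add: less_half_median_iff assms)
  also have "\<dots> \<in> sets borel"
    by measurable
  finally show "{z \<in> space borel. l < half_median A z} \<in> sets borel" by simp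
qed

lemma emeasure_ball_le_below_half_median:
  fixes A :: "real^'n \<Rightarrow> ennreal"
  assumes [measurable]: "A \<in> borel_measurable borel"
  shows "emeasure lborel (ball (fst z) (snd z))
    \<le> 2 * emeasure lborel {x \<in> ball (fst z) (snd z). A x \<le> half_median A z}"
proof -
  let ?B = "ball (fst z) (snd z)"
  let ?H = "{x. half_median A z < A x} \<inter> ?B" and ?L = "{x \<in> ?B. A x \<le> half_median A z}"
  have "?H \<union> ?L = ?B" "?H \<inter> ?L = {}" by auto
  then have eq: "emeasure lborel ?B = emeasure lborel ?H + emeasure lborel ?L"
    by (subst plus_emeasure) auto
  have "2 * emeasure lborel ?H \<le> emeasure lborel ?B"
    using half_median_le_iff[of A z "half_median A z"] by simp
  moreover have "2 * emeasure lborel ?B = 2 * emeasure lborel ?H + 2 * emeasure lborel ?L"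
    by (simp add: eq distrib_left)
  ultimately have "emeasure lborel ?B + emeasure lborel ?B \<le> emeasure lborel ?B + 2 * emeasure lborel ?L"
    by (simp add: mult_2[of "emeasure lborel ?B", symmetric] add_right_mono)
  then show ?thesis
    using emeasure_ball_finite[of "fst z" "snd z"] 
    by (subst (asm) ennreal_add_left_cancel_le) (auto simp del: emeasure_ball_finite simp: less_top)
qed

lemma nn_integral_powr_unit_interval:
  assumes "0 \<le> \<theta>" "\<theta> < 1"
  shows "(\<integral>\<^sup>+\<mu>. indicator {0..1} \<mu> * ennreal (\<mu> powr - \<theta>) \<partial>lborel) = ennreal (1 / (1 - \<theta>))"
proof -
  have "((\<lambda>x. x powr - \<theta>) has_integral (1 powr (- \<theta> + 1) / (- \<theta> + 1))) {0..1}"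
    using assms by (intro has_integral_powr_from_0) auto
  from nn_integral_has_integral_lebesgue[OF _ this] show ?thesis
    by (simp add: ennreal_mult' ennreal_indicator)
qed

text \<open>A maximal function of the indicator of U, taken over the b-fold dilates of the balls
  that contain x. Such dilates appear when a cone of aperture b is compared with one of aperture
  1.\<close>

definition density_max :: "real \<Rightarrow> (real^'n) set \<Rightarrow> real^'n \<Rightarrow> ennreal" where
  "density_max b U x = (SUP z\<in>cone x.
     emeasure lborel (U \<inter> ball (fst z) (b * snd z)) / emeasure lborel (ball (fst z) (b * snd z)))"

lemma mem_cone_iff: "z \<in> cone x \<longleftrightarrow> dist (fst z) x < snd z"
  unfolding cone_def using le_less_trans[OF zero_le_dist, of "fst z" x "snd z"] by (auto simp: split_beta)

lemma cone_imp_pos: "z \<in> cone x \<Longrightarrow> 0 < snd z"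
  by (auto simp: cone_def)

lemma open_cone_fiber: "open {x. z \<in> cone x}"
  unfolding mem_cone_iff by (intro open_Collect_less continuous_intros)

lemma borel_measurable_SUP_open:
  fixes F :: "'a::topological_space \<Rightarrow> 'b set"
  assumes "\<And>z. open {x. z \<in> F x}"
  shows "(\<lambda>x. SUP z\<in>F x. g z :: ennreal) \<in> borel_measurable borel"
proof (rule borel_measurableI_greater)
  fix c
  have "{x. c < (SUP z\<in>F x. g z)} = (\<Union>z\<in>{z. c < g z}. {x. z \<in> F x})"
    by (auto simp: less_SUP_iff)
  moreover have "open \<dots>"
    using assms by (intro open_UN) auto
  ultimately show "{x \<in> space borel. c < (SUP z\<in>F x. g z)} \<in> sets borel"
    by simp
qed

lemma borel_measurable_density_max [measurable]: "density_max b U \<in> borel_measurable borel"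
  unfolding density_max_def[abs_def] by (intro borel_measurable_SUP_open open_cone_fiber)

lemma density_max_le_1: "0 < b \<Longrightarrow> density_max b U x \<le> 1"
  unfolding density_max_def
  by (intro SUP_least divide_le_posI_ennreal emeasure_ball_pos mult_pos_pos)
    (auto intro: emeasure_mono cone_imp_pos)

text \<open>As b >= 1, the dilated ball still contains x, so the density estimate applies directly
  at radius b * t. This keeps the constant free of b.\<close>

lemma emeasure_density_max_level_le:
  fixes U :: "(real^'n) set"
  assumes U: "U \<in> sets borel" and b: "1 \<le> b" and c: "0 < c"
  shows "emeasure lborel {x. ennreal c < density_max b U x} \<le> ennreal (5 ^ CARD('n) / c) * emeasure lborel U"
proof -
  let ?S = "{x. \<exists>z. 0 < snd z \<and> dist x (fst z) < 1 * snd z \<and>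
      ennreal c * emeasure lborel (ball (fst z) (snd z)) < emeasure lborel (U \<inter> ball (fst z) (snd z))}"
  have S: "?S \<in> sets borel"
    by (intro borel_open open_Collect_conj open_Collect_ex open_Collect_less continuous_intros open_Collect_const)
  have "{x. ennreal c < density_max b U x} \<subseteq> ?S"
  proof
    fix x assume "x \<in> {x. ennreal c < density_max b U x}"
    then obtain z where z: "z \<in> cone x"
      "ennreal c < emeasure lborel (U \<inter> ball (fst z) (b * snd z)) / emeasure lborel (ball (fst z) (b * snd z))"
      by (auto simp: density_max_def less_SUP_iff)
    have z0: "0 < snd z" using z(1) by (rule cone_imp_pos)
    have "ennreal c * emeasure lborel (ball (fst z) (b * snd z)) < emeasure lborel (U \<inter> ball (fst z) (b * snd z))"
    proof (rule ccontr)
      assume "\<not> ?thesis"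
      then have "emeasure lborel (U \<inter> ball (fst z) (b * snd z)) / emeasure lborel (ball (fst z) (b * snd z)) \<le> ennreal c"
        using z0 b by (intro divide_le_posI_ennreal emeasure_ball_pos mult_pos_pos) (auto simp: not_less mult.commute)
      with z(2) show False by simp
    qed
    moreover have "snd z \<le> b * snd z"
      using z0 b by simp
    then have "dist x (fst z) < 1 * (b * snd z)"
      using z(1) by (simp add: mem_cone_iff dist_commute)
    moreover have "0 < b * snd z" using z0 b by simp
    ultimately show "x \<in> ?S"
      by (intro CollectI exI[of _ "(fst z, b * snd z)"]) simp
  qed
  then have "emeasure lborel {x. ennreal c < density_max b U x} \<le> emeasure lborel ?S"
    using S by (intro emeasure_mono) auto
  also have "\<dots> \<le> ennreal ((5 * 1) ^ CARD('n) / c) * emeasure lborel U"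
    using c by (intro emeasure_high_density_le U) auto
  finally show ?thesis by simp
qed

text \<open>Densities never exceed 1, so only levels below 1 count. There the weak bound gives \<mu>
  powr (-1/p), which is integrable on the unit interval because p > 1.\<close>

lemma nn_integral_density_max_le:
  fixes U :: "(real^'n) set"
  assumes U: "U \<in> sets borel" and b: "1 \<le> b" and p: "1 < p"
  shows "(\<integral>\<^sup>+x. epow (density_max b U x) p \<partial>lborel)
    \<le> ennreal (5 ^ CARD('n) * (1 / (1 - 1 / p))) * emeasure lborel U"
proof -
  have *: "indicator {0<..} \<mu> * emeasure lborel {x. ennreal \<mu> < epow (density_max b U x) p}
      \<le> ennreal (5 ^ CARD('n)) * emeasure lborel U * (indicator {0..1} \<mu> * ennreal (\<mu> powr - (1 / p)))" for \<mu>
  proof (cases "0 < \<mu> \<and> \<mu> < 1")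
    case True
    have "{x. ennreal \<mu> < epow (density_max b U x) p} = {x. ennreal (\<mu> powr (1 / p)) < density_max b U x}"
      using True p by (simp add: less_epow_iff epow_ennreal)
    then have "emeasure lborel {x. ennreal \<mu> < epow (density_max b U x) p} \<le>
        ennreal (5 ^ CARD('n) / \<mu> powr (1 / p)) * emeasure lborel U"
      using True by (simp add: emeasure_density_max_level_le U b)
    then show ?thesis
      using True by (simp add: powr_minus_divide mult_ac flip: ennreal_mult)
  next
    case False
    have "epow (density_max b U x) p \<le> 1" for x
      using epow_mono[OF density_max_le_1, of b p U x] b p by simp
    then have "{x. ennreal \<mu> < epow (density_max b U x) p} = {}" if "1 \<le> \<mu>"
      using ennreal_leI[OF that] by (auto simp: not_less ennreal_1[symmetric] simp del: ennreal_1 intro: order_trans)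
    with False show ?thesis by (cases "0 < \<mu>") auto
  qed
  have "(\<integral>\<^sup>+x. epow (density_max b U x) p \<partial>lborel) =
      (\<integral>\<^sup>+\<mu>. indicator {0<..} \<mu> * emeasure lborel {x. ennreal \<mu> < epow (density_max b U x) p} \<partial>lborel)"
    by (rule nn_integral_layer_cake) measurable
  also have "\<dots> \<le> (\<integral>\<^sup>+\<mu>. ennreal (5 ^ CARD('n)) * emeasure lborel U * (indicator {0..1} \<mu> * ennreal (\<mu> powr - (1 / p))) \<partial>lborel)"
    by (intro nn_integral_mono *)
  also have "\<dots> = ennreal (5 ^ CARD('n)) * emeasure lborel U * ennreal (1 / (1 - 1 / p))"
    using p nn_integral_powr_unit_interval[of "1 / p"] by (subst nn_integral_cmult) auto
  also have "\<dots> = ennreal (5 ^ CARD('n) * (1 / (1 - 1 / p))) * emeasure lborel U"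
    by (subst ennreal_mult') (simp_all only: mult_ac zero_le_power zero_le_numeral)
  finally show ?thesis .
qed

text \<open>The threshold is b = \<epsilon> * M powr (1/\<sigma>). Below it the first term
  dominates. Above it, M <= 1 gives M <= (M powr (1/\<sigma>)) powr (\<sigma> - 1), which is at most
  (b/\<epsilon>) powr (\<sigma> - 1). The exponent 1 + 1/\<sigma> exceeds 1, so the maximal function
  can be integrated to that power.\<close>

lemma young_dominated:
  fixes b M :: ennreal
  assumes "M \<le> 1" "1 \<le> \<sigma>" "0 < \<epsilon>"
  shows "b * M \<le> ennreal \<epsilon> * epow M (1 + 1 / \<sigma>) + ennreal (\<epsilon> powr (1 - \<sigma>)) * epow b \<sigma>"
proof (cases b)
  case top
  then show ?thesis using assms(3) by (simp add: ennreal_mult_top)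
next
  case (real r)
  obtain m where m: "M = ennreal m" "0 \<le> m" "m \<le> 1"
    using assms(1) by (cases M) (auto simp: top_unique)
  have "r * m \<le> \<epsilon> * m powr (1 + 1 / \<sigma>) + \<epsilon> powr (1 - \<sigma>) * r powr \<sigma>"
  proof (cases "r \<le> \<epsilon> * m powr (1 / \<sigma>)")
    case True
    then have "r * m \<le> \<epsilon> * m powr (1 / \<sigma>) * m"
      using m by (intro mult_right_mono) auto
    also have "\<dots> = \<epsilon> * m powr (1 + 1 / \<sigma>)"
      using m by (cases "m = 0") (auto simp: powr_add)
    finally show ?thesis by (simp add: add_increasing2)
  next
    case False
    have r: "0 < r"
      using False assms(3) real(1) by (metis less_eq_real_def mult_nonneg_nonneg powr_ge_zero)
    have "m = (m powr (1 / \<sigma>)) powr \<sigma>"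
      using m assms(2) by (simp add: powr_powr)
    also have "\<dots> \<le> (m powr (1 / \<sigma>)) powr (\<sigma> - 1)"
      using m assms(2) by (intro powr_mono') (auto simp: powr_le1)
    also have "\<dots> \<le> (r / \<epsilon>) powr (\<sigma> - 1)"
      using False assms m by (intro powr_mono2) (auto simp: field_simps)
    finally have "r * m \<le> r * (r / \<epsilon>) powr (\<sigma> - 1)"
      using r by (intro mult_left_mono) auto
    also have "\<dots> = \<epsilon> powr (1 - \<sigma>) * r powr \<sigma>"
      using r assms(3) by (simp add: powr_divide powr_diff field_simps)
    finally show ?thesis
      using assms(3) by (simp add: add_increasing)
  qed
  then show ?thesis
    using real m assms(3) by (simp add: epow_ennreal flip: ennreal_mult ennreal_plus)
qed

section \<open>Change of aperture\<close>

lemma epow_antimono_exp: "x \<le> 1 \<Longrightarrow> \<tau> \<le> \<sigma> \<Longrightarrow> epow x \<sigma> \<le> epow x \<tau>"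
  by (cases x) (auto simp: epow_ennreal top_unique intro!: ennreal_leI powr_mono')

definition wide_cone :: "real \<Rightarrow> real^'n \<Rightarrow> ((real^'n) \<times> real) set" where
  "wide_cone b x = {z. dist (fst z) x < b * snd z}"

lemma wide_cone_1: "wide_cone 1 x = cone x"
  by (auto simp: wide_cone_def mem_cone_iff)

lemma measurable_indicator_wide_cone [measurable (raw)]:
  assumes [measurable]: "f \<in> borel_measurable M" "g \<in> borel_measurable M"
  shows "(\<lambda>w. indicator (wide_cone b (f w)) (g w) :: ennreal) \<in> borel_measurable M"
proof -
  have "(\<lambda>w. indicator (wide_cone b (f w)) (g w) :: ennreal) =
      (\<lambda>w. indicator {0<..} (b * snd (g w) - dist (fst (g w)) (f w)))"
    by (auto simp: wide_cone_def indicator_def)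
  also have "\<dots> \<in> borel_measurable M" by measurable
  finally show ?thesis .
qed

definition cone_area :: "real \<Rightarrow> ((real^'n) \<times> real \<Rightarrow> ennreal) \<Rightarrow> real^'n \<Rightarrow> ennreal" where
  "cone_area b G x = (\<integral>\<^sup>+z. indicator (wide_cone b x) z * G z \<partial>lborel)"

lemma borel_measurable_cone_area [measurable]:
  assumes [measurable]: "G \<in> borel_measurable borel"
  shows "cone_area b G \<in> borel_measurable borel"
  unfolding cone_area_def[abs_def] by measurable

text \<open>The density of U in the dilated ball is a single number, bounded by the maximal function
  at every x of the undilated ball. Integrating it over the half below the median recovers the
  measure, with b^n from the dilation and 2 from the half.\<close>

lemma emeasure_Int_ball_le_density_max:
  fixes A :: "real^'n \<Rightarrow> ennreal" and z :: "(real^'n) \<times> real"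
  assumes [measurable]: "A \<in> borel_measurable borel" and U: "U \<in> sets borel" and b: "1 \<le> b" and z: "0 < snd z"
  shows "emeasure lborel (U \<inter> ball (fst z) (b * snd z)) \<le> ennreal (2 * b ^ CARD('n)) *
    (\<integral>\<^sup>+x. indicator {x \<in> ball (fst z) (snd z). A x \<le> half_median A z} x * density_max b U x \<partial>lborel)"
proof -
  let ?E = "{x \<in> ball (fst z) (snd z). A x \<le> half_median A z}"
  let ?B = "ball (fst z) (b * snd z)"
  define r where "r = emeasure lborel (U \<inter> ?B) / emeasure lborel ?B"
  have B: "emeasure lborel ?B \<noteq> 0" "emeasure lborel ?B \<noteq> top"
    using emeasure_ball_pos[of "b * snd z" "fst z"] b z emeasure_ball_finite[of "fst z" "b * snd z"]
    by (auto simp del: emeasure_ball_finite)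
  have "emeasure lborel (U \<inter> ?B) = r * emeasure lborel ?B"
    using B by (simp add: r_def ennreal_divide_times ennreal_mult_divide_eq)
  also have "emeasure lborel ?B = ennreal (b ^ CARD('n)) * emeasure lborel (ball (fst z) (snd z))"
    using b z by (intro emeasure_ball_scale) auto
  also have "r * \<dots> \<le> r * (ennreal (b ^ CARD('n)) * (2 * emeasure lborel ?E))"
    by (intro mult_left_mono emeasure_ball_le_below_half_median) auto
  also have "\<dots> = ennreal (2 * b ^ CARD('n)) * (\<integral>\<^sup>+x. r * indicator ?E x \<partial>lborel)"
    using b by (subst nn_integral_cmult_indicator) (auto simp: ennreal_mult' mult_ac)
  also have "\<dots> \<le> ennreal (2 * b ^ CARD('n)) * (\<integral>\<^sup>+x. indicator ?E x * density_max b U x \<partial>lborel)"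
  proof (intro mult_left_mono nn_integral_mono)
    fix x
    have "r \<le> density_max b U x" if "x \<in> ?E"
      unfolding r_def density_max_def using that by (intro SUP_upper) (auto simp: mem_cone_iff)
    then show "r * indicator ?E x \<le> indicator ?E x * density_max b U x"
      by (auto simp: indicator_def)
  qed simp
  finally show ?thesis .
qed

lemma measurable_indicator_ball_below_median [measurable (raw)]:
  fixes A :: "real^'n \<Rightarrow> ennreal"
  assumes [measurable]: "A \<in> borel_measurable borel" "f \<in> borel_measurable M" "g \<in> borel_measurable M"
  shows "(\<lambda>w. indicator {x \<in> ball (fst (f w)) (snd (f w)). A x \<le> half_median A (f w)} (g w) :: ennreal)
    \<in> borel_measurable M"
proof -
  have "(\<lambda>w. indicator {x \<in> ball (fst (f w)) (snd (f w)). A x \<le> half_median A (f w)} (g w) :: ennreal) =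
      (\<lambda>w. indicator {0<..} (snd (f w) - dist (fst (f w)) (g w)) *
        (if A (g w) \<le> half_median A (f w) then 1 else 0))"
    by (auto simp: indicator_def)
  also have "\<dots> \<in> borel_measurable M" by measurable
  finally show ?thesis .
qed

text \<open>Here \<open>G\<close> is cut off where the median of its area function exceeds \<open>l\<close>. By Tonelli the integral
  of the wide area function over \<open>U\<close> can be moved to the points where the ordinary area function is
  below the median, at the price of the maximal function of \<open>U\<close>, which Young's inequality absorbs.\<close>

lemma emeasure_subset_wide_level_le:
  fixes G :: "(real^'n) \<times> real \<Rightarrow> ennreal"
  assumes [measurable]: "G \<in> borel_measurable borel" and b: "1 \<le> b" and \<sigma>: "1 < \<sigma>" and l: "0 < l"
    and G1: "G1 = (\<lambda>z. if half_median (cone_area 1 G) z \<le> ennreal l then G z else 0)"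
    and C: "C = 5 ^ CARD('n) * (1 / (1 - 1 / (1 + 1 / \<sigma>)))"
    and U [measurable]: "U \<in> sets borel" and U_fin: "emeasure lborel U < top"
    and U_sub: "\<And>x. x \<in> U \<Longrightarrow> ennreal l < cone_area b G1 x"
  shows "emeasure lborel U \<le> ennreal (4 * b ^ CARD('n) * (1 / (4 * b ^ CARD('n) * C)) powr (1 - \<sigma>)) *
    (\<integral>\<^sup>+x. epow (min 1 (cone_area 1 G x / ennreal l)) \<sigma> \<partial>lborel)"
proof -
  define a where "a = cone_area 1 G"
  have [measurable]: "a \<in> borel_measurable borel" unfolding a_def by measurable
  have [measurable]: "G1 \<in> borel_measurable borel" unfolding G1 by measurable
  define M where "M = density_max b U"
  have [measurable]: "M \<in> borel_measurable borel" unfolding M_def by measurable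
  define E where "E z = {x \<in> ball (fst z) (snd z). a x \<le> half_median a z}" for z
  have [measurable]: "(\<lambda>w. indicator (E (f w)) (g w) :: ennreal) \<in> borel_measurable N"
    if [measurable]: "f \<in> borel_measurable N" "g \<in> borel_measurable N" for f g and N :: "'b measure"
    unfolding E_def by measurable
  let ?v = "\<lambda>x. min 1 (a x / ennreal l)"
  let ?I = "\<integral>\<^sup>+x. epow (?v x) \<sigma> \<partial>lborel"
  have C0: "0 < C" using \<sigma> by (simp add: C field_simps add_pos_pos)
  have "ennreal l * emeasure lborel U = (\<integral>\<^sup>+x. ennreal l * indicator U x \<partial>lborel)"
    by (simp add: nn_integral_cmult_indicator)
  also have "\<dots> \<le> (\<integral>\<^sup>+x. indicator U x * cone_area b G1 x \<partial>lborel)"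
    using U_sub by (intro nn_integral_mono) (auto simp: indicator_def intro: less_imp_le)
  also have "\<dots> = (\<integral>\<^sup>+x. \<integral>\<^sup>+z. indicator U x * (indicator (wide_cone b x) z * G1 z) \<partial>lborel \<partial>lborel)"
    by (simp add: cone_area_def nn_integral_cmult)
  also have "\<dots> = (\<integral>\<^sup>+z. \<integral>\<^sup>+x. indicator U x * (indicator (wide_cone b x) z * G1 z) \<partial>lborel \<partial>lborel)"
    by (rule lborel_swap) measurable
  also have "\<dots> = (\<integral>\<^sup>+z. G1 z * emeasure lborel (U \<inter> ball (fst z) (b * snd z)) \<partial>lborel)"
  proof (intro nn_integral_cong)
    fix z
    have "(\<integral>\<^sup>+x. indicator U x * (indicator (wide_cone b x) z * G1 z) \<partial>lborel) =
        (\<integral>\<^sup>+x. G1 z * indicator (U \<inter> ball (fst z) (b * snd z)) x \<partial>lborel)"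
      by (intro nn_integral_cong) (auto simp: indicator_def wide_cone_def)
    then show "(\<integral>\<^sup>+x. indicator U x * (indicator (wide_cone b x) z * G1 z) \<partial>lborel) =
        G1 z * emeasure lborel (U \<inter> ball (fst z) (b * snd z))"
      by (simp add: nn_integral_cmult_indicator)
  qed
  also have "\<dots> \<le> (\<integral>\<^sup>+z. G1 z * (ennreal (2 * b ^ CARD('n)) * (\<integral>\<^sup>+x. indicator (E z) x * M x \<partial>lborel)) \<partial>lborel)"
  proof (intro nn_integral_mono mult_left_mono)
    fix z
    show "emeasure lborel (U \<inter> ball (fst z) (b * snd z))
        \<le> ennreal (2 * b ^ CARD('n)) * (\<integral>\<^sup>+x. indicator (E z) x * M x \<partial>lborel)"
    proof (cases "0 < snd z")
      case True
      then show ?thesis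
        unfolding E_def M_def by (intro emeasure_Int_ball_le_density_max b U) measurable
    next
      case False
      then have "b * snd z \<le> 0" using b by (simp add: mult_nonneg_nonpos)
      then show ?thesis by (simp add: ball_empty)
    qed
  qed simp
  also have "\<dots> = ennreal (2 * b ^ CARD('n)) * (\<integral>\<^sup>+z. \<integral>\<^sup>+x. G1 z * (indicator (E z) x * M x) \<partial>lborel \<partial>lborel)"
    by (subst nn_integral_cmult[symmetric], measurable) (simp add: nn_integral_cmult mult.left_commute)
  also have "(\<integral>\<^sup>+z. \<integral>\<^sup>+x. G1 z * (indicator (E z) x * M x) \<partial>lborel \<partial>lborel) =
      (\<integral>\<^sup>+x. \<integral>\<^sup>+z. G1 z * (indicator (E z) x * M x) \<partial>lborel \<partial>lborel)"
    by (rule lborel_swap) measurable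
  also have "\<dots> \<le> (\<integral>\<^sup>+x. ennreal l * (?v x * M x) \<partial>lborel)"
  proof (intro nn_integral_mono)
    fix x
    have "(\<integral>\<^sup>+z. G1 z * (indicator (E z) x * M x) \<partial>lborel) = (\<integral>\<^sup>+z. G1 z * indicator (E z) x \<partial>lborel) * M x"
      by (subst nn_integral_multc[symmetric]) (auto simp: mult.assoc)
    moreover have "(\<integral>\<^sup>+z. G1 z * indicator (E z) x \<partial>lborel) \<le> ennreal l * ?v x"
    proof (cases "a x \<le> ennreal l")
      case True
      have "(\<integral>\<^sup>+z. G1 z * indicator (E z) x \<partial>lborel) \<le> a x"
        unfolding a_def cone_area_def by (intro nn_integral_mono)
          (auto simp: indicator_def E_def G1 wide_cone_1 mem_cone_iff)
      also have "a x = ennreal l * (a x / ennreal l)"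
        using l by (simp add: ennreal_times_divide mult.commute[of "ennreal l"] ennreal_mult_divide_eq)
      also have "a x / ennreal l = ?v x"
        using True l by (intro min_absorb2[symmetric] divide_le_posI_ennreal) auto
      finally show ?thesis .
    next
      \<comment> \<open>The purpose of the cut-off: x in \<open>E z\<close> gives \<open>a x\<close>
        <= \<open>half_median a z\<close>, and this is at most l wherever \<open>G1 z\<close> is
        nonzero. So points above level l contribute nothing.\<close>
      case False
      then have "G1 z * indicator (E z) x = 0" for z
        by (auto simp: indicator_def E_def G1 a_def dest: order_trans)
      then show ?thesis by (simp only: nn_integral_const mult_zero_left zero_le)
    qed
    ultimately show "(\<integral>\<^sup>+z. G1 z * (indicator (E z) x * M x) \<partial>lborel) \<le> ennreal l * (?v x * M x)"
      by (simp add: mult.assoc[symmetric] mult_right_mono)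
  qed
  also have "\<dots> = ennreal l * (\<integral>\<^sup>+x. ?v x * M x \<partial>lborel)"
    by (intro nn_integral_cmult) measurable
  finally have "ennreal l * emeasure lborel U \<le>
      ennreal l * (ennreal (2 * b ^ CARD('n)) * (\<integral>\<^sup>+x. ?v x * M x \<partial>lborel))"
    by (simp add: mult_left_mono mult.left_commute)
  then have "emeasure lborel U \<le> ennreal (2 * b ^ CARD('n)) * (\<integral>\<^sup>+x. ?v x * M x \<partial>lborel)"
    using l by (subst (asm) ennreal_mult_le_mult_iff) auto
  also have "\<dots> \<le> ennreal (2 * b ^ CARD('n)) *
      (ennreal \<epsilon> * (ennreal C * emeasure lborel U) + ennreal (\<epsilon> powr (1 - \<sigma>)) * ?I)"
    if \<epsilon>: "0 < \<epsilon>" for \<epsilon>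
  proof (intro mult_left_mono)
    have "(\<integral>\<^sup>+x. ?v x * M x \<partial>lborel) \<le>
        (\<integral>\<^sup>+x. ennreal \<epsilon> * epow (M x) (1 + 1 / \<sigma>) + ennreal (\<epsilon> powr (1 - \<sigma>)) * epow (?v x) \<sigma> \<partial>lborel)"
      using b \<sigma> \<epsilon> by (intro nn_integral_mono young_dominated) (auto simp: M_def density_max_le_1)
    also have "\<dots> = ennreal \<epsilon> * (\<integral>\<^sup>+x. epow (M x) (1 + 1 / \<sigma>) \<partial>lborel) + ennreal (\<epsilon> powr (1 - \<sigma>)) * ?I"
      by (simp add: nn_integral_add nn_integral_cmult)
    also have "(\<integral>\<^sup>+x. epow (M x) (1 + 1 / \<sigma>) \<partial>lborel) \<le> ennreal C * emeasure lborel U"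
      unfolding M_def C using \<sigma> b by (intro nn_integral_density_max_le U) auto
    finally show "(\<integral>\<^sup>+x. ?v x * M x \<partial>lborel) \<le>
        ennreal \<epsilon> * (ennreal C * emeasure lborel U) + ennreal (\<epsilon> powr (1 - \<sigma>)) * ?I"
      by (simp add: add_right_mono mult_left_mono)
  qed simp
  finally have *: "emeasure lborel U \<le> ennreal (2 * b ^ CARD('n)) *
      (ennreal \<epsilon> * (ennreal C * emeasure lborel U) + ennreal (\<epsilon> powr (1 - \<sigma>)) * ?I)" if "0 < \<epsilon>" for \<epsilon>
    using that by blast
  \<comment> \<open>Chosen so that the maximal function term is exactly half the measure of U; since
    that measure is finite, it can be subtracted.\<close>
  define \<epsilon> where "\<epsilon> = 1 / (4 * b ^ CARD('n) * C)"
  have \<epsilon>: "0 < \<epsilon>" "2 * b ^ CARD('n) * \<epsilon> * C = 1 / 2"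
    using C0 b by (auto simp: \<epsilon>_def field_simps)
  have "2 * emeasure lborel U \<le> 2 * (ennreal (2 * b ^ CARD('n)) *
      (ennreal \<epsilon> * (ennreal C * emeasure lborel U) + ennreal (\<epsilon> powr (1 - \<sigma>)) * ?I))"
    by (intro mult_left_mono * \<epsilon>) auto
  also have "\<dots> = ennreal (2 * (2 * b ^ CARD('n) * \<epsilon> * C)) * emeasure lborel U +
      ennreal (4 * b ^ CARD('n) * \<epsilon> powr (1 - \<sigma>)) * ?I"
    using b \<epsilon>(1) C0 by (simp add: distrib_left ennreal_mult' mult.assoc)
  finally have "emeasure lborel U + emeasure lborel U \<le> emeasure lborel U +
      ennreal (4 * b ^ CARD('n) * \<epsilon> powr (1 - \<sigma>)) * ?I"
    unfolding \<epsilon>(2) by (simp add: mult_2)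
  then show ?thesis
    using U_fin by (subst (asm) ennreal_add_left_cancel_le) (auto simp: \<epsilon>_def a_def)
qed

lemma open_near_balls: "open {x. \<exists>z. 0 < snd z \<and> dist x (fst z) < b * snd z \<and> P z}"
  by (intro open_Collect_conj open_Collect_ex open_Collect_less continuous_intros open_Collect_const)

text \<open>A median above l at z means that \<open>{x. l < A x}\<close> has density above 1/2 in
  the ball of z. Hence the density estimate with c = 1/2, which also produces the factor 2.\<close>

lemma emeasure_near_high_median_le:
  fixes A :: "real^'n \<Rightarrow> ennreal"
  assumes [measurable]: "A \<in> borel_measurable borel" and b: "1 \<le> b"
  shows "emeasure lborel {x. \<exists>z. 0 < snd z \<and> dist x (fst z) < b * snd z \<and> l < half_median A z}
    \<le> ennreal (2 * (5 * b) ^ CARD('n)) * emeasure lborel {x. l < A x}" (is "emeasure _ ?S \<le> _")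
proof -
  let ?U = "{x. l < A x}"
  let ?T = "{x. \<exists>z. 0 < snd z \<and> dist x (fst z) < b * snd z \<and>
      ennreal (1 / 2) * emeasure lborel (ball (fst z) (snd z)) < emeasure lborel (?U \<inter> ball (fst z) (snd z))}"
  have half: "ennreal (1 / 2) * X < Y" if "X < 2 * Y" for X Y :: ennreal
  proof (rule ccontr)
    assume "\<not> ?thesis"
    then have "2 * Y \<le> 2 * (ennreal (1 / 2) * X)"
      by (intro mult_left_mono) auto
    also have "\<dots> = ennreal (2 * (1 / 2)) * X"
      by (subst ennreal_mult') (auto simp: mult.assoc)
    also have "\<dots> = X"
      by simp
    finally show False using that by simp
  qed
  have "?S \<subseteq> ?T"
    using half by (fastforce simp: less_half_median_iff)
  then have "emeasure lborel ?S \<le> emeasure lborel ?T"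
    by (rule emeasure_mono) (simp only: sets_lborel, intro borel_open open_near_balls)
  also have "\<dots> \<le> ennreal ((5 * b) ^ CARD('n) / (1 / 2)) * emeasure lborel ?U"
    by (intro emeasure_high_density_le b) auto
  finally show ?thesis by (simp add: mult.commute)
qed

lemma emeasure_level_le_nn_integral_min:
  fixes a :: "'a::euclidean_space \<Rightarrow> ennreal"
  assumes [measurable]: "a \<in> borel_measurable borel" and l: "0 < l"
  shows "emeasure lborel {x. ennreal l < a x} \<le> (\<integral>\<^sup>+x. epow (min 1 (a x / ennreal l)) \<sigma> \<partial>lborel)"
proof -
  have "emeasure lborel {x. ennreal l < a x} = (\<integral>\<^sup>+x. indicator {x. ennreal l < a x} x \<partial>lborel)"
    by (subst nn_integral_indicator) auto
  also have "\<dots> \<le> (\<integral>\<^sup>+x. epow (min 1 (a x / ennreal l)) \<sigma> \<partial>lborel)"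
  proof (intro nn_integral_mono)
    fix x
    have "1 \<le> a x / ennreal l" if "ennreal l < a x"
    proof -
      have "1 = ennreal l / ennreal l"
        using l by (simp add: divide_ennreal)
      also have "\<dots> \<le> a x / ennreal l"
        using that by (intro divide_right_mono_ennreal) auto
      finally show ?thesis .
    qed
    then show "indicator {x. ennreal l < a x} x \<le> epow (min 1 (a x / ennreal l)) \<sigma>"
      by (auto simp: indicator_def min_absorb1)
  qed
  finally show ?thesis .
qed

text \<open>Points x are split by whether their wide cone meets a place where the median exceeds l.
  If it does, x lies in the set controlled by \<open>emeasure_near_high_median_le\<close>; if not,
  cutting G off leaves the wide area at x unchanged and the absorption argument applies.\<close>

lemma emeasure_wide_level_le:
  assumes b: "1 \<le> b" and \<sigma>: "1 < \<sigma>"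
  shows "\<exists>K::real. \<forall>(G :: (real^'n) \<times> real \<Rightarrow> ennreal) l. G \<in> borel_measurable borel \<longrightarrow> 0 < l \<longrightarrow>
    emeasure lborel {x. ennreal l < cone_area b G x} \<le>
    ennreal K * (\<integral>\<^sup>+x. epow (min 1 (cone_area 1 G x / ennreal l)) \<sigma> \<partial>lborel)"
proof -
  define C where "C = 5 ^ CARD('n) * (1 / (1 - 1 / (1 + 1 / \<sigma>)))"
  define K1 where "K1 = 4 * b ^ CARD('n) * (1 / (4 * b ^ CARD('n) * C)) powr (1 - \<sigma>)"
  define K2 where "K2 = 2 * (5 * b) ^ CARD('n)"
  have K: "0 \<le> K1" "0 \<le> K2" using b by (auto simp: K1_def K2_def)
  have "emeasure lborel {x. ennreal l < cone_area b G x} \<le>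
      ennreal (K1 + K2) * (\<integral>\<^sup>+x. epow (min 1 (cone_area 1 G x / ennreal l)) \<sigma> \<partial>lborel)"
    if [measurable]: "G \<in> borel_measurable borel" and l: "0 < l"
    for G :: "(real^'n) \<times> real \<Rightarrow> ennreal" and l
  proof -
    let ?I = "\<integral>\<^sup>+x. epow (min 1 (cone_area 1 G x / ennreal l)) \<sigma> \<partial>lborel"
    define G1 where "G1 = (\<lambda>z. if half_median (cone_area 1 G) z \<le> ennreal l then G z else 0)"
    have [measurable]: "G1 \<in> borel_measurable borel" unfolding G1_def by measurable
    let ?S = "{x. ennreal l < cone_area b G1 x}"
    let ?T = "{x. \<exists>z. 0 < snd z \<and> dist x (fst z) < b * snd z \<and> ennreal l < half_median (cone_area 1 G) z}"
    have S: "?S \<in> sets borel" by measurable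
    have T: "?T \<in> sets borel" by (intro borel_open open_near_balls)
    \<comment> \<open>Balls supply the finite measure needed for the absorption; the bound is
      independent of the ball, so a monotone limit removes it.\<close>
    have part: "emeasure lborel (?S \<inter> ball 0 (real k)) \<le> ennreal K1 * ?I" for k
    proof -
      have "emeasure lborel (?S \<inter> ball 0 (real k)) \<le> emeasure lborel (ball (0::real^'n) (real k))"
        by (intro emeasure_mono) auto
      also have "\<dots> < top" by simp
      finally show ?thesis
        unfolding K1_def using S
        by (intro emeasure_subset_wide_level_le[OF _ b \<sigma> l G1_def C_def]) auto
    qed
    have "emeasure lborel (\<Union>k. ?S \<inter> ball 0 (real k)) = (SUP k. emeasure lborel (?S \<inter> ball 0 (real k)))"
      using S by (intro SUP_emeasure_incseq[symmetric] incseq_SucI) auto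
    also have "(\<Union>k. ?S \<inter> ball 0 (real k)) = ?S"
      using reals_Archimedean2 by fastforce
    finally have S_le: "emeasure lborel ?S \<le> ennreal K1 * ?I"
      using part by (simp add: SUP_le_iff)
    have "{x. ennreal l < cone_area b G x} \<subseteq> ?S \<union> ?T"
    proof
      fix x assume x: "x \<in> {x. ennreal l < cone_area b G x}"
      show "x \<in> ?S \<union> ?T"
      proof (cases "x \<in> ?T")
        case False
        have "indicator (wide_cone b x) z * G z = indicator (wide_cone b x) z * G1 z" for z
        proof (cases "z \<in> wide_cone b x")
          case True
          then have *: "dist x (fst z) < b * snd z"
            by (simp add: wide_cone_def dist_commute)
          then have "0 < b * snd z" using le_less_trans[OF zero_le_dist] by blast
          then have "0 < snd z" using b by (simp add: zero_less_mult_iff)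
          with * False have "half_median (cone_area 1 G) z \<le> ennreal l"
            unfolding mem_Collect_eq not_less[symmetric] by blast
          then show ?thesis by (simp add: G1_def)
        qed simp
        then have "cone_area b G x = cone_area b G1 x" by (simp add: cone_area_def)
        with x show ?thesis by auto
      qed simp
    qed
    then have "emeasure lborel {x. ennreal l < cone_area b G x} \<le> emeasure lborel (?S \<union> ?T)"
      using S T by (intro emeasure_mono) auto
    also have "\<dots> \<le> emeasure lborel ?S + emeasure lborel ?T"
      using S T by (intro emeasure_subadditive) auto
    also have "emeasure lborel ?T \<le> ennreal K2 * emeasure lborel {x. ennreal l < cone_area 1 G x}"
      unfolding K2_def by (intro emeasure_near_high_median_le b) measurable
    also have "\<dots> \<le> ennreal K2 * ?I"
      by (intro mult_left_mono emeasure_level_le_nn_integral_min l) auto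
    finally show ?thesis
      using S_le K by (simp add: ennreal_plus distrib_right add_mono order_trans)
  qed
  then show ?thesis by blast
qed

text \<open>With the substitution \<mu> = l powr s the level set bound takes the form required by
  \<open>nn_integral_le_by_levels\<close>. Working on level sets treats s below and above 1 in the
  same way.\<close>

theorem nn_integral_wide_cone_area_le:
  assumes b: "1 \<le> b" and s: "0 < s"
  shows "\<exists>K::real. \<forall>G :: (real^'n) \<times> real \<Rightarrow> ennreal. G \<in> borel_measurable borel \<longrightarrow>
    (\<integral>\<^sup>+x. epow (cone_area b G x) s \<partial>lborel) \<le> ennreal K * (\<integral>\<^sup>+x. epow (cone_area 1 G x) s \<partial>lborel)"
proof -
  \<comment> \<open>Two demands: \<sigma> > 1 for the level set bound, and \<sigma> >= 2 * s, so
    that the truncated \<sigma>-th power is at most the square of the truncated s-th power.\<close>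
  define \<sigma> where "\<sigma> = 2 * s + 1"
  have \<sigma>: "1 < \<sigma>" using s by (simp add: \<sigma>_def)
  obtain K :: real where K: "\<And>(G :: (real^'n) \<times> real \<Rightarrow> ennreal) l. G \<in> borel_measurable borel \<Longrightarrow> 0 < l \<Longrightarrow>
    emeasure lborel {x. ennreal l < cone_area b G x} \<le>
    ennreal K * (\<integral>\<^sup>+x. epow (min 1 (cone_area 1 G x / ennreal l)) \<sigma> \<partial>lborel)"
    using emeasure_wide_level_le[OF b \<sigma>] by metis
  have "(\<integral>\<^sup>+x. epow (cone_area b G x) s \<partial>lborel) \<le> ennreal (2 * K) * (\<integral>\<^sup>+x. epow (cone_area 1 G x) s \<partial>lborel)"
    if [measurable]: "G \<in> borel_measurable borel" for G :: "(real^'n) \<times> real \<Rightarrow> ennreal"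
  proof -
    have "(\<integral>\<^sup>+x. epow (cone_area b G x) s \<partial>lborel) \<le> 2 * ennreal K * (\<integral>\<^sup>+x. epow (cone_area 1 G x) s \<partial>lborel)"
    proof (rule nn_integral_le_by_levels)
      fix \<mu> :: real assume \<mu>: "0 < \<mu>"
      define l where "l = \<mu> powr (1 / s)"
      have l: "0 < l" using \<mu> by (simp add: l_def)
      have "{x. ennreal \<mu> < epow (cone_area b G x) s} = {x. ennreal l < cone_area b G x}"
        using s \<mu> by (simp add: less_epow_iff epow_ennreal l_def)
      also have "emeasure lborel \<dots> \<le> ennreal K * (\<integral>\<^sup>+x. epow (min 1 (cone_area 1 G x / ennreal l)) \<sigma> \<partial>lborel)"
        by (intro K l) measurable
      also have "\<dots> \<le> ennreal K * (\<integral>\<^sup>+x. epow (min 1 (epow (cone_area 1 G x) s / ennreal \<mu>)) 2 \<partial>lborel)"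
      proof (intro mult_left_mono nn_integral_mono)
        fix x
        let ?y = "cone_area 1 G x"
        have "epow (min 1 (?y / ennreal l)) \<sigma> \<le> epow (min 1 (?y / ennreal l)) (s * 2)"
          by (intro epow_antimono_exp) (auto simp: \<sigma>_def)
        also have "\<dots> = epow (epow (min 1 (?y / ennreal l)) s) 2"
          by (simp add: epow_epow)
        also have "epow (min 1 (?y / ennreal l)) s = min 1 (epow (?y / ennreal l) s)"
          using s by (subst min_of_mono[symmetric]) (auto simp: mono_def intro: epow_mono)
        also have "epow (?y / ennreal l) s = epow ?y s / ennreal \<mu>"
        proof -
          have "inverse (ennreal l) = ennreal (1 / l)" "inverse (ennreal \<mu>) = ennreal (1 / \<mu>)"
            using l \<mu> by (simp_all add: inverse_ennreal inverse_eq_divide)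
          moreover have "(1 / l) powr s = 1 / \<mu>"
            using \<mu> s by (simp add: l_def powr_divide powr_powr)
          ultimately show ?thesis
            using l by (simp add: divide_ennreal_def epow_mult epow_ennreal)
        qed
        finally show "epow (min 1 (?y / ennreal l)) \<sigma> \<le> epow (min 1 (epow ?y s / ennreal \<mu>)) 2" .
      qed simp
      finally show "emeasure lborel {x. ennreal \<mu> < epow (cone_area b G x) s} \<le>
        ennreal K * (\<integral>\<^sup>+x. epow (min 1 (epow (cone_area 1 G x) s / ennreal \<mu>)) 2 \<partial>lborel)" .
    qed measurable
    then show ?thesis by (simp add: ennreal_mult')
  qed
  then show ?thesis by blast
qed

section \<open>Whitney averages\<close>

lemma AE_lebesgue_iff: "(AE z in lebesgue. P z) \<longleftrightarrow> (AE z in lborel. P z)"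
  by (rule AE_completion_iff)

text \<open>The infimum defining the essential supremum is attained, because the bounds c + 1/(k+1)
  involve only countably many null sets.\<close>

lemma ess_sup_on_le_iff: "ess_sup_on A g \<le> c \<longleftrightarrow> (AE z in lborel. z \<in> A \<longrightarrow> g z \<le> c)"
proof
  assume le: "ess_sup_on A g \<le> c"
  show "AE z in lborel. z \<in> A \<longrightarrow> g z \<le> c"
  proof (cases "c = top")
    case False
    then obtain r where r: "c = ennreal r" "0 \<le> r" by (cases c) auto
    have "AE z in lborel. z \<in> A \<longrightarrow> g z \<le> ennreal (r + 1 / Suc k)" for k
    proof -
      have "ess_sup_on A g < ennreal (r + 1 / Suc k)"
        using le r by (intro le_less_trans[OF le]) (auto simp: ennreal_less_iff)
      then obtain d where "d < ennreal (r + 1 / Suc k)" "AE z in lborel. z \<in> A \<longrightarrow> g z \<le> d"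
        by (auto simp: ess_sup_on_def Inf_less_iff AE_lebesgue_iff)
      then show ?thesis by (auto elim!: eventually_mono)
    qed
    then have "AE z in lborel. \<forall>k. z \<in> A \<longrightarrow> g z \<le> ennreal (r + 1 / Suc k)"
      unfolding AE_all_countable by blast
    then show ?thesis
    proof (rule eventually_mono, intro impI)
      fix z assume *: "\<forall>k. z \<in> A \<longrightarrow> g z \<le> ennreal (r + 1 / Suc k)" and "z \<in> A"
      then have **: "\<And>k. g z \<le> ennreal (r + 1 / Suc k)" by blast
      have "(\<lambda>k. r + 1 / Suc k) \<longlonglongrightarrow> r + 0"
        by (intro tendsto_intros LIMSEQ_Suc[OF lim_1_over_n])
      then have "(\<lambda>k. ennreal (r + 1 / Suc k)) \<longlonglongrightarrow> ennreal r"
        by (intro tendsto_ennrealI) simp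
      from LIMSEQ_le_const[OF this] ** show "g z \<le> c" unfolding r by blast
    qed
  qed simp
qed (auto simp: ess_sup_on_def AE_lebesgue_iff intro: Inf_lower)

lemma AE_le_ess_sup_on: "AE z in lborel. z \<in> A \<longrightarrow> g z \<le> ess_sup_on A g"
  by (rule iffD1[OF ess_sup_on_le_iff order_refl])

lemma ess_sup_on_mono_set: "A \<subseteq> B \<Longrightarrow> ess_sup_on A g \<le> ess_sup_on B g"
  using ess_sup_on_le_iff[of B g "ess_sup_on B g"] by (auto simp: ess_sup_on_le_iff elim!: eventually_mono)

text \<open>The Whitney average for functions with values in [0,\<infinity>]. The analysis runs on
  these, where suprema and quotients stay inside the type; complex functions enter only in the final
  assembly.\<close>

definition wavg :: "real \<Rightarrow> real \<Rightarrow> ennreal \<Rightarrow> ((real^'n) \<times> real \<Rightarrow> ennreal) \<Rightarrow> (real^'n) \<times> real \<Rightarrow> ennreal" where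
  "wavg a1 a2 r u z =
    (if r = top then ess_sup_on (whitney a1 a2 z) u
     else epow ((\<integral>\<^sup>+ \<zeta>. indicator (whitney a1 a2 z) \<zeta> * epow (u \<zeta>) (enn2real r) \<partial>lborel)
                 / emeasure lborel (whitney a1 a2 z)) (1 / enn2real r))"

lemma whitney_eq_Times:
  "whitney c1 c2 z = ball (fst z) (c1 * snd z) \<times> {snd z / c2<..<c2 * snd z}"
  by (auto simp: whitney_def dist_commute)

lemma mem_whitney_iff:
  "\<zeta> \<in> whitney c1 c2 z \<longleftrightarrow>
    dist (fst \<zeta>) (fst z) < c1 * snd z \<and> snd z / c2 < snd \<zeta> \<and> snd \<zeta> < c2 * snd z"
  by (cases \<zeta>) (simp add: whitney_def)

lemma open_whitney: "open (whitney c1 c2 z)"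
  unfolding whitney_eq_Times by (intro open_Times) auto

lemma open_whitney_fiber: "open {z. \<zeta> \<in> whitney c1 c2 z}"
  unfolding mem_whitney_iff divide_inverse
  by (intro open_Collect_conj open_Collect_less continuous_intros)

lemma sets_whitney [measurable]: "whitney c1 c2 z \<in> sets borel"
  using open_whitney by (rule borel_open)

lemma measurable_indicator_whitney [measurable (raw)]:
  fixes f g :: "'a \<Rightarrow> (real^'n) \<times> real"
  assumes [measurable]: "f \<in> borel_measurable M" "g \<in> borel_measurable M"
  shows "(\<lambda>w. indicator (whitney c1 c2 (f w)) (g w) :: ennreal) \<in> borel_measurable M"
proof -
  have "(\<lambda>w. indicator (whitney c1 c2 (f w)) (g w) :: ennreal) =
      (\<lambda>w. indicator {0<..} (c1 * snd (f w) - dist (fst (g w)) (fst (f w))) *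
        (indicator {0<..} (snd (g w) - snd (f w) / c2) * indicator {0<..} (c2 * snd (f w) - snd (g w))))"
    by (auto simp: mem_whitney_iff indicator_def)
  also have "\<dots> \<in> borel_measurable M" by measurable
  finally show ?thesis .
qed

lemma emeasure_whitney:
  fixes z :: "(real^'n) \<times> real"
  assumes "0 < snd z" "0 < c1" "1 < c2"
  shows "emeasure lborel (whitney c1 c2 z) =
    ennreal (unit_ball_vol CARD('n) * c1 ^ CARD('n) * (c2 - 1 / c2) * snd z ^ (CARD('n) + 1))"
proof -
  have "snd z / c2 \<le> snd z" "snd z \<le> c2 * snd z"
    using assms by (simp_all add: divide_le_eq)
  then have "snd z / c2 \<le> c2 * snd z" by (rule order_trans)
  then have "emeasure (lborel \<Otimes>\<^sub>M lborel) (whitney c1 c2 z) =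
      ennreal (unit_ball_vol CARD('n) * (c1 * snd z) ^ CARD('n)) * ennreal (c2 * snd z - snd z / c2)"
    using assms unfolding whitney_eq_Times
    by (subst lborel.emeasure_pair_measure_Times) (auto simp: emeasure_ball)
  also have "\<dots> = ennreal (unit_ball_vol CARD('n) * (c1 * snd z) ^ CARD('n) * (c2 * snd z - snd z / c2))"
    using assms by (intro ennreal_mult'[symmetric]) (auto simp: unit_ball_vol_nonneg)
  also have "unit_ball_vol CARD('n) * (c1 * snd z) ^ CARD('n) * (c2 * snd z - snd z / c2) =
      unit_ball_vol CARD('n) * c1 ^ CARD('n) * (c2 - 1 / c2) * snd z ^ (CARD('n) + 1)"
    by (simp add: algebra_simps power_mult_distrib)
  finally show ?thesis by (simp add: lborel_prod)
qed

lemma whitney_avg_eq_wavg: "whitney_avg a1 a2 r f = wavg a1 a2 r (\<lambda>z. ennreal (cmod (f z)))"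
  by (rule ext) (simp add: whitney_avg_def wavg_def epow_ennreal)

locale whitney_params =
  fixes a1 a2 :: real
  assumes a1_pos: "0 < a1" and a1_less: "a1 < 1 / a2" and inverse_a2_less: "1 / a2 < 1"
begin

lemma a2_gt_1: "1 < a2"
proof -
  have "0 < 1 / a2" using a1_pos a1_less by (rule less_trans)
  then have "0 < a2" by (simp add: zero_less_divide_iff)
  then show ?thesis using inverse_a2_less by (simp add: field_simps)
qed

lemma a1_less_1: "a1 < 1"
  using a1_less inverse_a2_less by simp

abbreviation "W \<equiv> whitney a1 a2"
abbreviation "\<W> \<equiv> wavg a1 a2"

lemma whitney_pos:
  assumes "\<zeta> \<in> W z"
  shows "0 < snd z" "0 < snd \<zeta>"
proof -
  have *: "dist (fst \<zeta>) (fst z) < a1 * snd z" "snd z / a2 < snd \<zeta>"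
    using assms by (auto simp: whitney_def)
  then have "0 < a1 * snd z"
    using le_less_trans[OF zero_le_dist] by blast
  then show "0 < snd z" using a1_pos by (simp add: zero_less_mult_iff)
  then have "0 < snd z / a2" using a2_gt_1 by simp
  with *(2) show "0 < snd \<zeta>" by simp
qed

lemma self_in_whitney: "0 < snd z \<Longrightarrow> z \<in> W z"
  using a1_pos a2_gt_1 by (simp add: mem_whitney_iff divide_less_eq)

lemma emeasure_whitney_W:
  fixes z :: "(real^'n) \<times> real"
  assumes "0 < snd z"
  shows "0 < emeasure lborel (W z)" "emeasure lborel (W z) < top"
proof -
  have "0 < unit_ball_vol CARD('n) * a1 ^ CARD('n) * (a2 - 1 / a2) * snd z ^ (CARD('n) + 1)"
    using assms a1_pos a2_gt_1 inverse_a2_less by (intro mult_pos_pos zero_less_power) (use less_trans[OF inverse_a2_less a2_gt_1] in \<open>auto simp: unit_ball_vol_pos\<close>)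
  then show "0 < emeasure lborel (W z)" "emeasure lborel (W z) < top"
    using assms a1_pos a2_gt_1 by (simp_all add: emeasure_whitney)
qed

lemma wavg_mono_AE:
  assumes AE: "AE \<zeta> in lborel. \<zeta> \<in> W z \<longrightarrow> u \<zeta> \<le> v \<zeta>"
  shows "\<W> r u z \<le> \<W> r v z"
proof (cases "r = top")
  case True
  have "AE \<zeta> in lborel. \<zeta> \<in> W z \<longrightarrow> v \<zeta> \<le> ess_sup_on (W z) v"
    by (rule AE_le_ess_sup_on)
  then have "AE \<zeta> in lborel. \<zeta> \<in> W z \<longrightarrow> u \<zeta> \<le> ess_sup_on (W z) v"
    using AE by eventually_elim (blast intro: order_trans)
  then show ?thesis using True by (simp add: wavg_def ess_sup_on_le_iff)
next
  case False
  have "(\<integral>\<^sup>+ \<zeta>. indicator (W z) \<zeta> * epow (u \<zeta>) (enn2real r) \<partial>lborel) \<le>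
      (\<integral>\<^sup>+ \<zeta>. indicator (W z) \<zeta> * epow (v \<zeta>) (enn2real r) \<partial>lborel)"
  proof (rule nn_integral_mono_AE)
    show "AE \<zeta> in lborel. indicator (W z) \<zeta> * epow (u \<zeta>) (enn2real r) \<le> indicator (W z) \<zeta> * epow (v \<zeta>) (enn2real r)"
      using AE by eventually_elim (auto simp: indicator_def intro!: epow_mono)
  qed
  then show ?thesis
    using False by (auto simp: wavg_def intro!: epow_mono divide_right_mono_ennreal)
qed

lemma wavg_mono: "(\<And>\<zeta>. \<zeta> \<in> W z \<Longrightarrow> u \<zeta> \<le> v \<zeta>) \<Longrightarrow> \<W> r u z \<le> \<W> r v z"
  by (intro wavg_mono_AE) simp

lemma wavg_cong_AE:
  assumes "AE \<zeta> in lborel. 0 < snd \<zeta> \<longrightarrow> u \<zeta> = v \<zeta>"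
  shows "\<W> r u z = \<W> r v z"
proof (rule antisym)
  have "AE \<zeta> in lborel. \<zeta> \<in> W z \<longrightarrow> u \<zeta> = v \<zeta>"
    using assms by eventually_elim (use whitney_pos(2) in blast)
  then have "AE \<zeta> in lborel. \<zeta> \<in> W z \<longrightarrow> u \<zeta> \<le> v \<zeta>" "AE \<zeta> in lborel. \<zeta> \<in> W z \<longrightarrow> v \<zeta> \<le> u \<zeta>"
    by (auto elim!: eventually_mono)
  then show "\<W> r u z \<le> \<W> r v z" "\<W> r v z \<le> \<W> r u z"
    by (simp_all add: wavg_mono_AE)
qed

text \<open>For r = top the essential supremum exceeds c exactly when
  \<open>{\<zeta>. c < u \<zeta>}\<close> meets the Whitney region in positive measure, a condition
  on an integral depending measurably on z.\<close>

lemma borel_measurable_wavg [measurable]: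
  fixes u :: "(real^'n) \<times> real \<Rightarrow> ennreal"
  assumes [measurable]: "u \<in> borel_measurable borel"
  shows "\<W> r u \<in> borel_measurable borel"
proof (cases "r = top")
  case True
  show ?thesis
  proof (rule borel_measurableI_greater)
    fix c
    have "c < \<W> r u z \<longleftrightarrow> 0 < (\<integral>\<^sup>+\<zeta>. indicator (W z) \<zeta> * indicator {\<zeta>. c < u \<zeta>} \<zeta> \<partial>lborel)" for z
    proof -
      have "(\<integral>\<^sup>+\<zeta>. indicator (W z) \<zeta> * indicator {\<zeta>. c < u \<zeta>} \<zeta> \<partial>lborel) = 0 \<longleftrightarrow>
          (AE \<zeta> in lborel. indicator (W z) \<zeta> * indicator {\<zeta>. c < u \<zeta>} \<zeta> = (0::ennreal))"
        by (subst nn_integral_0_iff_AE) auto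
      also have "\<dots> \<longleftrightarrow> (AE \<zeta> in lborel. \<zeta> \<in> W z \<longrightarrow> u \<zeta> \<le> c)"
        by (intro arg_cong[where f="\<lambda>P. AE \<zeta> in lborel. P \<zeta>"] ext) (auto simp: indicator_def not_less)
      also have "\<dots> \<longleftrightarrow> \<W> r u z \<le> c"
        by (simp add: ess_sup_on_le_iff wavg_def True)
      finally show ?thesis
        by (simp add: zero_less_iff_neq_zero not_le[symmetric])
    qed
    then show "{z \<in> space borel. c < \<W> r u z} \<in> sets borel"
      by simp
  qed
next
  case False
  have "emeasure lborel (W z) = (\<integral>\<^sup>+\<zeta>. indicator (W z) \<zeta> \<partial>lborel)" for z :: "(real^'n) \<times> real"
    by simp
  then have "\<W> r u = (\<lambda>z. epow ((\<integral>\<^sup>+ \<zeta>. indicator (W z) \<zeta> * epow (u \<zeta>) (enn2real r) \<partial>lborel)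
                 / (\<integral>\<^sup>+\<zeta>. indicator (W z) \<zeta> \<partial>lborel)) (1 / enn2real r))"
    using False by (auto simp: wavg_def)
  also have "\<dots> \<in> borel_measurable borel" by measurable
  finally show ?thesis .
qed

lemma wavg_eq_0_imp:
  fixes u :: "(real^'n) \<times> real \<Rightarrow> ennreal"
  assumes [measurable]: "u \<in> borel_measurable borel" and "0 < r" and 0: "\<W> r u z = 0" and z: "0 < snd z"
  shows "AE \<zeta> in lborel. \<zeta> \<in> W z \<longrightarrow> u \<zeta> = 0"
proof (cases "r = top")
  case True
  then show ?thesis
    using 0 ess_sup_on_le_iff[of "W z" u 0] by (simp add: wavg_def)
next
  case False
  then have "(\<integral>\<^sup>+ \<zeta>. indicator (W z) \<zeta> * epow (u \<zeta>) (enn2real r) \<partial>lborel) = 0"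
    using 0 emeasure_whitney_W[OF z] by (auto simp: wavg_def ennreal_divide_eq_0_iff)
  then show ?thesis
    by (subst (asm) nn_integral_0_iff_AE) (auto elim!: eventually_mono simp: indicator_def)
qed

text \<open>The product form avoids dividing by c, which may be 0 or top. For r = c = top, a finite
  essential supremum of c * v forces v to vanish a.e. on the region; otherwise the average is
  homogeneous in c.\<close>

lemma mult_wavg_le:
  fixes u v :: "(real^'n) \<times> real \<Rightarrow> ennreal"
  assumes [measurable]: "v \<in> borel_measurable borel" and r: "0 < r"
    and le: "\<And>\<zeta>. \<zeta> \<in> W z \<Longrightarrow> c * v \<zeta> \<le> u \<zeta>"
  shows "c * \<W> r v z \<le> \<W> r u z"
proof -
  have "c * \<W> r v z \<le> \<W> r (\<lambda>\<zeta>. c * v \<zeta>) z"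
  proof (cases "r = top")
    case True
    let ?e = "ess_sup_on (W z) (\<lambda>\<zeta>. c * v \<zeta>)"
    note AE = AE_le_ess_sup_on[of "W z" "\<lambda>\<zeta>. c * v \<zeta>"]
    consider "c = 0" | "?e = top" | "c = top" "?e < top" | "0 < c" "c < top"
      using less_top[of c] less_top[of ?e] zero_less_iff_neq_zero[of c] by blast
    then have "c * ess_sup_on (W z) v \<le> ?e"
    proof cases
      case 3
      have "AE \<zeta> in lborel. \<zeta> \<in> W z \<longrightarrow> v \<zeta> \<le> 0"
        using AE
      proof eventually_elim
        case (elim \<zeta>)
        with 3 show ?case by (cases "v \<zeta> = 0") (auto simp: ennreal_top_mult top_unique)
      qed
      then have "ess_sup_on (W z) v = 0"
        using ess_sup_on_le_iff[of "W z" v 0] by simp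
      then show ?thesis by simp
    next
      case 4
      have "AE \<zeta> in lborel. \<zeta> \<in> W z \<longrightarrow> v \<zeta> \<le> ?e / c"
        using AE
      proof eventually_elim
        case (elim \<zeta>)
        show ?case
        proof
          assume "\<zeta> \<in> W z"
          then have "c * v \<zeta> / c \<le> ?e / c"
            using elim by (intro divide_right_mono_ennreal) auto
          then show "v \<zeta> \<le> ?e / c"
            using 4 by (simp add: ennreal_mult_divide_eq mult.commute[of c])
        qed
      qed
      then have "c * ess_sup_on (W z) v \<le> c * (?e / c)"
        by (intro mult_left_mono) (simp_all add: ess_sup_on_le_iff)
      also have "\<dots> = ?e"
        using 4 by (simp add: ennreal_times_divide mult.commute[of c] ennreal_mult_divide_eq)
      finally show ?thesis .
    qed auto
    then show ?thesis using True by (simp add: wavg_def)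
  next
    case False
    with r have r': "0 < enn2real r" by (simp add: enn2real_positive_iff less_top)
    have "(\<integral>\<^sup>+ \<zeta>. indicator (W z) \<zeta> * epow (c * v \<zeta>) (enn2real r) \<partial>lborel) =
        epow c (enn2real r) * (\<integral>\<^sup>+ \<zeta>. indicator (W z) \<zeta> * epow (v \<zeta>) (enn2real r) \<partial>lborel)"
      by (subst nn_integral_cmult[symmetric]) (auto simp: epow_mult mult_ac)
    then show ?thesis
      using False r' by (simp add: wavg_def epow_mult ennreal_times_divide[symmetric])
  qed
  also have "\<dots> \<le> \<W> r u z"
    by (rule wavg_mono) (rule le)
  finally show ?thesis .
qed

section \<open>The two factors: the supremum \<open>S k\<close> and the quotient by it\<close>

definition S :: "((real^'n) \<times> real \<Rightarrow> ennreal) \<Rightarrow> (real^'n) \<times> real \<Rightarrow> ennreal" where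
  "S k \<zeta> = (SUP z\<in>{z. \<zeta> \<in> W z}. k z)"

definition H :: "((real^'n) \<times> real \<Rightarrow> ennreal) \<Rightarrow> (real^'n) \<times> real \<Rightarrow> ennreal" where
  "H k z = (SUP \<zeta>\<in>W z. S k \<zeta>)"

text \<open>The superlevel sets are unions of open Whitney regions, hence open for arbitrary
  k.\<close>

lemma borel_measurable_S [measurable]: "S k \<in> borel_measurable borel"
  unfolding S_def[abs_def] by (rule borel_measurable_SUP_open) (use open_whitney in simp)

lemma borel_measurable_H [measurable]: "H k \<in> borel_measurable borel"
  unfolding H_def[abs_def] by (rule borel_measurable_SUP_open) (rule open_whitney_fiber)

lemma le_S: "\<zeta> \<in> W z \<Longrightarrow> k z \<le> S k \<zeta>"
  unfolding S_def by (rule SUP_upper) simp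

lemma S_le_H: "\<zeta> \<in> W z \<Longrightarrow> S k \<zeta> \<le> H k z"
  unfolding H_def by (rule SUP_upper)

lemma wavg_top_S_le_H: "\<W> top (S k) z \<le> H k z"
  by (auto simp: wavg_def ess_sup_on_le_iff S_le_H)

text \<open>The case distinction keeps the quotient from being top where u > 0 and
  \<open>S k\<close> = 0. Where \<open>S k\<close> is top, the quotient is 0 as well.\<close>

definition quot :: "((real^'n) \<times> real \<Rightarrow> ennreal) \<Rightarrow> ((real^'n) \<times> real \<Rightarrow> ennreal) \<Rightarrow> (real^'n) \<times> real \<Rightarrow> ennreal" where
  "quot k u \<zeta> = (if S k \<zeta> = 0 then 0 else u \<zeta> / S k \<zeta>)"

lemma borel_measurable_quot [measurable]:
  assumes [measurable]: "u \<in> borel_measurable borel"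
  shows "quot k u \<in> borel_measurable borel"
  unfolding quot_def[abs_def] by measurable

lemma mult_wavg_quot_le:
  assumes [measurable]: "u \<in> borel_measurable borel" and r: "0 < r"
  shows "k z * \<W> r (quot k u) z \<le> \<W> r u z"
proof (rule mult_wavg_le)
  fix \<zeta> assume \<zeta>: "\<zeta> \<in> W z"
  have "k z * quot k u \<zeta> \<le> S k \<zeta> * quot k u \<zeta>"
    by (intro mult_right_mono le_S \<zeta>) auto
  also have "\<dots> \<le> u \<zeta>"
    by (cases "S k \<zeta> = top") (auto simp: quot_def mult.commute[of "S k \<zeta>"] ennreal_divide_times less_top)
  finally show "k z * quot k u \<zeta> \<le> u \<zeta>" .
qed (use r in auto)

lemma wavg_quot_eq_0:
  fixes u :: "(real^'n) \<times> real \<Rightarrow> ennreal"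
  assumes [measurable]: "u \<in> borel_measurable borel" and r: "0 < r" and "\<W> r u z = 0" "0 < snd z"
  shows "\<W> r (quot k u) z = 0"
proof -
  have AE: "AE \<zeta> in lborel. \<zeta> \<in> W z \<longrightarrow> quot k u \<zeta> = 0"
    using wavg_eq_0_imp[OF assms] by eventually_elim (auto simp: quot_def)
  show ?thesis
  proof (cases "r = top")
    case True
    then show ?thesis using AE ess_sup_on_le_iff[of "W z" "quot k u" 0] by (simp add: wavg_def)
  next
    case False
    have "(\<integral>\<^sup>+ \<zeta>. indicator (W z) \<zeta> * epow (quot k u \<zeta>) (enn2real r) \<partial>lborel) = 0"
      using AE by (subst nn_integral_0_iff_AE) (auto elim!: eventually_mono simp: indicator_def)
    then show ?thesis using False by (simp add: wavg_def)
  qed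
qed

text \<open>The point is that u vanishes a.e. where \<open>S k\<close> = 0. If \<open>k z\<close> =
  0 then u = 0 a.e. on the Whitney region of z, but the null set depends on z. Only z in a countable
  dense set are used: the points whose Whitney region contains \<zeta> form a nonempty open set, so
  a dense point is among them.\<close>

lemma AE_eq_S_mult_quot:
  fixes u :: "(real^'n) \<times> real \<Rightarrow> ennreal"
  assumes [measurable]: "u \<in> borel_measurable borel" and r: "0 < r"
    and pos: "\<And>z. 0 < snd z \<Longrightarrow> 0 < \<W> r u z \<Longrightarrow> 0 < k z"
    and fin: "AE z in lborel. 0 < snd z \<longrightarrow> S k z < top"
  shows "AE z in lborel. 0 < snd z \<longrightarrow> u z = S k z * quot k u z"
proof -
  obtain D :: "((real^'n) \<times> real) set" where D: "countable D" "\<And>X. open X \<Longrightarrow> X \<noteq> {} \<Longrightarrow> \<exists>d\<in>D. d \<in> X"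
    using countable_dense_exists by blast
  have "AE \<zeta> in lborel. \<zeta> \<in> W z \<longrightarrow> k z = 0 \<longrightarrow> u \<zeta> = 0" for z
  proof (cases "0 < snd z \<and> k z = 0")
    case True
    then have "\<W> r u z = 0" using pos[of z] by (metis not_gr_zero)
    with wavg_eq_0_imp[OF _ r this] True show ?thesis by (auto elim!: eventually_mono)
  next
    case False
    then show ?thesis using whitney_pos(1)[of _ z] by auto
  qed
  then have "AE \<zeta> in lborel. \<forall>z\<in>D. \<zeta> \<in> W z \<longrightarrow> k z = 0 \<longrightarrow> u \<zeta> = 0"
    using D(1) by (intro AE_ball_countable') auto
  with fin show ?thesis
  proof eventually_elim
    case (elim \<zeta>)
    show ?case
    proof
      assume \<zeta>: "0 < snd \<zeta>"
      show "u \<zeta> = S k \<zeta> * quot k u \<zeta>"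
      proof (cases "S k \<zeta> = 0")
        case True
        obtain d where d: "d \<in> D" "\<zeta> \<in> W d"
          using D(2)[OF open_whitney_fiber[of \<zeta> a1 a2]] self_in_whitney[OF \<zeta>] by blast
        then have "k d = 0" using le_S[OF d(2), of k] True by simp
        with elim d have "u \<zeta> = 0" by blast
        with True show ?thesis by simp
      next
        case False
        with elim(1) \<zeta> show ?thesis
          by (simp add: quot_def ennreal_times_divide mult.commute[of "S k \<zeta>"] ennreal_mult_divide_eq)
      qed
    qed
  qed
qed

end

section \<open>Affine invariance and uniform comparison of Whitney averages\<close>

definition affine_move :: "(real^'n) \<times> real \<Rightarrow> (real^'n) \<times> real \<Rightarrow> (real^'n) \<times> real" where
  "affine_move z k = (fst z + snd z *\<^sub>R fst k, snd z * snd k)"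

lemma mem_whitney_affine_move_iff:
  assumes t: "0 < snd z"
  shows "\<zeta> \<in> whitney c1 c2 (affine_move z k) \<longleftrightarrow>
    ((1 / snd z) *\<^sub>R (fst \<zeta> - fst z), snd \<zeta> / snd z) \<in> whitney c1 c2 k"
proof -
  have "fst \<zeta> - (fst z + snd z *\<^sub>R fst k) = snd z *\<^sub>R ((1 / snd z) *\<^sub>R (fst \<zeta> - fst z) - fst k)"
    using t by (simp add: algebra_simps)
  then have "dist (fst \<zeta>) (fst z + snd z *\<^sub>R fst k) = snd z * dist ((1 / snd z) *\<^sub>R (fst \<zeta> - fst z)) (fst k)"
    unfolding dist_norm using t by simp
  then show ?thesis
    using t by (simp add: mem_whitney_iff affine_move_def less_divide_eq divide_less_eq mult.commute mult.left_commute)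
qed

lemma finite_ex_maximizer:
  fixes f :: "'a \<Rightarrow> 'b::linorder"
  assumes "finite K" "K \<noteq> {}"
  shows "\<exists>k\<in>K. \<forall>k'\<in>K. f k' \<le> f k"
proof -
  have "Max (f ` K) \<in> f ` K" using assms by (intro Max_in) auto
  then obtain k where "k \<in> K" "Max (f ` K) = f k" by auto
  then show ?thesis using assms by (metis Max_ge finite_imageI imageI)
qed

context whitney_params begin

lemma small_whitney_exists:
  "\<exists>\<delta>. 0 < \<delta> \<and> \<delta> \<le> 1 \<and> (\<forall>z \<zeta> :: (real^'n) \<times> real. 0 < snd z \<longrightarrow> \<zeta> \<in> whitney \<delta> (1 + \<delta>) z \<longrightarrow>
    whitney \<delta> (1 + \<delta>) z \<subseteq> W \<zeta>)"
proof -
  \<comment> \<open>Secures (1 + \<delta>)^2 <= a2 for the ratio of two heights in a small region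
    and 2 * \<delta> * (1 + \<delta>) <= a1 for their horizontal distance, by way of \<delta>^2 <=
    \<delta>.\<close>
  define \<delta> where "\<delta> = min 1 (min (a1 / 4) ((a2 - 1) / 3))"
  have \<delta>: "0 < \<delta>" "\<delta> \<le> 1" "4 * \<delta> \<le> a1" "3 * \<delta> \<le> a2 - 1"
    using a1_pos a2_gt_1 by (auto simp: \<delta>_def min_def)
  have "\<delta> * \<delta> \<le> \<delta>" using \<delta> by (simp add: mult_left_le)
  then have "1 + 2 * \<delta> + \<delta> * \<delta> \<le> a2" "2 * \<delta> + 2 * (\<delta> * \<delta>) \<le> a1"
    using \<delta> by linarith+
  moreover have "(1 + \<delta>) * (1 + \<delta>) = 1 + 2 * \<delta> + \<delta> * \<delta>" "2 * \<delta> * (1 + \<delta>) = 2 * \<delta> + 2 * (\<delta> * \<delta>)"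
    by (simp_all add: algebra_simps)
  ultimately have \<delta>2: "(1 + \<delta>) * (1 + \<delta>) \<le> a2" "2 * \<delta> * (1 + \<delta>) \<le> a1"
    by (simp_all only:)
  have "\<eta> \<in> W \<zeta>"
    if t: "0 < snd z" and \<zeta>: "\<zeta> \<in> whitney \<delta> (1 + \<delta>) z" and \<eta>: "\<eta> \<in> whitney \<delta> (1 + \<delta>) z"
    for z \<zeta> \<eta> :: "(real^'n) \<times> real"
  proof -
    have z: "snd z < (1 + \<delta>) * snd \<zeta>" "snd z < (1 + \<delta>) * snd \<eta>"
        "snd \<zeta> < (1 + \<delta>) * snd z" "snd \<eta> < (1 + \<delta>) * snd z"
        "dist (fst \<zeta>) (fst z) < \<delta> * snd z" "dist (fst \<eta>) (fst z) < \<delta> * snd z"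
      using \<zeta> \<eta> \<delta>(1) by (auto simp: mem_whitney_iff divide_less_eq mult.commute)
    have pos: "0 < snd \<zeta>" "0 < snd \<eta>"
      using less_trans[OF t z(1)] less_trans[OF t z(2)] \<delta>(1) by (simp_all add: zero_less_mult_iff)
    have "dist (fst \<eta>) (fst \<zeta>) < 2 * \<delta> * snd z"
      using z(5,6) dist_triangle2[of "fst \<eta>" "fst \<zeta>" "fst z"] by simp
    also have "\<dots> \<le> 2 * \<delta> * ((1 + \<delta>) * snd \<zeta>)"
      using z(1) \<delta> by (intro mult_left_mono) auto
    also have "\<dots> \<le> a1 * snd \<zeta>"
      using \<delta>2(2) pos by (simp add: mult.assoc[symmetric] mult_right_mono)
    finally have 1: "dist (fst \<eta>) (fst \<zeta>) < a1 * snd \<zeta>" .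
    have *: "x < a2 * y" if "x < (1 + \<delta>) * snd z" "snd z < (1 + \<delta>) * y" "0 < y" for x y
    proof -
      have "(1 + \<delta>) * snd z < (1 + \<delta>) * ((1 + \<delta>) * y)"
        using that \<delta> by (intro mult_strict_left_mono) auto
      also have "\<dots> \<le> a2 * y"
        using \<delta>2(1) that by (simp only: mult.assoc[symmetric] mult_right_mono less_imp_le)
      finally show ?thesis using that by simp
    qed
    have "snd \<eta> < a2 * snd \<zeta>" "snd \<zeta> < a2 * snd \<eta>"
      using * z pos by blast+
    with 1 show ?thesis
      using a2_gt_1 by (simp add: mem_whitney_iff divide_less_eq mult.commute)
  qed
  then show ?thesis using \<delta> by blast
qed

text \<open>Compactness gives a finite cover at the base point (0,1). Translations and dilations of
  the half space carry Whitney regions to Whitney regions, so the same K serves every z.\<close>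

lemma whitney_finite_cover:
  assumes \<delta>: "0 < \<delta>"
  shows "\<exists>K :: ((real^'n) \<times> real) set. finite K \<and> K \<subseteq> cball 0 a1 \<times> {1 / a2..a2} \<and>
    (\<forall>z. 0 < snd z \<longrightarrow> W z \<subseteq> (\<Union>k\<in>K. whitney \<delta> (1 + \<delta>) (affine_move z k)))"
proof -
  let ?Q = "cball 0 a1 \<times> {1 / a2..a2} :: ((real^'n) \<times> real) set"
  have "compact ?Q" by (intro compact_Times compact_cball compact_Icc)
  moreover have "?Q \<subseteq> (\<Union>k\<in>?Q. whitney \<delta> (1 + \<delta>) k)"
  proof
    fix k assume k: "k \<in> ?Q"
    have "0 < 1 / a2" using a2_gt_1 by simp
    also have "\<dots> \<le> snd k" using k by auto
    finally have "0 < snd k" .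
    then have "k \<in> whitney \<delta> (1 + \<delta>) k"
      using \<delta> by (simp add: mem_whitney_iff divide_less_eq)
    with k show "k \<in> (\<Union>k\<in>?Q. whitney \<delta> (1 + \<delta>) k)" by blast
  qed
  ultimately obtain K where K: "K \<subseteq> ?Q" "finite K" "?Q \<subseteq> (\<Union>k\<in>K. whitney \<delta> (1 + \<delta>) k)"
    using compactE_image[of ?Q ?Q "whitney \<delta> (1 + \<delta>)"] open_whitney by metis
  have "\<zeta> \<in> (\<Union>k\<in>K. whitney \<delta> (1 + \<delta>) (affine_move z k))" if z: "0 < snd z" and \<zeta>: "\<zeta> \<in> W z" for z \<zeta>
  proof -
    have "norm ((1 / snd z) *\<^sub>R (fst \<zeta> - fst z)) = dist (fst \<zeta>) (fst z) / snd z"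
      using z by (simp add: dist_norm)
    also have "\<dots> \<le> a1"
      using \<zeta> z by (simp add: mem_whitney_iff divide_le_eq)
    finally have "((1 / snd z) *\<^sub>R (fst \<zeta> - fst z), snd \<zeta> / snd z) \<in> ?Q"
      using \<zeta> z a2_gt_1 by (simp add: mem_whitney_iff field_simps)
    then have "((1 / snd z) *\<^sub>R (fst \<zeta> - fst z), snd \<zeta> / snd z) \<in> (\<Union>k\<in>K. whitney \<delta> (1 + \<delta>) k)"
      by (rule subsetD[OF K(3)])
    then show ?thesis
      using z by (simp add: mem_whitney_affine_move_iff)
  qed
  then show ?thesis
    using K(1,2) by (intro exI[of _ K] conjI allI impI subsetI) auto
qed

text \<open>The point of the lemma is the uniformity: the average at \<open>z\<close> is controlled by the average at
  every point of some set of measure comparable to that of \<open>W z\<close>.\<close>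

lemma wavg_le_on_small_whitney:
  assumes r: "0 < r"
  shows "\<exists>(C::real) \<delta>. 0 \<le> C \<and> 0 < \<delta> \<and> \<delta> \<le> 1 \<and>
    (\<forall>(u :: (real^'n) \<times> real \<Rightarrow> ennreal) z. u \<in> borel_measurable borel \<longrightarrow> 0 < snd z \<longrightarrow>
      (\<exists>k \<in> cball 0 a1 \<times> {1 / a2..a2}. \<forall>\<zeta> \<in> whitney \<delta> (1 + \<delta>) (affine_move z k). \<W> r u z \<le> ennreal C * \<W> r u \<zeta>))"
proof -
  obtain \<delta> where \<delta>: "0 < \<delta>" "\<delta> \<le> 1"
    "\<And>z \<zeta> :: (real^'n) \<times> real. 0 < snd z \<Longrightarrow> \<zeta> \<in> whitney \<delta> (1 + \<delta>) z \<Longrightarrow> whitney \<delta> (1 + \<delta>) z \<subseteq> W \<zeta>"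
    using small_whitney_exists by blast
  obtain K :: "((real^'n) \<times> real) set" where K: "finite K" "K \<subseteq> cball 0 a1 \<times> {1 / a2..a2}"
    "\<And>z. 0 < snd z \<Longrightarrow> W z \<subseteq> (\<Union>k\<in>K. whitney \<delta> (1 + \<delta>) (affine_move z k))"
    using whitney_finite_cover[OF \<delta>(1)] by blast
  define V where "V z k = whitney \<delta> (1 + \<delta>) (affine_move z k)" for z k :: "(real^'n) \<times> real"
  have "W (0, 1) \<noteq> ({} :: ((real^'n) \<times> real) set)"
    using self_in_whitney[of "(0, 1)"] by auto
  with K(3)[of "(0, 1)"] have K_ne: "K \<noteq> {}" by auto
  have kpos: "0 < snd (affine_move z k)" "snd (affine_move z k) \<le> a2 * snd z" if "0 < snd z" "k \<in> K" for z k
  proof -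
    have "1 / a2 \<le> snd k" "snd k \<le> a2" using that K(2) by auto
    moreover have "0 < snd k" using a2_gt_1 by (intro less_le_trans[OF _ \<open>1 / a2 \<le> snd k\<close>]) simp
    ultimately show "0 < snd (affine_move z k)" "snd (affine_move z k) \<le> a2 * snd z"
      using that by (auto simp: affine_move_def mult.commute intro: mult_pos_pos)
  qed
  have VW: "V z k \<subseteq> W \<zeta>" if "0 < snd z" "k \<in> K" "\<zeta> \<in> V z k" for z k \<zeta>
    using \<delta>(3)[OF kpos(1)[OF that(1,2)]] that unfolding V_def by blast
  \<comment> \<open>Points of a covering region have height at most 2 * a2 times that of z, so L
    bounds the ratio of Whitney volumes. The factor card K in C is the pigeonhole loss: the covering
    region with the largest integral carries at least that fraction of the whole.\<close>
  define L where "L = (2 * a2) ^ (CARD('n) + 1)"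
  define C where "C = (if r = top then 1 else (real (card K) * L) powr (1 / enn2real r))"
  have L: "0 < L" using a2_gt_1 by (simp add: L_def)
  have "\<exists>k\<in>K. \<forall>\<zeta>\<in>V z k. \<W> r u z \<le> ennreal C * \<W> r u \<zeta>"
    if u [measurable]: "u \<in> borel_measurable borel" and z: "0 < snd z" for u :: "(real^'n) \<times> real \<Rightarrow> ennreal" and z
  proof (cases "r = top")
    case True
    obtain k where k: "k \<in> K" "\<And>k'. k' \<in> K \<Longrightarrow> ess_sup_on (V z k') u \<le> ess_sup_on (V z k) u"
      using finite_ex_maximizer[OF K(1) K_ne, of "\<lambda>k. ess_sup_on (V z k) u"] by blast
    have "AE \<zeta> in lborel. \<forall>k'\<in>K. \<zeta> \<in> V z k' \<longrightarrow> u \<zeta> \<le> ess_sup_on (V z k') u"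
      by (intro AE_finite_allI K(1) AE_le_ess_sup_on)
    then have "AE \<zeta> in lborel. \<zeta> \<in> W z \<longrightarrow> u \<zeta> \<le> ess_sup_on (V z k) u"
    proof eventually_elim
      case (elim \<zeta>)
      show ?case
      proof
        assume "\<zeta> \<in> W z"
        then obtain k' where "k' \<in> K" "\<zeta> \<in> V z k'" using K(3)[OF z] unfolding V_def by blast
        with elim k(2)[of k'] show "u \<zeta> \<le> ess_sup_on (V z k) u" by (meson order_trans)
      qed
    qed
    then have Wz: "\<W> r u z \<le> ess_sup_on (V z k) u"
      by (simp add: wavg_def True ess_sup_on_le_iff)
    have "\<W> r u z \<le> ennreal C * \<W> r u \<zeta>" if "\<zeta> \<in> V z k" for \<zeta>
      using order_trans[OF Wz ess_sup_on_mono_set[OF VW[OF z k(1) that]]] by (simp add: wavg_def C_def True)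
    with k(1) show ?thesis by blast
  next
    case False
    with r have r': "0 < enn2real r" by (simp add: enn2real_positive_iff less_top)
    define I where "I A = (\<integral>\<^sup>+ \<zeta>. indicator A \<zeta> * epow (u \<zeta>) (enn2real r) \<partial>lborel)" for A
    obtain k where k: "k \<in> K" "\<And>k'. k' \<in> K \<Longrightarrow> I (V z k') \<le> I (V z k)"
      using finite_ex_maximizer[OF K(1) K_ne, of "\<lambda>k. I (V z k)"] by blast
    have [measurable]: "V z k' \<in> sets borel" for k' unfolding V_def by measurable
    have "I (W z) \<le> (\<integral>\<^sup>+ \<zeta>. (\<Sum>k'\<in>K. indicator (V z k') \<zeta> * epow (u \<zeta>) (enn2real r)) \<partial>lborel)"
      unfolding I_def
    proof (intro nn_integral_mono)
      fix \<zeta>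
      show "indicator (W z) \<zeta> * epow (u \<zeta>) (enn2real r) \<le> (\<Sum>k'\<in>K. indicator (V z k') \<zeta> * epow (u \<zeta>) (enn2real r))"
      proof (cases "\<zeta> \<in> W z")
        case True
        with K(3)[OF z] obtain k' where k': "k' \<in> K" "\<zeta> \<in> V z k'" unfolding V_def by blast
        have "indicator (W z) \<zeta> * epow (u \<zeta>) (enn2real r) = indicator (V z k') \<zeta> * epow (u \<zeta>) (enn2real r)"
          using True k' by simp
        also have "\<dots> \<le> (\<Sum>k'\<in>K. indicator (V z k') \<zeta> * epow (u \<zeta>) (enn2real r))"
          using k'(1) K(1) by (intro member_le_sum) auto
        finally show ?thesis .
      qed simp
    qed
    also have "\<dots> = (\<Sum>k'\<in>K. I (V z k'))"
      unfolding I_def by (intro nn_integral_sum) measurable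
    also have "\<dots> \<le> of_nat (card K) * I (V z k)"
      using k(2) by (intro sum_bounded_above) auto
    finally have IW: "I (W z) \<le> of_nat (card K) * I (V z k)" .
    have "\<W> r u z \<le> ennreal C * \<W> r u \<zeta>" if \<zeta>: "\<zeta> \<in> V z k" for \<zeta>
    proof -
      have IV: "I (V z k) \<le> I (W \<zeta>)"
        unfolding I_def using VW[OF z k(1) \<zeta>] by (intro nn_integral_mono) (auto simp: indicator_def)
      have s: "0 < snd \<zeta>"
      proof -
        have "0 < snd (affine_move z k) / (1 + \<delta>)" using kpos(1)[OF z k(1)] \<delta>(1) by simp
        also have "\<dots> < snd \<zeta>" using \<zeta> by (simp add: V_def mem_whitney_iff)
        finally show ?thesis .
      qed
      have "snd \<zeta> < (1 + \<delta>) * snd (affine_move z k)"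
        using \<zeta> by (simp add: V_def mem_whitney_iff)
      also have "\<dots> \<le> 2 * (a2 * snd z)"
        using kpos[OF z k(1)] \<delta> by (intro mult_mono) auto
      finally have "snd \<zeta> ^ (CARD('n) + 1) \<le> (2 * a2 * snd z) ^ (CARD('n) + 1)"
        using s by (intro power_mono) auto
      then have sz: "snd \<zeta> ^ (CARD('n) + 1) \<le> L * snd z ^ (CARD('n) + 1)"
        by (simp only: L_def power_mult_distrib)
      define c where "c = unit_ball_vol CARD('n) * a1 ^ CARD('n) * (a2 - 1 / a2)"
      have c: "0 \<le> c"
        using a1_pos less_trans[OF inverse_a2_less a2_gt_1] by (simp add: c_def unit_ball_vol_nonneg)
      have "emeasure lborel (W \<zeta>) = ennreal (c * snd \<zeta> ^ (CARD('n) + 1))"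
        using emeasure_whitney[OF s a1_pos a2_gt_1] by (simp add: c_def)
      also have "\<dots> \<le> ennreal (L * (c * snd z ^ (CARD('n) + 1)))"
        using mult_left_mono[OF sz c] by (intro ennreal_leI) (simp add: mult_ac)
      also have "\<dots> = ennreal L * emeasure lborel (W z)"
        using emeasure_whitney[OF z a1_pos a2_gt_1] L by (simp add: c_def ennreal_mult')
      finally have vol: "emeasure lborel (W \<zeta>) \<le> ennreal L * emeasure lborel (W z)" .
      have "I (W z) \<le> of_nat (card K) * I (W \<zeta>)"
        using IW IV by (meson mult_left_mono order_trans zero_le)
      also have "I (W \<zeta>) = I (W \<zeta>) / emeasure lborel (W \<zeta>) * emeasure lborel (W \<zeta>)"
        using emeasure_whitney_W[OF s] by (simp add: ennreal_divide_times)
      also have "of_nat (card K) * \<dots> \<le> of_nat (card K) * (I (W \<zeta>) / emeasure lborel (W \<zeta>) * (ennreal L * emeasure lborel (W z)))"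
        by (intro mult_left_mono vol) auto
      finally have "I (W z) / emeasure lborel (W z) \<le>
          of_nat (card K) * ennreal L * (I (W \<zeta>) / emeasure lborel (W \<zeta>))"
        using emeasure_whitney_W[OF z] by (intro divide_le_posI_ennreal) (auto simp: mult_ac)
      also have "of_nat (card K) * ennreal L = ennreal (real (card K) * L)"
        using L by (simp add: ennreal_mult' ennreal_of_nat_eq_real_of_nat)
      finally have "epow (I (W z) / emeasure lborel (W z)) (1 / enn2real r) \<le>
          epow (ennreal (real (card K) * L) * (I (W \<zeta>) / emeasure lborel (W \<zeta>))) (1 / enn2real r)"
        using r' by (intro epow_mono) auto
      then show ?thesis
        using False L by (simp add: wavg_def I_def[symmetric] epow_mult epow_ennreal C_def)
    qed
    with k(1) show ?thesis by blast
  qed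
  moreover have "0 \<le> C" by (simp add: C_def)
  ultimately show ?thesis
    using \<delta>(1,2) K(2) unfolding V_def by (intro exI[of _ C] exI[of _ \<delta>]) blast
qed

text \<open>Large enough to contain the small regions attached to every z' whose Whitney region
  meets that of z. With heights t and t' <= a2^2 * t, the horizontal distance is below (a2 + 2) * t'
  + t <= 3 * a2^3 * t + a2^3 * t.\<close>

definition wide :: "(real^'n) \<times> real \<Rightarrow> ((real^'n) \<times> real) set" where
  "wide z = whitney (4 * a2 ^ 3) (4 * a2 ^ 3) z"

text \<open>Each z' competing in the supremum has height comparable to that of z, and its average is
  dominated throughout a small region inside \<open>wide z\<close> of volume at least c * t^(n+1).
  Integrating over that region replaces the supremum by an average, for every q > 0.\<close>

lemma H_epow_le_average:
  assumes r: "0 < r" and q: "0 < q"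
  shows "\<exists>C::real. 0 \<le> C \<and> (\<forall>(u :: (real^'n) \<times> real \<Rightarrow> ennreal) z. u \<in> borel_measurable borel \<longrightarrow> 0 < snd z \<longrightarrow>
    epow (H (\<W> r u) z) q \<le> ennreal (C / snd z ^ (CARD('n) + 1)) *
      (\<integral>\<^sup>+\<zeta>. indicator (wide z) \<zeta> * epow (\<W> r u \<zeta>) q \<partial>lborel))"
proof -
  obtain C \<delta> where C: "0 \<le> C" and \<delta>: "0 < \<delta>" "\<delta> \<le> 1"
    and le: "\<And>(u :: (real^'n) \<times> real \<Rightarrow> ennreal) z. u \<in> borel_measurable borel \<Longrightarrow> 0 < snd z \<Longrightarrow>
      (\<exists>k \<in> cball 0 a1 \<times> {1 / a2..a2}. \<forall>\<zeta> \<in> whitney \<delta> (1 + \<delta>) (affine_move z k). \<W> r u z \<le> ennreal C * \<W> r u \<zeta>)"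
    using wavg_le_on_small_whitney[OF r, where 'n='n] by blast
  \<comment> \<open>The volume constant of the small region, divided by the loss in t <= a2^3 * s,
    where s is the height of its centre.\<close>
  define c where "c = unit_ball_vol CARD('n) * \<delta> ^ CARD('n) * (1 + \<delta> - 1 / (1 + \<delta>)) / a2 ^ (3 * (CARD('n) + 1))"
  have "1 / (1 + \<delta>) < 1 + \<delta>"
    using \<delta> less_trans[of "1 / (1 + \<delta>)" 1 "1 + \<delta>"] by simp
  then have c: "0 < c"
    using \<delta> a2_gt_1 unfolding c_def by (intro divide_pos_pos mult_pos_pos) (auto simp: unit_ball_vol_pos)
  have main: "epow (H (\<W> r u) z) q \<le> ennreal (C powr q / c / snd z ^ (CARD('n) + 1)) *
      (\<integral>\<^sup>+\<zeta>. indicator (wide z) \<zeta> * epow (\<W> r u \<zeta>) q \<partial>lborel)"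
    if u [measurable]: "u \<in> borel_measurable borel" and z: "0 < snd z" for u :: "(real^'n) \<times> real \<Rightarrow> ennreal" and z
  proof -
    let ?I = "\<integral>\<^sup>+\<zeta>. indicator (wide z) \<zeta> * epow (\<W> r u \<zeta>) q \<partial>lborel"
    have "epow (\<W> r u z') q \<le> ennreal (C powr q / c / snd z ^ (CARD('n) + 1)) * ?I"
      if \<eta>: "\<eta> \<in> W z" "\<eta> \<in> W z'" for \<eta> z'
    proof -
      let ?t = "snd z" and ?t' = "snd z'"
      have z': "0 < ?t'" using whitney_pos(1)[OF \<eta>(2)] .
      obtain k where k: "k \<in> cball 0 a1 \<times> {1 / a2..a2}"
        "\<And>\<zeta>. \<zeta> \<in> whitney \<delta> (1 + \<delta>) (affine_move z' k) \<Longrightarrow> \<W> r u z' \<le> ennreal C * \<W> r u \<zeta>"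
        using le[OF u z'] by blast
      define V where "V = whitney \<delta> (1 + \<delta>) (affine_move z' k)"
      let ?s = "snd (affine_move z' k)"
      have a2: "0 < a2" using a2_gt_1 by simp
      have h: "snd \<eta> < a2 * ?t" "?t < a2 * snd \<eta>" "snd \<eta> < a2 * ?t'" "?t' < a2 * snd \<eta>"
          "dist (fst \<eta>) (fst z) < a1 * ?t" "dist (fst \<eta>) (fst z') < a1 * ?t'"
        using \<eta> a2 by (auto simp: mem_whitney_iff divide_less_eq mult.commute)
      have tt: "?t' \<le> a2 * (a2 * ?t)" "?t \<le> a2 * (a2 * ?t')"
        using less_imp_le[OF less_trans[OF h(4) mult_strict_left_mono[OF h(1) a2]]]
          less_imp_le[OF less_trans[OF h(2) mult_strict_left_mono[OF h(3) a2]]] .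
      have kk: "norm (fst k) \<le> a1" "1 / a2 \<le> snd k" "snd k \<le> a2"
        using k(1) by auto
      have "1 \<le> a2 * snd k"
        using kk(2) a2 by (simp add: divide_le_eq mult.commute)
      then have s: "?t' \<le> a2 * ?s" "?s \<le> a2 * ?t'"
        using mult_left_mono[of 1 "a2 * snd k" ?t'] mult_left_mono[OF kk(3), of ?t'] z'
        by (simp_all add: affine_move_def mult.commute mult.left_commute)
      have s0: "0 < ?s"
        using less_le_trans[OF z' s(1)] a2 by (simp add: zero_less_mult_iff)
      have ts: "?t \<le> a2 ^ 3 * ?s"
      proof -
        have "a2 * (a2 * ?t') \<le> a2 * (a2 * (a2 * ?s))"
          using s(1) a2 by (intro mult_left_mono) auto
        with tt(2) show ?thesis by (simp add: power3_eq_cube mult.assoc)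
      qed
      have sub: "V \<subseteq> wide z"
      proof
        fix \<zeta> assume "\<zeta> \<in> V"
        then have v: "dist (fst \<zeta>) (fst z' + ?t' *\<^sub>R fst k) < \<delta> * ?s" "?s < (1 + \<delta>) * snd \<zeta>" "snd \<zeta> < (1 + \<delta>) * ?s"
          using \<delta> by (auto simp: V_def mem_whitney_iff affine_move_def divide_less_eq mult.commute)
        have "0 < (1 + \<delta>) * snd \<zeta>" using v(2) s0 by simp
        then have \<zeta>0: "0 < snd \<zeta>" using \<delta> by (simp add: zero_less_mult_iff)
        have d: "dist (fst z' + ?t' *\<^sub>R fst k) (fst z') \<le> a1 * ?t'"
          using kk(1) z' by (simp add: dist_norm mult.commute mult_left_mono)
        have "\<delta> * ?s \<le> 1 * (a2 * ?t')"
          using \<delta> s s0 by (intro mult_mono) auto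
        moreover have "a1 * ?t' \<le> ?t'" "a1 * ?t \<le> ?t"
          using a1_less_1 z z' a1_pos by (auto intro: mult_left_le_one_le)
        moreover have "dist (fst \<zeta>) (fst z) \<le> dist (fst \<zeta>) (fst z' + ?t' *\<^sub>R fst k) +
            dist (fst z' + ?t' *\<^sub>R fst k) (fst z') + dist (fst \<eta>) (fst z') + dist (fst \<eta>) (fst z)"
          using dist_triangle[of "fst \<zeta>" "fst z" "fst z' + ?t' *\<^sub>R fst k"]
            dist_triangle[of "fst z' + ?t' *\<^sub>R fst k" "fst z" "fst z'"]
            dist_triangle[of "fst z'" "fst z" "fst \<eta>"] by (simp add: dist_commute)
        ultimately have "dist (fst \<zeta>) (fst z) < (a2 + 2) * ?t' + ?t"
          using v(1) d h(5,6) by (simp add: algebra_simps)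
        also have "\<dots> \<le> (3 * a2) * (a2 * (a2 * ?t)) + a2 ^ 3 * ?t"
        proof (intro add_mono mult_mono tt)
          show "?t \<le> a2 ^ 3 * ?t" using z a2_gt_1 by (simp add: one_le_power)
        qed (use a2_gt_1 z z' in auto)
        finally have 1: "dist (fst \<zeta>) (fst z) < 4 * a2 ^ 3 * ?t"
          by (simp add: power3_eq_cube algebra_simps)
        have "(1 + \<delta>) * ?s \<le> 2 * (a2 * (a2 * (a2 * ?t)))"
          using \<delta> s0 a2 order_trans[OF s(2) mult_left_mono[OF tt(1), of a2]] by (intro mult_mono) auto
        also have "\<dots> \<le> 4 * a2 ^ 3 * ?t"
          using a2 z by (simp add: power3_eq_cube mult.assoc)
        finally have 2: "snd \<zeta> < 4 * a2 ^ 3 * ?t" using v(3) by simp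
        have "?t \<le> a2 ^ 3 * ?s" by (rule ts)
        also have "\<dots> < a2 ^ 3 * ((1 + \<delta>) * snd \<zeta>)"
          using v(2) a2 by (intro mult_strict_left_mono) auto
        also have "\<dots> \<le> a2 ^ 3 * (4 * snd \<zeta>)"
          using \<delta> \<zeta>0 a2 by (intro mult_left_mono mult_right_mono) auto
        finally have "?t < 4 * a2 ^ 3 * snd \<zeta>" by simp
        with 1 2 a2 show "\<zeta> \<in> wide z"
          by (simp add: wide_def mem_whitney_iff divide_less_eq mult.commute)
      qed
      have "ennreal (c * ?t ^ (CARD('n) + 1)) \<le> emeasure lborel V"
      proof -
        have "c * ?t ^ (CARD('n) + 1) \<le> c * (a2 ^ 3 * ?s) ^ (CARD('n) + 1)"
          using c z ts by (intro mult_left_mono power_mono) auto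
        also have "\<dots> = c * a2 ^ (3 * (CARD('n) + 1)) * ?s ^ (CARD('n) + 1)"
          by (simp only: power_mult_distrib power_mult mult.assoc)
        also have "c * a2 ^ (3 * (CARD('n) + 1)) = unit_ball_vol CARD('n) * \<delta> ^ CARD('n) * (1 + \<delta> - 1 / (1 + \<delta>))"
          using a2 by (simp add: c_def)
        finally show ?thesis
          unfolding V_def using \<delta> s0 by (subst emeasure_whitney) (auto intro: ennreal_leI)
      qed
      then have "ennreal (c * ?t ^ (CARD('n) + 1)) * epow (\<W> r u z') q \<le> emeasure lborel V * epow (\<W> r u z') q"
        by (intro mult_right_mono) auto
      also have "\<dots> = (\<integral>\<^sup>+\<zeta>. indicator V \<zeta> * epow (\<W> r u z') q \<partial>lborel)"
        by (subst nn_integral_multc) (auto simp: V_def)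
      also have "\<dots> \<le> (\<integral>\<^sup>+\<zeta>. ennreal (C powr q) * (indicator (wide z) \<zeta> * epow (\<W> r u \<zeta>) q) \<partial>lborel)"
      proof (intro nn_integral_mono)
        fix \<zeta>
        have "epow (\<W> r u z') q \<le> ennreal (C powr q) * epow (\<W> r u \<zeta>) q" if "\<zeta> \<in> V"
          using epow_mono[OF k(2), of \<zeta> q] that q C by (simp add: V_def epow_mult epow_ennreal)
        then show "indicator V \<zeta> * epow (\<W> r u z') q \<le> ennreal (C powr q) * (indicator (wide z) \<zeta> * epow (\<W> r u \<zeta>) q)"
          using sub by (auto simp: indicator_def)
      qed
      also have "\<dots> = ennreal (C powr q) * ?I"
        by (intro nn_integral_cmult) (simp add: wide_def)
      finally have *: "ennreal (c * ?t ^ (CARD('n) + 1)) * epow (\<W> r u z') q \<le> ennreal (C powr q) * ?I" .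
      have ct: "0 < c * ?t ^ (CARD('n) + 1)" using c z by simp
      have "epow (\<W> r u z') q = ennreal (1 / (c * ?t ^ (CARD('n) + 1))) * (ennreal (c * ?t ^ (CARD('n) + 1)) * epow (\<W> r u z') q)"
        using ct by (subst mult.assoc[symmetric], subst ennreal_mult'[symmetric]) auto
      also have "\<dots> \<le> ennreal (1 / (c * ?t ^ (CARD('n) + 1))) * (ennreal (C powr q) * ?I)"
        by (intro mult_left_mono *) auto
      also have "\<dots> = ennreal (C powr q / c / ?t ^ (CARD('n) + 1)) * ?I"
        using ct by (subst mult.assoc[symmetric], subst ennreal_mult'[symmetric]) auto
      finally show ?thesis .
    qed
    then have "\<W> r u z' \<le> epow (ennreal (C powr q / c / snd z ^ (CARD('n) + 1)) * ?I) (1 / q)"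
      if "\<eta> \<in> W z" "\<eta> \<in> W z'" for \<eta> z'
      using that q by (simp add: epow_le_iff[symmetric])
    then have "H (\<W> r u) z \<le> epow (ennreal (C powr q / c / snd z ^ (CARD('n) + 1)) * ?I) (1 / q)"
      unfolding H_def S_def by (intro SUP_least) auto
    then show ?thesis using q by (simp add: epow_le_iff)
  qed
  show ?thesis
    using main c by (intro exI[of _ "C powr q / c"]) auto
qed

text \<open>Covers both norms: m = n+1 with cones for P and P', m = 1 with tents. After Tonelli, the
  z with \<zeta> in \<open>wide z\<close> have height comparable to that of \<zeta> and fill a
  volume of order s^(n+1), which cancels the normalization of the average.\<close>

lemma nn_integral_H_epow_weighted_le:
  fixes m :: nat
  assumes r: "0 < r" and q: "0 < q"
  shows "\<exists>C::real. 0 \<le> C \<and> (\<forall>(u :: (real^'n) \<times> real \<Rightarrow> ennreal) P P'. u \<in> borel_measurable borel \<longrightarrow>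
    P \<in> sets borel \<longrightarrow> P' \<in> sets borel \<longrightarrow> (\<forall>z\<in>P. 0 < snd z) \<longrightarrow> (\<forall>z\<in>P. wide z \<subseteq> P') \<longrightarrow>
    (\<integral>\<^sup>+z. indicator P z * (epow (H (\<W> r u) z) q * ennreal (1 / snd z ^ m)) \<partial>lborel) \<le>
    ennreal C * (\<integral>\<^sup>+z. indicator P' z * (epow (\<W> r u z) q * ennreal (1 / snd z ^ m)) \<partial>lborel))"
proof -
  obtain C where C: "0 \<le> C" and le: "\<And>(u :: (real^'n) \<times> real \<Rightarrow> ennreal) z. u \<in> borel_measurable borel \<Longrightarrow> 0 < snd z \<Longrightarrow>
    epow (H (\<W> r u) z) q \<le> ennreal (C / snd z ^ (CARD('n) + 1)) *
      (\<integral>\<^sup>+\<zeta>. indicator (wide z) \<zeta> * epow (\<W> r u \<zeta>) q \<partial>lborel)"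
    using H_epow_le_average[OF r q, where 'n='n] by blast
  define b where "b = 4 * a2 ^ 3"
  have b: "1 < b" using one_less_power[OF a2_gt_1, of 3] by (simp add: b_def)
  define d where "d = unit_ball_vol CARD('n) * (b * b) ^ CARD('n) * (b - 1 / b)"
  have "1 / b < b" using b less_trans[of "1 / b" 1 b] by simp
  then have d: "0 \<le> d" using b by (simp add: d_def unit_ball_vol_nonneg)
  define D where "D = C * b ^ (m + (CARD('n) + 1)) * d"
  have "(\<integral>\<^sup>+z. indicator P z * (epow (H (\<W> r u) z) q * ennreal (1 / snd z ^ m)) \<partial>lborel) \<le>
    ennreal D * (\<integral>\<^sup>+z. indicator P' z * (epow (\<W> r u z) q * ennreal (1 / snd z ^ m)) \<partial>lborel)"
    if [measurable]: "u \<in> borel_measurable borel" "P \<in> sets borel" "P' \<in> sets borel"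
      and pos: "\<And>z. z \<in> P \<Longrightarrow> 0 < snd z" and sub: "\<And>z. z \<in> P \<Longrightarrow> wide z \<subseteq> P'"
    for u :: "(real^'n) \<times> real \<Rightarrow> ennreal" and P P'
  proof -
    let ?w = "\<lambda>z :: (real^'n) \<times> real. ennreal (C / snd z ^ (m + (CARD('n) + 1)))"
    have "(\<integral>\<^sup>+z. indicator P z * (epow (H (\<W> r u) z) q * ennreal (1 / snd z ^ m)) \<partial>lborel) \<le>
      (\<integral>\<^sup>+z. \<integral>\<^sup>+\<zeta>. indicator P z * (?w z * (indicator (wide z) \<zeta> * epow (\<W> r u \<zeta>) q)) \<partial>lborel \<partial>lborel)"
    proof (intro nn_integral_mono)
      fix z :: "(real^'n) \<times> real"
      show "indicator P z * (epow (H (\<W> r u) z) q * ennreal (1 / snd z ^ m)) \<le>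
        (\<integral>\<^sup>+\<zeta>. indicator P z * (?w z * (indicator (wide z) \<zeta> * epow (\<W> r u \<zeta>) q)) \<partial>lborel)"
      proof (cases "z \<in> P")
        case True
        let ?I = "\<integral>\<^sup>+\<zeta>. indicator (wide z) \<zeta> * epow (\<W> r u \<zeta>) q \<partial>lborel"
        have "epow (H (\<W> r u) z) q * ennreal (1 / snd z ^ m) \<le>
            ennreal (C / snd z ^ (CARD('n) + 1)) * ?I * ennreal (1 / snd z ^ m)"
          using pos[OF True] by (intro mult_right_mono le) auto
        also have "\<dots> = ennreal (C / snd z ^ (CARD('n) + 1) * (1 / snd z ^ m)) * ?I"
          using C pos[OF True] by (subst ennreal_mult') (auto simp: mult_ac)
        also have "C / snd z ^ (CARD('n) + 1) * (1 / snd z ^ m) = C / snd z ^ (m + (CARD('n) + 1))"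
          by (simp add: power_add mult_ac)
        also have "ennreal (C / snd z ^ (m + (CARD('n) + 1))) * ?I =
            (\<integral>\<^sup>+\<zeta>. ?w z * (indicator (wide z) \<zeta> * epow (\<W> r u \<zeta>) q) \<partial>lborel)"
          by (intro nn_integral_cmult[symmetric]) (simp add: wide_def)
        finally show ?thesis using True by simp
      qed simp
    qed
    also have "\<dots> = (\<integral>\<^sup>+\<zeta>. \<integral>\<^sup>+z. indicator P z * (?w z * (indicator (wide z) \<zeta> * epow (\<W> r u \<zeta>) q)) \<partial>lborel \<partial>lborel)"
      unfolding wide_def by (rule lborel_swap) measurable
    also have "\<dots> \<le> (\<integral>\<^sup>+\<zeta>. ennreal D * (indicator P' \<zeta> * (epow (\<W> r u \<zeta>) q * ennreal (1 / snd \<zeta> ^ m))) \<partial>lborel)"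
    proof (intro nn_integral_mono)
      fix \<zeta> :: "(real^'n) \<times> real"
      let ?s = "snd \<zeta>" and ?N = "CARD('n) + 1"
      let ?c = "ennreal (C * b ^ (m + ?N) / ?s ^ (m + ?N)) * (indicator P' \<zeta> * epow (\<W> r u \<zeta>) q)"
      show "(\<integral>\<^sup>+z. indicator P z * (?w z * (indicator (wide z) \<zeta> * epow (\<W> r u \<zeta>) q)) \<partial>lborel) \<le>
        ennreal D * (indicator P' \<zeta> * (epow (\<W> r u \<zeta>) q * ennreal (1 / ?s ^ m)))"
      proof (cases "0 < ?s")
        case s: True
        have "(\<integral>\<^sup>+z. indicator P z * (?w z * (indicator (wide z) \<zeta> * epow (\<W> r u \<zeta>) q)) \<partial>lborel) \<le>
            (\<integral>\<^sup>+z. ?c * indicator (whitney (b * b) b \<zeta>) z \<partial>lborel)"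
        proof (intro nn_integral_mono)
          fix z
          show "indicator P z * (?w z * (indicator (wide z) \<zeta> * epow (\<W> r u \<zeta>) q)) \<le> ?c * indicator (whitney (b * b) b \<zeta>) z"
          proof (cases "z \<in> P \<and> \<zeta> \<in> wide z")
            case True
            then have t: "0 < snd z" and P': "\<zeta> \<in> P'" using pos sub by blast+
            have z: "dist (fst \<zeta>) (fst z) < b * snd z" "snd z < b * ?s" "?s < b * snd z"
              using True b by (auto simp: wide_def b_def[symmetric] mem_whitney_iff divide_less_eq mult.commute)
            have "b * snd z \<le> b * (b * ?s)" using z(2) b by (intro mult_left_mono) auto
            with z(1) have "dist (fst z) (fst \<zeta>) < b * b * ?s"
              by (simp add: dist_commute mult.assoc)
            with z b have mem: "z \<in> whitney (b * b) b \<zeta>"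
              by (simp add: mem_whitney_iff divide_less_eq mult.commute)
            have "?s ^ (m + ?N) \<le> (b * snd z) ^ (m + ?N)"
              using z(3) s by (intro power_mono) auto
            then have "C / snd z ^ (m + ?N) \<le> C * b ^ (m + ?N) / ?s ^ (m + ?N)"
              using C s t mult_left_mono[of "?s ^ (m + ?N)" "b ^ (m + ?N) * snd z ^ (m + ?N)" C]
              by (simp only: power_mult_distrib) (simp add: divide_le_eq le_divide_eq mult_ac del: power_Suc)
            then have "?w z * epow (\<W> r u \<zeta>) q \<le> ennreal (C * b ^ (m + ?N) / ?s ^ (m + ?N)) * epow (\<W> r u \<zeta>) q"
              by (intro mult_right_mono ennreal_leI) auto
            then show ?thesis using True P' mem by simp
          qed auto
        qed
        also have "\<dots> = ?c * ennreal (d * ?s ^ ?N)"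
          using b s by (subst nn_integral_cmult_indicator) (auto simp: emeasure_whitney d_def)
        also have "\<dots> = ennreal (C * b ^ (m + ?N) / ?s ^ (m + ?N) * (d * ?s ^ ?N)) * (indicator P' \<zeta> * epow (\<W> r u \<zeta>) q)"
          using C b s d by (subst ennreal_mult'[of _ "d * ?s ^ ?N"]) (auto simp: mult_ac)
        also have "C * b ^ (m + ?N) / ?s ^ (m + ?N) * (d * ?s ^ ?N) = D * (1 / ?s ^ m)"
          using s by (simp add: D_def power_add field_simps)
        also have "ennreal (D * (1 / ?s ^ m)) = ennreal D * ennreal (1 / ?s ^ m)"
          using C b d by (intro ennreal_mult') (simp add: D_def)
        finally show ?thesis by (simp add: mult_ac)
      next
        case False
        have "indicator P z * (?w z * (indicator (wide z) \<zeta> * epow (\<W> r u \<zeta>) q)) = 0" for z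
        proof (cases "z \<in> P \<and> \<zeta> \<in> wide z")
          case True
          then have "snd z / b < ?s" "0 < snd z"
            using pos by (auto simp: wide_def b_def[symmetric] mem_whitney_iff)
          moreover from this(2) have "0 < snd z / b" using b by simp
          ultimately show ?thesis using False by simp
        qed auto
        then show ?thesis by (simp only: nn_integral_const mult_zero_left zero_le)
      qed
    qed
    also have "\<dots> = ennreal D * (\<integral>\<^sup>+z. indicator P' z * (epow (\<W> r u z) q * ennreal (1 / snd z ^ m)) \<partial>lborel)"
      by (intro nn_integral_cmult) measurable
    finally show ?thesis .
  qed
  moreover have "0 \<le> D" using C b d by (simp add: D_def)
  ultimately show ?thesis by (intro exI[of _ D]) blast
qed

end

section \<open>Tent space norms\<close>

lemma enn2real_pos: "0 < q \<Longrightarrow> q \<noteq> top \<Longrightarrow> 0 < enn2real q"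
  by (simp add: enn2real_positive_iff less_top)

section \<open>Area functions and Carleson norms\<close>

definition area_density :: "real \<Rightarrow> ((real^'n) \<times> real \<Rightarrow> ennreal) \<Rightarrow> (real^'n) \<times> real \<Rightarrow> ennreal" where
  "area_density q g z = epow (g z) q * ennreal (1 / snd z ^ (CARD('n) + 1))"

lemma borel_measurable_area_density [measurable]:
  assumes [measurable]: "g \<in> borel_measurable borel"
  shows "area_density q g \<in> borel_measurable borel"
  unfolding area_density_def[abs_def] by measurable

text \<open>The function whose \<open>L\<^sup>p\<close> norm is the tent space norm when \<open>p < \<infinity>\<close>: the area function for
  \<open>q < \<infinity>\<close>, the nontangential maximal function for \<open>q = \<infinity>\<close>.\<close>

definition area :: "ennreal \<Rightarrow> ((real^'n) \<times> real \<Rightarrow> ennreal) \<Rightarrow> real^'n \<Rightarrow> ennreal" where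
  "area q g x = (if q = top then SUP z\<in>cone x. g z
     else epow (cone_area 1 (area_density (enn2real q) g) x) (1 / enn2real q))"

lemma borel_measurable_area [measurable]:
  assumes [measurable]: "g \<in> borel_measurable borel"
  shows "area q g \<in> borel_measurable borel"
proof (cases "q = top")
  case True
  then have "area q g = (\<lambda>x. SUP z\<in>cone x. g z)" by (auto simp: area_def)
  then show ?thesis by (simp add: borel_measurable_SUP_open open_cone_fiber)
next
  case False
  then have "area q g = (\<lambda>x. epow (cone_area 1 (area_density (enn2real q) g) x) (1 / enn2real q))"
    by (auto simp: area_def)
  then show ?thesis by simp
qed

lemma tent_norm_eq_area:
  fixes g :: "(real^'n) \<times> real \<Rightarrow> ennreal"
  assumes "p \<noteq> top" "0 < q"
  shows "tent_norm p q g = epow (\<integral>\<^sup>+x. epow (area q g x) (enn2real p) \<partial>lborel) (1 / enn2real p)"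
proof (cases "q = top")
  case False
  have "(\<integral>\<^sup>+ yt. indicator (cone x) yt * epow (g yt) (enn2real q) * ennreal (1 / snd yt ^ (CARD('n) + 1)) \<partial>lborel)
      = cone_area 1 (area_density (enn2real q) g) x" for x
    unfolding cone_area_def area_density_def wide_cone_1 by (simp only: mult.assoc)
  then show ?thesis
    using False assms by (simp add: tent_norm_def area_def epow_epow)
qed (use assms in \<open>simp add: tent_norm_def area_def\<close>)

lemma cone_area_mono: "(\<And>z. z \<in> wide_cone b x \<Longrightarrow> g z \<le> h z) \<Longrightarrow> cone_area b g x \<le> cone_area b h x"
  unfolding cone_area_def by (intro nn_integral_mono) (auto simp: indicator_def)

lemma area_density_mono: "0 \<le> q \<Longrightarrow> g z \<le> h z \<Longrightarrow> area_density q g z \<le> area_density q h z"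
  unfolding area_density_def by (intro mult_right_mono epow_mono) auto

lemma area_mono:
  assumes "\<And>z. 0 < snd z \<Longrightarrow> g z \<le> h z"
  shows "area q g x \<le> area q h x"
proof -
  have le: "g z \<le> h z" if "z \<in> cone x" for z
    using assms cone_imp_pos[OF that] .
  show ?thesis
  proof (cases "q = top")
    case True
    have "(SUP z\<in>cone x. g z) \<le> (SUP z\<in>cone x. h z)"
      using le by (intro SUP_mono) blast
    then show ?thesis using True by (simp add: area_def)
  next
    case False
    have "cone_area 1 (area_density (enn2real q) g) x \<le> cone_area 1 (area_density (enn2real q) h) x"
      by (intro cone_area_mono area_density_mono le) (simp_all add: wide_cone_1)
    then show ?thesis using False by (simp add: area_def epow_mono)
  qed
qed

text \<open>Quotient and root can be cleared because balls of positive radius have positive finite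
  volume. The outer supremum over x drops out, since each ball contains its centre.\<close>

lemma tent_norm_top_le_iff:
  fixes g :: "(real^'n) \<times> real \<Rightarrow> ennreal"
  assumes q: "0 < q" "q \<noteq> top"
  shows "tent_norm top q g \<le> C \<longleftrightarrow> (\<forall>c \<rho>. 0 < \<rho> \<longrightarrow>
    (\<integral>\<^sup>+z. indicator (tent (ball c \<rho>)) z * (epow (g z) (enn2real q) * ennreal (1 / snd z)) \<partial>lborel)
      \<le> epow C (enn2real q) * emeasure lborel (ball c \<rho>))"
proof -
  have q': "0 < enn2real q" using enn2real_pos[OF q] .
  define I where "I B = (\<integral>\<^sup>+z. indicator (tent B) z * (epow (g z) (enn2real q) * ennreal (1 / snd z)) \<partial>lborel)" for B
  have *: "epow (I B) (1 / enn2real q) / epow (emeasure lborel B) (1 / enn2real q) \<le> C \<longleftrightarrow>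
      I B \<le> epow C (enn2real q) * emeasure lborel B"
    if B: "emeasure lborel B \<noteq> 0" "emeasure lborel B \<noteq> top" for B :: "(real^'n) set"
  proof -
    let ?e = "epow (emeasure lborel B) (1 / enn2real q)"
    have e: "?e \<noteq> 0" "?e \<noteq> top" using B by simp_all
    have "epow (I B) (1 / enn2real q) / ?e \<le> C \<longleftrightarrow> epow (I B) (1 / enn2real q) \<le> C * ?e"
    proof
      assume "epow (I B) (1 / enn2real q) / ?e \<le> C"
      then have "epow (I B) (1 / enn2real q) / ?e * ?e \<le> C * ?e" by (rule mult_right_mono) simp
      then show "epow (I B) (1 / enn2real q) \<le> C * ?e"
        using e by (simp add: ennreal_divide_times less_top)
    next
      assume "epow (I B) (1 / enn2real q) \<le> C * ?e"
      then show "epow (I B) (1 / enn2real q) / ?e \<le> C"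
        using e by (intro divide_le_posI_ennreal) (simp_all add: mult.commute zero_less_iff_neq_zero)
    qed
    also have "\<dots> \<longleftrightarrow> I B \<le> epow (C * ?e) (enn2real q)"
      using epow_le_iff[of "1 / enn2real q" "I B" "C * ?e"] q' by simp
    also have "epow (C * ?e) (enn2real q) = epow C (enn2real q) * emeasure lborel B"
      using q' by (simp add: epow_mult)
    finally show ?thesis .
  qed
  have B: "emeasure lborel (ball c \<rho>) \<noteq> 0" "emeasure lborel (ball c \<rho>) \<noteq> top" if "0 < \<rho>" for c :: "real^'n" and \<rho>
    using emeasure_ball_pos[OF that, of c] emeasure_ball_finite[of c \<rho>] by (auto simp del: emeasure_ball_finite)
  have "tent_norm top q g = (SUP x. SUP B\<in>{ball c \<rho> | c \<rho>. 0 < \<rho> \<and> x \<in> ball c \<rho>}.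
      epow (I B) (1 / enn2real q) / epow (emeasure lborel B) (1 / enn2real q))"
    using q by (auto simp: tent_norm_def I_def mult.assoc intro!: SUP_cong)
  then have "tent_norm top q g \<le> C \<longleftrightarrow> (\<forall>x. \<forall>B\<in>{ball c \<rho> | c \<rho>. 0 < \<rho> \<and> x \<in> ball c \<rho>}.
      epow (I B) (1 / enn2real q) / epow (emeasure lborel B) (1 / enn2real q) \<le> C)"
    by (simp only: SUP_le_iff) blast
  also have "\<dots> \<longleftrightarrow> (\<forall>c \<rho>. 0 < \<rho> \<longrightarrow>
      epow (I (ball c \<rho>)) (1 / enn2real q) / epow (emeasure lborel (ball c \<rho>)) (1 / enn2real q) \<le> C)"
  proof (intro iffI allI impI ballI)
    fix c :: "real^'n" and \<rho> :: real assume all: "\<forall>x. \<forall>B\<in>{ball c \<rho> | c \<rho>. 0 < \<rho> \<and> x \<in> ball c \<rho>}.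
      epow (I B) (1 / enn2real q) / epow (emeasure lborel B) (1 / enn2real q) \<le> C" and "0 < \<rho>"
    have "ball c \<rho> \<in> {ball c' \<rho> | c' \<rho>. 0 < \<rho> \<and> c \<in> ball c' \<rho>}"
      using \<open>0 < \<rho>\<close> by (intro CollectI exI[of _ c] exI[of _ \<rho>]) simp
    with all show "epow (I (ball c \<rho>)) (1 / enn2real q) / epow (emeasure lborel (ball c \<rho>)) (1 / enn2real q) \<le> C"
      by blast
  qed auto
  also have "\<dots> \<longleftrightarrow> (\<forall>c \<rho>. 0 < \<rho> \<longrightarrow> I (ball c \<rho>) \<le> epow C (enn2real q) * emeasure lborel (ball c \<rho>))"
    using * B by blast
  finally show ?thesis unfolding I_def .
qed

lemma tent_norm_mono:
  fixes g h :: "(real^'n) \<times> real \<Rightarrow> ennreal"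
  assumes q: "0 < q" and le: "\<And>z. 0 < snd z \<Longrightarrow> g z \<le> h z"
  shows "tent_norm p q g \<le> tent_norm p q h"
proof (cases "p = top")
  case False
  have "(\<integral>\<^sup>+x. epow (area q g x) (enn2real p) \<partial>lborel) \<le> (\<integral>\<^sup>+x. epow (area q h x) (enn2real p) \<partial>lborel)"
    by (intro nn_integral_mono epow_mono area_mono le) auto
  then show ?thesis using False q by (simp add: tent_norm_eq_area epow_mono)
next
  case p: True
  show ?thesis
  proof (cases "q = top")
    case True
    have "AE z in lborel. z \<in> {yt. 0 < snd yt} \<longrightarrow> g z \<le> tent_norm p q h"
      using AE_le_ess_sup_on[of "{yt. 0 < snd yt}" h]
    proof eventually_elim
      case (elim z)
      then show ?case using le[of z] p True by (auto simp: tent_norm_def intro: order_trans)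
    qed
    then show ?thesis using p True ess_sup_on_le_iff[of "{yt. 0 < snd yt}" g] by (simp add: tent_norm_def)
  next
    case False
    have "(\<integral>\<^sup>+z. indicator (tent (ball c \<rho>)) z * (epow (g z) (enn2real q) * ennreal (1 / snd z)) \<partial>lborel)
      \<le> epow (tent_norm top q h) (enn2real q) * emeasure lborel (ball c \<rho>)" if \<rho>: "0 < \<rho>" for c \<rho>
    proof -
      have "(\<integral>\<^sup>+z. indicator (tent (ball c \<rho>)) z * (epow (g z) (enn2real q) * ennreal (1 / snd z)) \<partial>lborel) \<le>
        (\<integral>\<^sup>+z. indicator (tent (ball c \<rho>)) z * (epow (h z) (enn2real q) * ennreal (1 / snd z)) \<partial>lborel)"
        using le by (intro nn_integral_mono) (auto simp: indicator_def tent_def intro!: mult_right_mono epow_mono)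
      also have "\<dots> \<le> epow (tent_norm top q h) (enn2real q) * emeasure lborel (ball c \<rho>)"
        using tent_norm_top_le_iff[OF q False, of h "tent_norm top q h"] \<rho> by blast
      finally show ?thesis .
    qed
    then show ?thesis
      using tent_norm_top_le_iff[OF q False, of g "tent_norm top q h"] p by blast
  qed
qed

lemma tent_ball_eq: "tent (ball c \<rho>) = {z. 0 < snd z \<and> dist (fst z) c + snd z \<le> \<rho>}"
  by (auto simp: tent_def ball_subset_ball_iff)

lemma sets_tent_ball [measurable]: "tent (ball c \<rho>) \<in> sets borel"
proof -
  have "tent (ball c \<rho>) = {z. 0 < snd z} \<inter> {z. dist (fst z) c + snd z \<le> \<rho>}"
    by (auto simp: tent_ball_eq)
  also have "\<dots> \<in> sets borel"
    by (intro sets.Int borel_open borel_closed open_Collect_less closed_Collect_le continuous_intros)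
  finally show ?thesis .
qed

text \<open>For p < top the area function is finite a.e., so almost every cone meets
  \<open>{z. h z = top}\<close> in a null set. By Tonelli, for a.e. z in that set the ball of z
  would be null, which is absurd. For p = top, tents over growing balls exhaust the half space and
  each carries a finite integral.\<close>

lemma AE_finite_of_tent_norm_finite:
  fixes h :: "(real^'n) \<times> real \<Rightarrow> ennreal"
  assumes [measurable]: "h \<in> borel_measurable borel" and p: "0 < p" and q: "0 < q"
    and not_top: "p \<noteq> top \<or> q \<noteq> top" and fin: "tent_norm p q h < top"
  shows "AE z in lborel. 0 < snd z \<longrightarrow> h z < top"
proof (cases "p = top")
  case False
  have p': "0 < enn2real p" using enn2real_pos[OF p False] .
  have "(\<integral>\<^sup>+x. epow (area q h x) (enn2real p) \<partial>lborel) < top"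
    using fin False q by (simp add: tent_norm_eq_area)
  then have "AE x in lborel. epow (area q h x) (enn2real p) \<noteq> \<infinity>"
    by (intro nn_integral_PInf_AE) auto
  then have area_fin: "AE x in lborel. area q h x < top"
    by eventually_elim (simp add: less_top)
  have cone: "(\<integral>\<^sup>+z. indicator (wide_cone 1 x) z * indicator {z. h z = top} z \<partial>lborel) = (0::ennreal)"
    if x: "area q h x < top" for x
  proof (cases "q = top")
    case True
    have "indicator (wide_cone 1 x) z * indicator {z. h z = top} z = (0::ennreal)" for z
    proof -
      have "h z \<le> area q h x" if "z \<in> cone x"
        using that True by (auto simp: area_def intro: SUP_upper)
      with x show ?thesis by (auto simp: indicator_def wide_cone_1)
    qed
    then show ?thesis by (simp only: nn_integral_const mult_zero_left)
  next
    case False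
    then have "cone_area 1 (area_density (enn2real q) h) x < top"
      using x by (simp add: area_def)
    then have "AE z in lborel. indicator (wide_cone 1 x) z * area_density (enn2real q) h z \<noteq> \<infinity>"
      unfolding cone_area_def by (intro nn_integral_PInf_AE) auto
    then have "AE z in lborel. indicator (wide_cone 1 x) z * indicator {z. h z = top} z = (0::ennreal)"
    proof eventually_elim
      case (elim z)
      show ?case
      proof (cases "z \<in> cone x \<and> h z = top")
        case True
        then have "0 < snd z" using cone_imp_pos by blast
        then have "area_density (enn2real q) h z = top"
          using True by (simp add: area_density_def ennreal_top_mult)
        with elim True show ?thesis by (simp add: wide_cone_1)
      qed (auto simp: indicator_def wide_cone_1)
    qed
    then show ?thesis by (subst nn_integral_0_iff_AE) auto
  qed
  have "(\<integral>\<^sup>+z. \<integral>\<^sup>+x. indicator (wide_cone 1 x) z * indicator {z. h z = top} z \<partial>(lborel :: (real^'n) measure) \<partial>lborel) =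
      (\<integral>\<^sup>+x. \<integral>\<^sup>+z. indicator (wide_cone 1 x) z * indicator {z. h z = top} z \<partial>lborel \<partial>lborel)"
    by (rule lborel_swap) measurable
  also have "\<dots> = 0"
    using area_fin by (subst nn_integral_0_iff_AE) (auto elim!: eventually_mono simp: cone)
  finally have "AE z in lborel. (\<integral>\<^sup>+x. indicator (wide_cone 1 x) z * indicator {z. h z = top} z \<partial>(lborel :: (real^'n) measure)) = (0::ennreal)"
    by (subst (asm) nn_integral_0_iff_AE) auto
  then show ?thesis
  proof eventually_elim
    case (elim z)
    show ?case
    proof
      assume z: "0 < snd z"
      show "h z < top"
      proof (rule ccontr)
        assume "\<not> ?thesis"
        then have "h z = top" by (simp add: less_top[symmetric])
        then have "(\<integral>\<^sup>+x. indicator (ball (fst z) (snd z)) x \<partial>(lborel :: (real^'n) measure)) =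
            (\<integral>\<^sup>+x. indicator (wide_cone 1 x) z * indicator {z. h z = top} z \<partial>lborel)"
          by (intro nn_integral_cong) (auto simp: indicator_def wide_cone_def)
        with elim have "emeasure lborel (ball (fst z) (snd z)) = 0" by simp
        with emeasure_ball_pos[OF z, of "fst z"] show False by simp
      qed
    qed
  qed
next
  case True
  with not_top have q': "q \<noteq> top" by simp
  have "AE z in lborel. z \<in> tent (ball 0 (real (Suc k))) \<longrightarrow> h z < top" for k
  proof -
    have "(\<integral>\<^sup>+z. indicator (tent (ball 0 (real (Suc k)))) z * (epow (h z) (enn2real q) * ennreal (1 / snd z)) \<partial>lborel)
      \<le> epow (tent_norm top q h) (enn2real q) * emeasure lborel (ball (0::real^'n) (real (Suc k)))"
      using tent_norm_top_le_iff[OF q q', of h "tent_norm top q h"] by (auto simp del: of_nat_Suc)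
    also have "\<dots> < top"
      using fin True emeasure_ball_finite[of "0::real^'n" "real (Suc k)"] by (simp add: ennreal_mult_less_top del: of_nat_Suc)
    finally have "AE z in lborel. indicator (tent (ball 0 (real (Suc k)))) z * (epow (h z) (enn2real q) * ennreal (1 / snd z)) \<noteq> \<infinity>"
      by (intro nn_integral_PInf_AE) auto
    then show ?thesis
    proof eventually_elim
      case (elim z)
      show ?case
      proof
        assume z: "z \<in> tent (ball 0 (real (Suc k)))"
        then have "0 < snd z" by (auto simp: tent_def)
        then show "h z < top"
          using elim z by (cases "h z = top") (auto simp: ennreal_top_mult less_top)
      qed
    qed
  qed
  then have "AE z in lborel. \<forall>k. z \<in> tent (ball 0 (real (Suc k))) \<longrightarrow> h z < top"
    unfolding AE_all_countable by blast
  then show ?thesis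
  proof eventually_elim
    case (elim z)
    show ?case
    proof
      assume "0 < snd z"
      moreover obtain k where "dist (fst z) 0 + snd z < real k" using reals_Archimedean2 by blast
      ultimately have "z \<in> tent (ball 0 (real (Suc k)))" by (simp add: tent_ball_eq)
      with elim show "h z < top" by blast
    qed
  qed
qed

lemma tent_norm_le_of_area:
  fixes g h :: "(real^'n) \<times> real \<Rightarrow> ennreal"
  assumes p: "0 < p" "p \<noteq> top" and q: "0 < q" "0 < q'"
    and le: "(\<integral>\<^sup>+x. epow (area q' h x) (enn2real p) \<partial>lborel) \<le> K * (\<integral>\<^sup>+x. epow (area q g x) (enn2real p) \<partial>lborel)"
  shows "tent_norm p q' h \<le> epow K (1 / enn2real p) * tent_norm p q g"
  using epow_mono[OF le, of "1 / enn2real p"] enn2real_pos[OF p] p q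
  by (simp add: tent_norm_eq_area epow_mult)

section \<open>Tent space estimates for the two factors\<close>

context whitney_params begin

text \<open>A common point of the two Whitney regions gives t < a2^2 * t' and horizontal distance
  below t + t'. Adding the distance below t from the vertex x gives 2 * t + t', hence the
  constant.\<close>

lemma less_H_imp:
  assumes z: "z \<in> cone x" and l: "l < H k z"
  shows "\<exists>z'. 0 < snd z' \<and> dist x (fst z') < (2 * (a2 * a2) + 1) * snd z' \<and> l < k z'"
proof -
  obtain \<zeta> z' where \<zeta>: "\<zeta> \<in> W z" "\<zeta> \<in> W z'" and lk: "l < k z'"
    using l by (auto simp: H_def S_def less_SUP_iff)
  note pos = whitney_pos(1)[OF \<zeta>(1)] whitney_pos(1)[OF \<zeta>(2)]
  have a2: "0 < a2" using a2_gt_1 by simp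
  have h: "snd z < a2 * snd \<zeta>" "snd \<zeta> < a2 * snd z'" "dist (fst \<zeta>) (fst z) < a1 * snd z" "dist (fst \<zeta>) (fst z') < a1 * snd z'"
    using \<zeta> a2 by (auto simp: mem_whitney_iff divide_less_eq mult.commute)
  have t: "snd z < a2 * a2 * snd z'"
    using less_trans[OF h(1) mult_strict_left_mono[OF h(2) a2]] by (simp add: mult.assoc)
  have a1: "a1 * snd z \<le> snd z" "a1 * snd z' \<le> snd z'"
    using a1_less_1 a1_pos pos by (auto intro: mult_left_le_one_le)
  have "dist x (fst z') \<le> dist (fst z) x + dist (fst \<zeta>) (fst z) + dist (fst \<zeta>) (fst z')"
    using dist_triangle[of x "fst z'" "fst z"] dist_triangle[of "fst z" "fst z'" "fst \<zeta>"]
    by (simp add: dist_commute)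
  also have "\<dots> < snd z + snd z + snd z'"
    using z h(3,4) a1 by (simp add: mem_cone_iff)
  also have "\<dots> \<le> (2 * (a2 * a2) + 1) * snd z'"
    using t by (simp add: algebra_simps)
  finally show ?thesis using pos lk by blast
qed

text \<open>Where the nontangential maximal function exceeds l, some place with median above l is
  near, and the measure of such points is controlled by that of \<open>{x. l < A x}\<close>.
  Comparing level sets makes this work for every p > 0.\<close>

lemma nn_integral_area_H_half_median_le:
  fixes A :: "real^'n \<Rightarrow> ennreal"
  assumes [measurable]: "A \<in> borel_measurable borel" and p: "0 < p"
  shows "(\<integral>\<^sup>+x. epow (area top (H (half_median A)) x) p \<partial>lborel) \<le>
    2 * ennreal (2 * (5 * (2 * (a2 * a2) + 1)) ^ CARD('n)) * (\<integral>\<^sup>+x. epow (A x) p \<partial>lborel)"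
proof (rule nn_integral_le_by_levels)
  let ?b = "2 * (a2 * a2) + 1"
  fix \<mu> :: real assume \<mu>: "0 < \<mu>"
  define l where "l = epow (ennreal \<mu>) (1 / p)"
  let ?S = "{x. \<exists>z. 0 < snd z \<and> dist x (fst z) < ?b * snd z \<and> l < half_median A z}"
  have "{x. ennreal \<mu> < epow (area top (H (half_median A)) x) p} = {x. l < area top (H (half_median A)) x}"
    using p by (simp add: less_epow_iff l_def)
  also have "\<dots> \<subseteq> ?S"
  proof
    fix x assume "x \<in> {x. l < area top (H (half_median A)) x}"
    then obtain z where "z \<in> cone x" "l < H (half_median A) z"
      by (auto simp: area_def less_SUP_iff)
    from less_H_imp[OF this] show "x \<in> ?S" by simp
  qed
  finally have "emeasure lborel {x. ennreal \<mu> < epow (area top (H (half_median A)) x) p} \<le> emeasure lborel ?S"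
    by (rule emeasure_mono) (simp only: sets_lborel, intro borel_open open_near_balls)
  also have "\<dots> \<le> ennreal (2 * (5 * ?b) ^ CARD('n)) * emeasure lborel {x. l < A x}"
    by (intro emeasure_near_high_median_le) auto
  also have "{x. l < A x} = {x. ennreal \<mu> < epow (A x) p}"
    using p by (simp add: less_epow_iff l_def)
  also have "emeasure lborel \<dots> \<le> (\<integral>\<^sup>+x. epow (min 1 (epow (A x) p / ennreal \<mu>)) 2 \<partial>lborel)"
    by (intro emeasure_level_le_nn_integral_min \<mu>) measurable
  finally show "emeasure lborel {x. ennreal \<mu> < epow (area top (H (half_median A)) x) p} \<le>
      ennreal (2 * (5 * ?b) ^ CARD('n)) * (\<integral>\<^sup>+x. epow (min 1 (epow (A x) p / ennreal \<mu>)) 2 \<partial>lborel)"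
    by (simp add: mult_left_mono)
qed measurable

lemma wavg_eq_0I:
  assumes "AE \<zeta> in lborel. \<zeta> \<in> W z \<longrightarrow> u \<zeta> = 0"
  shows "\<W> r u z = 0"
proof -
  have "\<W> r u z \<le> \<W> r (\<lambda>_. 0) z"
    using assms by (intro wavg_mono_AE) (auto elim!: eventually_mono)
  moreover have "ess_sup_on (W z) (\<lambda>_. 0) = 0"
    using ess_sup_on_le_iff[of "W z" "\<lambda>_. 0" 0] by simp
  ultimately show ?thesis by (simp add: wavg_def split: if_splits)
qed

text \<open>By Tonelli, for a.e. \<zeta> with \<open>u \<zeta>\<close> > 0 the points of P whose
  Whitney region contains \<zeta> form a null set. This set is open, hence empty, so u vanishes a.e.
  on the Whitney region of every point of P.\<close>

lemma wavg_eq_0_everywhere: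
  fixes u :: "(real^'n) \<times> real \<Rightarrow> ennreal"
  assumes [measurable]: "u \<in> borel_measurable borel" and r: "0 < r" and P: "open P"
    and AE: "AE z in lborel. z \<in> P \<longrightarrow> \<W> r u z = 0" and z: "z \<in> P"
  shows "\<W> r u z = 0"
proof (rule wavg_eq_0I)
  have [measurable]: "P \<in> sets borel" using P by (rule borel_open)
  let ?f = "\<lambda>z \<zeta>. indicator P z * (indicator (W z) \<zeta> * indicator {\<zeta>. 0 < u \<zeta>} \<zeta>) :: ennreal"
  have "(\<integral>\<^sup>+\<zeta>. \<integral>\<^sup>+z. ?f z \<zeta> \<partial>lborel \<partial>lborel) = (\<integral>\<^sup>+z. \<integral>\<^sup>+\<zeta>. ?f z \<zeta> \<partial>lborel \<partial>lborel)"
    by (rule lborel_swap) measurable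
  also have "\<dots> = 0"
  proof (rule nn_integral_0_iff_AE[THEN iffD2])
    have "(\<lambda>z. \<integral>\<^sup>+\<zeta>. ?f z \<zeta> \<partial>lborel) \<in> borel_measurable borel"
      by measurable
    then show "(\<lambda>z. \<integral>\<^sup>+\<zeta>. ?f z \<zeta> \<partial>lborel) \<in> borel_measurable lborel"
      by simp
    show "AE z in lborel. (\<integral>\<^sup>+\<zeta>. ?f z \<zeta> \<partial>lborel) = 0"
      using AE
    proof eventually_elim
      case (elim z)
      have "AE \<zeta> in lborel. ?f z \<zeta> = 0"
      proof (cases "z \<in> P \<and> 0 < snd z")
        case True
        with elim have "\<W> r u z = 0" by blast
        from wavg_eq_0_imp[OF _ r this] True show ?thesis
          by (auto elim!: eventually_mono simp: indicator_def)
      next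
        case False
        then have "?f z \<zeta> = 0" for \<zeta>
          using whitney_pos(1)[of \<zeta> z] by (auto simp: indicator_def)
        then show ?thesis by simp
      qed
      then show ?case by (subst nn_integral_0_iff_AE) auto
    qed
  qed
  finally have "AE \<zeta> in lborel. (\<integral>\<^sup>+z. ?f z \<zeta> \<partial>lborel) = 0"
    by (subst (asm) nn_integral_0_iff_AE) auto
  then show "AE \<zeta> in lborel. \<zeta> \<in> W z \<longrightarrow> u \<zeta> = 0"
  proof eventually_elim
    case (elim \<zeta>)
    show ?case
    proof
      assume \<zeta>: "\<zeta> \<in> W z"
      show "u \<zeta> = 0"
      proof (rule ccontr)
        assume u: "u \<zeta> \<noteq> 0"
        let ?O = "P \<inter> {z. \<zeta> \<in> W z}"
        have O: "open ?O" using P open_whitney_fiber by (rule open_Int)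
        have "(\<integral>\<^sup>+z. ?f z \<zeta> \<partial>lborel) = (\<integral>\<^sup>+z. indicator ?O z \<partial>lborel)"
          using u by (intro nn_integral_cong) (auto simp: indicator_def zero_less_iff_neq_zero)
        also have "\<dots> = emeasure lborel ?O"
          using O by (intro nn_integral_indicator) auto
        finally have "?O \<in> null_sets lborel"
          using elim O by (intro null_setsI) auto
        moreover have "?O \<noteq> {}" using z \<zeta> by blast
        ultimately show False
          using O open_not_negligible null_sets_completionI negligible_iff_null_sets by blast
      qed
    qed
  qed
qed

text \<open>From \<open>k z * \<W> r (quot k u) z\<close> <= \<open>k z\<close> the factor
  \<open>k z\<close> can be cancelled when it is positive and finite. It is finite a.e. because
  \<open>k z\<close> <= \<open>S k z\<close>, and positive unless the average of u is 0, where the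
  average of the quotient is 0 too.\<close>

lemma wavg_quot_le_1:
  fixes u :: "(real^'n) \<times> real \<Rightarrow> ennreal"
  assumes u: "u \<in> borel_measurable borel" and r: "0 < r"
    and le: "\<And>z. 0 < snd z \<Longrightarrow> \<W> r u z \<le> k z"
    and fin: "AE z in lborel. 0 < snd z \<longrightarrow> S k z < top"
  shows "tent_norm top top (\<W> r (quot k u)) \<le> 1"
proof -
  have "AE z in lborel. z \<in> {yt. 0 < snd yt} \<longrightarrow> \<W> r (quot k u) z \<le> 1"
    using fin
  proof eventually_elim
    case (elim z)
    show ?case
    proof
      assume "z \<in> {yt. 0 < snd yt}"
      then have z: "0 < snd z" by simp
      show "\<W> r (quot k u) z \<le> 1"
      proof (cases "\<W> r u z = 0")
        case True
        then show ?thesis using wavg_quot_eq_0[OF u r _ z] by simp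
      next
        case False
        then have k: "0 < k z" using le[OF z] by (auto simp: zero_less_iff_neq_zero)
        have "k z \<le> S k z" using z by (intro le_S self_in_whitney)
        with elim z have "k z < top" by auto
        moreover have "k z * \<W> r (quot k u) z \<le> k z * 1"
          using order_trans[OF mult_wavg_quot_le[OF u r] le[OF z]] by simp
        ultimately show ?thesis using k by (subst (asm) ennreal_mult_le_mult_iff) auto
      qed
    qed
  qed
  then show ?thesis
    using ess_sup_on_le_iff[of "{yt. 0 < snd yt}" "\<W> r (quot k u)" 1] by (simp add: tent_norm_def)
qed

lemma cone_area_zero_imp:
  fixes u :: "(real^'n) \<times> real \<Rightarrow> ennreal"
  assumes [measurable]: "u \<in> borel_measurable borel" and r: "0 < r"
    and 0: "cone_area 1 (area_density q (\<W> r u)) x = 0" and z: "z \<in> cone x"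
  shows "\<W> r u z = 0"
proof (rule wavg_eq_0_everywhere[OF _ r, of _ "cone x"])
  show "open (cone x)"
    unfolding wide_cone_1[symmetric] wide_cone_def by (intro open_Collect_less continuous_intros)
  have "AE z in lborel. indicator (wide_cone 1 x) z * area_density q (\<W> r u) z = 0"
    using 0 unfolding cone_area_def by (subst (asm) nn_integral_0_iff_AE) auto
  then show "AE z in lborel. z \<in> cone x \<longrightarrow> \<W> r u z = 0"
  proof eventually_elim
    case (elim z)
    then show ?case
      using cone_imp_pos[of z x] by (auto simp: wide_cone_1 area_density_def indicator_def)
  qed
qed (use z in auto)

text \<open>With median 0 the area function would vanish at some x of the ball of z. The cone over x
  contains z, and a vanishing area kills the average at every point of the cone, not just almost
  every one.\<close>

lemma half_median_area_pos:
  fixes u :: "(real^'n) \<times> real \<Rightarrow> ennreal"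
  assumes [measurable]: "u \<in> borel_measurable borel" and r: "0 < r" and q: "q \<noteq> top"
    and z: "0 < snd z" and pos: "0 < \<W> r u z"
  shows "0 < half_median (area q (\<W> r u)) z"
proof (rule ccontr)
  let ?A = "area q (\<W> r u)"
  assume "\<not> ?thesis"
  then have 0: "half_median ?A z = 0" by (simp add: zero_less_iff_neq_zero)
  have "0 < emeasure lborel (ball (fst z) (snd z))" using z by (rule emeasure_ball_pos)
  also have "\<dots> \<le> 2 * emeasure lborel {x \<in> ball (fst z) (snd z). ?A x \<le> half_median ?A z}"
    by (intro emeasure_ball_le_below_half_median) measurable
  finally have "{x \<in> ball (fst z) (snd z). ?A x \<le> half_median ?A z} \<noteq> {}"
    by (metis emeasure_empty less_irrefl mult_zero_right)
  then obtain x where "x \<in> ball (fst z) (snd z)" "?A x = 0"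
    using 0 by auto
  then have "cone_area 1 (area_density (enn2real q) (\<W> r u)) x = 0" "z \<in> cone x"
    using q by (auto simp: area_def mem_cone_iff)
  from cone_area_zero_imp[OF _ r this] pos show False by simp
qed

text \<open>z lies in the cone over each point of its ball, so the maximal function is at least
  \<open>g z\<close> on the whole ball, not merely on half of it.\<close>

lemma le_half_median_area_top:
  assumes [measurable]: "g \<in> borel_measurable borel" and z: "0 < snd z"
  shows "g z \<le> half_median (area top g) z"
proof (rule ccontr)
  assume "\<not> ?thesis"
  then have lt: "half_median (area top g) z < g z" by simp
  let ?B = "ball (fst z) (snd z)"
  have "half_median (area top g) z < area top g x" if "x \<in> ?B" for x
    using that by (intro less_le_trans[OF lt]) (auto simp: area_def mem_cone_iff intro!: SUP_upper)
  then have eq: "{x. half_median (area top g) z < area top g x} \<inter> ?B = ?B" by auto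
  have "2 * emeasure lborel ({x. half_median (area top g) z < area top g x} \<inter> ?B) \<le> emeasure lborel ?B"
    by (subst half_median_le_iff[symmetric]) auto
  then have "emeasure lborel ?B + emeasure lborel ?B \<le> emeasure lborel ?B + 0"
    unfolding eq by (simp add: mult_2)
  then have "emeasure lborel ?B \<le> 0"
    using emeasure_ball_finite[of "fst z" "snd z"]
    by (subst (asm) ennreal_add_left_cancel_le) (auto simp del: emeasure_ball_finite)
  with emeasure_ball_pos[OF z, of "fst z"] show False by simp
qed

text \<open>The Carleson estimate: at least half of each ball \<open>B(y,t)\<close> consists of points \<open>x\<close> where the area
  function is below the median over the ball, and for a fixed such \<open>x\<close> dividing by the median costs no
  more than dividing by the area function at \<open>x\<close>.\<close>

lemma tent_norm_quot_half_median_le: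
  fixes u :: "(real^'n) \<times> real \<Rightarrow> ennreal"
  assumes u [measurable]: "u \<in> borel_measurable borel" and r: "0 < r" and q: "0 < q" "q \<noteq> top"
    and fin: "AE x in lborel. area q (\<W> r u) x < top"
  shows "tent_norm top q (\<W> r (quot (half_median (area q (\<W> r u))) u)) \<le>
    epow (ennreal (2 / unit_ball_vol CARD('n))) (1 / enn2real q)"
proof -
  define A where "A = area q (\<W> r u)"
  define k where "k = half_median A"
  define h where "h = \<W> r (quot k u)"
  define q' where "q' = enn2real q"
  have q': "0 < q'" using enn2real_pos[OF q] by (simp add: q'_def)
  have [measurable]: "A \<in> borel_measurable borel" unfolding A_def by measurable
  have [measurable]: "k \<in> borel_measurable borel" unfolding k_def by measurable
  have [measurable]: "h \<in> borel_measurable borel" unfolding h_def by measurable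
  define E where "E z = {x \<in> ball (fst z) (snd z). A x \<le> k z}" for z
  have [measurable]: "(\<lambda>w. indicator (E (f w)) (g w) :: ennreal) \<in> borel_measurable N"
    if [measurable]: "f \<in> borel_measurable N" "g \<in> borel_measurable N" for f g and N :: "'b measure"
    unfolding E_def k_def by measurable
  have pointwise: "(\<integral>\<^sup>+z. indicator (E z) x * area_density q' h z \<partial>lborel) \<le> 1" if A_fin: "A x < top" for x
  proof (cases "A x = 0")
    \<comment> \<open>The main case cancels a power of \<open>A x\<close>, which must be nonzero. If
      \<open>A x\<close> = 0, all averages over the cone at x vanish, and with them the
      integrand.\<close>
    case True
    then have "cone_area 1 (area_density q' (\<W> r u)) x = 0"
      using q by (simp add: A_def area_def q'_def)
    then have "\<W> r u z = 0" if "z \<in> cone x" for z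
      using cone_area_zero_imp[OF u r] that by blast
    then have "h z = 0" if "z \<in> cone x" for z
      using wavg_quot_eq_0[OF u r] that cone_imp_pos[OF that] by (simp add: h_def)
    then have "indicator (E z) x * area_density q' h z = 0" for z
      by (auto simp: indicator_def E_def area_density_def mem_cone_iff)
    then show ?thesis by (simp only: nn_integral_const mult_zero_left zero_le)
  next
    case False
    let ?a = "epow (A x) q'"
    have a: "?a = cone_area 1 (area_density q' (\<W> r u)) x"
      using q q' by (simp add: A_def area_def q'_def)
    have "?a * (\<integral>\<^sup>+z. indicator (E z) x * area_density q' h z \<partial>lborel) =
        (\<integral>\<^sup>+z. ?a * (indicator (E z) x * area_density q' h z) \<partial>lborel)"
      by (intro nn_integral_cmult[symmetric]) measurable
    also have "\<dots> \<le> cone_area 1 (area_density q' (\<W> r u)) x"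
      unfolding cone_area_def
    proof (intro nn_integral_mono)
      fix z
      show "?a * (indicator (E z) x * area_density q' h z) \<le> indicator (wide_cone 1 x) z * area_density q' (\<W> r u) z"
      proof (cases "x \<in> E z")
        case True
        then have z: "z \<in> cone x" and le: "A x \<le> k z" by (auto simp: E_def mem_cone_iff)
        have "A x * h z \<le> \<W> r u z"
          using mult_right_mono[OF le, of "h z"] mult_wavg_quot_le[OF u r, of k z] by (simp add: h_def)
        then have "epow (A x * h z) q' * ennreal (1 / snd z ^ (CARD('n) + 1)) \<le> area_density q' (\<W> r u) z"
          unfolding area_density_def using q' by (intro mult_right_mono epow_mono) auto
        then show ?thesis
          using True z by (simp add: area_density_def epow_mult wide_cone_1 mult.assoc)
      qed simp
    qed
    also have "\<dots> = ?a * 1" by (simp add: a)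
    finally show ?thesis
      using False A_fin by (subst (asm) ennreal_mult_le_mult_iff) (auto simp: less_top)
  qed
  define \<omega> where "\<omega> = unit_ball_vol CARD('n)"
  have \<omega>: "0 < \<omega>" by (simp add: \<omega>_def unit_ball_vol_pos)
  have "(\<integral>\<^sup>+z. indicator (tent (ball c \<rho>)) z * (epow (h z) q' * ennreal (1 / snd z)) \<partial>lborel)
      \<le> ennreal (2 / \<omega>) * emeasure lborel (ball c \<rho>)" if \<rho>: "0 < \<rho>" for c and \<rho>
  proof -
    let ?T = "tent (ball c \<rho>)"
    have "(\<integral>\<^sup>+z. indicator ?T z * (epow (h z) q' * ennreal (1 / snd z)) \<partial>lborel) \<le>
        (\<integral>\<^sup>+z. ennreal (2 / \<omega>) * (\<integral>\<^sup>+x. indicator ?T z * (indicator (E z) x * area_density q' h z) \<partial>lborel) \<partial>lborel)"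
    proof (intro nn_integral_mono)
      fix z
      show "indicator ?T z * (epow (h z) q' * ennreal (1 / snd z)) \<le>
        ennreal (2 / \<omega>) * (\<integral>\<^sup>+x. indicator ?T z * (indicator (E z) x * area_density q' h z) \<partial>lborel)"
      proof (cases "z \<in> ?T")
        case True
        then have t: "0 < snd z" by (auto simp: tent_def)
        have [measurable]: "E z \<in> sets borel"
          unfolding E_def by measurable
        \<comment> \<open>The Carleson weight 1/t is the area weight t^-(n+1) times the ball volume
          \<omega> * t^n, divided by \<omega>. Shrinking the ball to \<open>E z\<close> costs 2,
          whence 2/\<omega>.\<close>
        have "ennreal (1 / snd z) = ennreal (1 / \<omega>) * (ennreal (1 / snd z ^ (CARD('n) + 1)) * ennreal (\<omega> * snd z ^ CARD('n)))"
          using t \<omega> by (simp flip: ennreal_mult)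
        also have "ennreal (\<omega> * snd z ^ CARD('n)) = emeasure lborel (ball (fst z) (snd z))"
          using t by (simp add: emeasure_ball \<omega>_def)
        also have "ennreal (1 / \<omega>) * (ennreal (1 / snd z ^ (CARD('n) + 1)) * emeasure lborel (ball (fst z) (snd z))) \<le>
            ennreal (1 / \<omega>) * (ennreal (1 / snd z ^ (CARD('n) + 1)) * (2 * emeasure lborel (E z)))"
          unfolding E_def k_def by (intro mult_left_mono emeasure_ball_le_below_half_median) auto
        also have "\<dots> = ennreal (2 * (1 / \<omega>)) * (ennreal (1 / snd z ^ (CARD('n) + 1)) * emeasure lborel (E z))"
          by (subst ennreal_mult') (auto simp: mult_ac)
        finally have "epow (h z) q' * ennreal (1 / snd z) \<le>
            epow (h z) q' * (ennreal (2 / \<omega>) * (ennreal (1 / snd z ^ (CARD('n) + 1)) * emeasure lborel (E z)))"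
          by (intro mult_left_mono) auto
        also have "\<dots> = ennreal (2 / \<omega>) * (area_density q' h z * emeasure lborel (E z))"
          by (simp add: area_density_def mult_ac)
        also have "area_density q' h z * emeasure lborel (E z) = (\<integral>\<^sup>+x. indicator (E z) x * area_density q' h z \<partial>lborel)"
          by (subst nn_integral_multc) (auto simp: mult.commute)
        finally show ?thesis using True by simp
      qed simp
    qed
    also have "\<dots> = ennreal (2 / \<omega>) * (\<integral>\<^sup>+z. \<integral>\<^sup>+x. indicator ?T z * (indicator (E z) x * area_density q' h z) \<partial>lborel \<partial>lborel)"
      by (intro nn_integral_cmult) measurable
    also have "(\<integral>\<^sup>+z. \<integral>\<^sup>+x. indicator ?T z * (indicator (E z) x * area_density q' h z) \<partial>lborel \<partial>lborel) =
        (\<integral>\<^sup>+x. \<integral>\<^sup>+z. indicator ?T z * (indicator (E z) x * area_density q' h z) \<partial>lborel \<partial>lborel)"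
      by (rule lborel_swap) measurable
    also have "\<dots> \<le> (\<integral>\<^sup>+x. indicator (ball c \<rho>) x \<partial>lborel)"
    proof (rule nn_integral_mono_AE)
      show "AE x in lborel. (\<integral>\<^sup>+z. indicator ?T z * (indicator (E z) x * area_density q' h z) \<partial>lborel) \<le> indicator (ball c \<rho>) x"
        using fin unfolding A_def[symmetric]
      proof eventually_elim
        case (elim x)
        show ?case
        proof (cases "x \<in> ball c \<rho>")
          case True
          have "(\<integral>\<^sup>+z. indicator ?T z * (indicator (E z) x * area_density q' h z) \<partial>lborel) \<le>
              (\<integral>\<^sup>+z. indicator (E z) x * area_density q' h z \<partial>lborel)"
            by (intro nn_integral_mono) (auto simp: indicator_def)
          also have "\<dots> \<le> 1" by (rule pointwise[OF elim])
          finally show ?thesis using True by simp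
        next
          \<comment> \<open>For z in the tent the ball of z, and so \<open>E z\<close>, lies inside
            \<open>ball c \<rho>\<close> and misses x.\<close>
          case False
          then have "indicator ?T z * (indicator (E z) x * area_density q' h z) = 0" for z
            by (auto simp: indicator_def tent_def E_def)
          then show ?thesis by (simp only: nn_integral_const mult_zero_left zero_le)
        qed
      qed
    qed
    also have "\<dots> = emeasure lborel (ball c \<rho>)" by simp
    finally show ?thesis by (simp add: mult_left_mono)
  qed
  then have "tent_norm top q h \<le> epow (ennreal (2 / \<omega>)) (1 / q')"
    using q' tent_norm_top_le_iff[OF q, of h "epow (ennreal (2 / \<omega>)) (1 / q')"] by (simp add: q'_def)
  then show ?thesis by (simp add: h_def k_def A_def q'_def \<omega>_def)
qed

text \<open>Replacing the average by \<open>H\<close> enlarges the domain of integration. For p <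
  top the enlarged cone is removed by the change of aperture; for p = top the enlarged tent sits
  over a concentric ball, and the cost is the ratio of volumes.\<close>

lemma tent_norm_H_wavg_le:
  assumes p: "0 < p" and q: "0 < q" "q \<noteq> top" and r: "0 < r"
  shows "\<exists>C. C < top \<and> (\<forall>u :: (real^'n) \<times> real \<Rightarrow> ennreal. u \<in> borel_measurable borel \<longrightarrow>
    tent_norm p q (H (\<W> r u)) \<le> C * tent_norm p q (\<W> r u))"
proof -
  have q': "0 < enn2real q" using enn2real_pos[OF q] .
  define b where "b = 4 * a2 ^ 3"
  have b: "1 < b" using one_less_power[OF a2_gt_1, of 3] by (simp add: b_def)
  have wide: "dist (fst \<zeta>) (fst z) < b * snd z" "snd z < b * snd \<zeta>" "snd \<zeta> < b * snd z" if "\<zeta> \<in> wide z"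
    for \<zeta> z :: "(real^'n) \<times> real"
    using that b by (auto simp: wide_def b_def[symmetric] mem_whitney_iff divide_less_eq mult.commute)
  show ?thesis
  proof (cases "p = top")
    case False
    have p': "0 < enn2real p" using enn2real_pos[OF p False] .
    obtain C1 :: real where C1: "0 \<le> C1" "\<And>(u :: (real^'n) \<times> real \<Rightarrow> ennreal) P P'. u \<in> borel_measurable borel \<Longrightarrow>
      P \<in> sets borel \<Longrightarrow> P' \<in> sets borel \<Longrightarrow> (\<forall>z\<in>P. 0 < snd z) \<Longrightarrow> (\<forall>z\<in>P. wide z \<subseteq> P') \<Longrightarrow>
      (\<integral>\<^sup>+z. indicator P z * (epow (H (\<W> r u) z) (enn2real q) * ennreal (1 / snd z ^ (CARD('n) + 1))) \<partial>lborel) \<le>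
      ennreal C1 * (\<integral>\<^sup>+z. indicator P' z * (epow (\<W> r u z) (enn2real q) * ennreal (1 / snd z ^ (CARD('n) + 1))) \<partial>lborel)"
      using nn_integral_H_epow_weighted_le[OF r q', where 'n='n and m="CARD('n) + 1"] by blast
    define s where "s = enn2real p / enn2real q"
    have s: "0 < s" using p' q' by (simp add: s_def)
    \<comment> \<open>The aperture: a point of \<open>wide z\<close> with z at height t in the cone
      is within (b + 1) * t of the vertex, and t is below b times its own height.\<close>
    have "1 \<le> (b + 1) * b" using b mult_mono[of 1 "b + 1" 1 b] by simp
    then obtain K :: real where K: "\<And>G :: (real^'n) \<times> real \<Rightarrow> ennreal. G \<in> borel_measurable borel \<Longrightarrow>
      (\<integral>\<^sup>+x. epow (cone_area ((b + 1) * b) G x) s \<partial>lborel) \<le> ennreal K * (\<integral>\<^sup>+x. epow (cone_area 1 G x) s \<partial>lborel)"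
      using nn_integral_wide_cone_area_le[OF _ s, where 'n='n] by blast
    define C where "C = epow (ennreal (C1 powr s) * ennreal K) (1 / enn2real p)"
    have "tent_norm p q (H (\<W> r u)) \<le> C * tent_norm p q (\<W> r u)"
      if [measurable]: "u \<in> borel_measurable borel" for u :: "(real^'n) \<times> real \<Rightarrow> ennreal"
      unfolding C_def
    proof (rule tent_norm_le_of_area[OF p False q(1) q(1)])
      let ?G = "area_density (enn2real q) (\<W> r u)"
      have area_eq: "epow (area q h x) (enn2real p) = epow (cone_area 1 (area_density (enn2real q) h) x) s"
        for h :: "(real^'n) \<times> real \<Rightarrow> ennreal" and x
        using q by (simp add: area_def epow_epow s_def)
      have "cone_area 1 (area_density (enn2real q) (H (\<W> r u))) x \<le> ennreal C1 * cone_area ((b + 1) * b) ?G x" for x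
        unfolding cone_area_def area_density_def
      proof (rule C1(2))
        show "wide_cone 1 x \<in> sets borel" "wide_cone ((b + 1) * b) x \<in> sets borel"
          unfolding wide_cone_def by (intro borel_open open_Collect_less continuous_intros)+
        show "\<forall>z\<in>wide_cone 1 x. 0 < snd z"
          using cone_imp_pos by (auto simp: wide_cone_1)
        show "\<forall>z\<in>wide_cone 1 x. wide z \<subseteq> wide_cone ((b + 1) * b) x"
        proof (intro ballI subsetI)
          fix z \<zeta> assume z: "z \<in> wide_cone 1 x" and \<zeta>: "\<zeta> \<in> wide z"
          have "dist (fst \<zeta>) x \<le> dist (fst \<zeta>) (fst z) + dist (fst z) x" by (rule dist_triangle)
          also have "\<dots> < (b + 1) * snd z"
            using wide(1)[OF \<zeta>] z by (simp add: wide_cone_def algebra_simps)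
          also have "\<dots> \<le> (b + 1) * (b * snd \<zeta>)"
            using wide(2)[OF \<zeta>] b by (intro mult_left_mono) auto
          finally show "\<zeta> \<in> wide_cone ((b + 1) * b) x" by (simp add: wide_cone_def mult.assoc)
        qed
      qed measurable
      then have "(\<integral>\<^sup>+x. epow (area q (H (\<W> r u)) x) (enn2real p) \<partial>lborel) \<le>
          (\<integral>\<^sup>+x. epow (ennreal C1 * cone_area ((b + 1) * b) ?G x) s \<partial>lborel)"
        unfolding area_eq using s by (intro nn_integral_mono epow_mono) auto
      also have "\<dots> = ennreal (C1 powr s) * (\<integral>\<^sup>+x. epow (cone_area ((b + 1) * b) ?G x) s \<partial>lborel)"
        using C1(1) by (subst nn_integral_cmult[symmetric]) (auto simp: epow_mult epow_ennreal)
      also have "\<dots> \<le> ennreal (C1 powr s) * (ennreal K * (\<integral>\<^sup>+x. epow (cone_area 1 ?G x) s \<partial>lborel))"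
        by (intro mult_left_mono K) auto
      finally show "(\<integral>\<^sup>+x. epow (area q (H (\<W> r u)) x) (enn2real p) \<partial>lborel) \<le>
          ennreal (C1 powr s) * ennreal K * (\<integral>\<^sup>+x. epow (area q (\<W> r u) x) (enn2real p) \<partial>lborel)"
        unfolding area_eq by (simp add: mult.assoc)
    qed
    moreover have "C < top" by (simp add: C_def ennreal_mult_less_top)
    ultimately show ?thesis by blast
  next
    case True
    obtain C1 :: real where C1: "0 \<le> C1" "\<And>(u :: (real^'n) \<times> real \<Rightarrow> ennreal) P P'. u \<in> borel_measurable borel \<Longrightarrow>
      P \<in> sets borel \<Longrightarrow> P' \<in> sets borel \<Longrightarrow> (\<forall>z\<in>P. 0 < snd z) \<Longrightarrow> (\<forall>z\<in>P. wide z \<subseteq> P') \<Longrightarrow>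
      (\<integral>\<^sup>+z. indicator P z * (epow (H (\<W> r u) z) (enn2real q) * ennreal (1 / snd z ^ 1)) \<partial>lborel) \<le>
      ennreal C1 * (\<integral>\<^sup>+z. indicator P' z * (epow (\<W> r u z) (enn2real q) * ennreal (1 / snd z ^ 1)) \<partial>lborel)"
      using nn_integral_H_epow_weighted_le[OF r q', where 'n='n and m=1] by blast
    \<comment> \<open>For z at height t <= \<rho> in the tent, passing to a point of
      \<open>wide z\<close> adds at most b * t to the horizontal distance, and the new height is at
      most b * t; together at most \<rho> + 2 * b * \<rho>.\<close>
    define \<kappa> where "\<kappa> = 1 + 2 * b"
    have \<kappa>: "0 < \<kappa>" using b by (simp add: \<kappa>_def)
    define C where "C = epow (ennreal (C1 * \<kappa> ^ CARD('n))) (1 / enn2real q)"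
    have "tent_norm top q (H (\<W> r u)) \<le> C * tent_norm top q (\<W> r u)"
      if [measurable]: "u \<in> borel_measurable borel" for u :: "(real^'n) \<times> real \<Rightarrow> ennreal"
      unfolding tent_norm_top_le_iff[OF q]
    proof (intro allI impI)
      fix c :: "real^'n" and \<rho> :: real assume \<rho>: "0 < \<rho>"
      let ?N = "tent_norm top q (\<W> r u)"
      have "(\<integral>\<^sup>+z. indicator (tent (ball c \<rho>)) z * (epow (H (\<W> r u) z) (enn2real q) * ennreal (1 / snd z)) \<partial>lborel)
          \<le> ennreal C1 * (\<integral>\<^sup>+z. indicator (tent (ball c (\<kappa> * \<rho>))) z * (epow (\<W> r u z) (enn2real q) * ennreal (1 / snd z)) \<partial>lborel)"
      proof (rule C1(2)[unfolded power_one_right])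
        show "\<forall>z\<in>tent (ball c \<rho>). 0 < snd z" by (auto simp: tent_def)
        show "\<forall>z\<in>tent (ball c \<rho>). wide z \<subseteq> tent (ball c (\<kappa> * \<rho>))"
        proof (intro ballI subsetI)
          fix z \<zeta> assume z: "z \<in> tent (ball c \<rho>)" and \<zeta>: "\<zeta> \<in> wide z"
          have z': "0 < snd z" "dist (fst z) c + snd z \<le> \<rho>" using z by (auto simp: tent_ball_eq)
          have "0 < b * snd \<zeta>" using wide(2)[OF \<zeta>] z'(1) by simp
          then have "0 < snd \<zeta>" using b by (simp add: zero_less_mult_iff)
          moreover have "snd z \<le> \<rho>" using z'(2) zero_le_dist[of "fst z" c] by linarith
          then have "b * snd z \<le> b * \<rho>" using b by (intro mult_left_mono) auto
          then have "dist (fst \<zeta>) c + snd \<zeta> \<le> \<kappa> * \<rho>"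
            using wide(1,3)[OF \<zeta>] z' dist_triangle[of "fst \<zeta>" c "fst z"] unfolding \<kappa>_def
            by (simp add: algebra_simps)
          ultimately show "\<zeta> \<in> tent (ball c (\<kappa> * \<rho>))" by (simp add: tent_ball_eq)
        qed
      qed measurable
      also have "\<dots> \<le> ennreal C1 * (epow ?N (enn2real q) * emeasure lborel (ball c (\<kappa> * \<rho>)))"
        using tent_norm_top_le_iff[OF q, of "\<W> r u" ?N] \<rho> \<kappa> by (intro mult_left_mono) auto
      also have "emeasure lborel (ball c (\<kappa> * \<rho>)) = ennreal (\<kappa> ^ CARD('n)) * emeasure lborel (ball c \<rho>)"
        using \<kappa> \<rho> by (intro emeasure_ball_scale) auto
      also have "ennreal C1 * (epow ?N (enn2real q) * \<dots>) = ennreal (C1 * \<kappa> ^ CARD('n)) * epow ?N (enn2real q) * emeasure lborel (ball c \<rho>)"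
        using C1(1) by (subst ennreal_mult') (auto simp: mult_ac)
      also have "ennreal (C1 * \<kappa> ^ CARD('n)) * epow ?N (enn2real q) = epow (C * ?N) (enn2real q)"
        using q' by (simp add: C_def epow_mult)
      finally show "(\<integral>\<^sup>+z. indicator (tent (ball c \<rho>)) z * (epow (H (\<W> r u) z) (enn2real q) * ennreal (1 / snd z)) \<partial>lborel)
          \<le> epow (C * ?N) (enn2real q) * emeasure lborel (ball c \<rho>)" .
    qed
    moreover have "C < top" by (simp add: C_def)
    ultimately show ?thesis using True by blast
  qed
qed

end

section \<open>The factorizations\<close>

lemma factorizes3I:
  assumes "factorizes2 N0 N1 N3 D" "factorizes2 N1 M1 M2 D"
  shows "factorizes3 N0 M1 M2 N3 D"
proof -
  obtain C1 :: real where C1: "\<And>f0. f0 \<in> borel_measurable lebesgue \<Longrightarrow> N0 f0 < top \<Longrightarrow>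
     \<exists>f1 f2. f1 \<in> borel_measurable lebesgue \<and> f2 \<in> borel_measurable lebesgue \<and>
        N1 f1 < top \<and> N3 f2 < top \<and>
        (AE z in lebesgue. D z \<longrightarrow> cmod (f0 z) = cmod (f1 z) * cmod (f2 z)) \<and>
        N1 f1 * N3 f2 \<le> ennreal C1 * N0 f0"
    using assms(1) unfolding factorizes2_def by blast
  obtain C2 :: real where C2: "\<And>f0. f0 \<in> borel_measurable lebesgue \<Longrightarrow> N1 f0 < top \<Longrightarrow>
     \<exists>f1 f2. f1 \<in> borel_measurable lebesgue \<and> f2 \<in> borel_measurable lebesgue \<and>
        M1 f1 < top \<and> M2 f2 < top \<and>
        (AE z in lebesgue. D z \<longrightarrow> cmod (f0 z) = cmod (f1 z) * cmod (f2 z)) \<and>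
        M1 f1 * M2 f2 \<le> ennreal C2 * N1 f0"
    using assms(2) unfolding factorizes2_def by blast
  show ?thesis
    unfolding factorizes3_def
  \<comment> \<open>The constants are arbitrary reals and \<open>ennreal\<close> sends negative ones
    to 0; multiplying after the conversion keeps the product correct whatever the signs.\<close>
  proof (intro exI[of _ "enn2real (ennreal C2 * ennreal C1)"] allI impI, elim conjE)
    fix f0 assume f0: "f0 \<in> borel_measurable lebesgue" "N0 f0 < top"
    obtain f f3 where f: "f \<in> borel_measurable lebesgue" "f3 \<in> borel_measurable lebesgue" "N1 f < top" "N3 f3 < top"
        "AE z in lebesgue. D z \<longrightarrow> cmod (f0 z) = cmod (f z) * cmod (f3 z)" "N1 f * N3 f3 \<le> ennreal C1 * N0 f0"
      using C1[OF f0] by blast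
    obtain f1 f2 where g: "f1 \<in> borel_measurable lebesgue" "f2 \<in> borel_measurable lebesgue" "M1 f1 < top" "M2 f2 < top"
        "AE z in lebesgue. D z \<longrightarrow> cmod (f z) = cmod (f1 z) * cmod (f2 z)" "M1 f1 * M2 f2 \<le> ennreal C2 * N1 f"
      using C2[OF f(1,3)] by blast
    have "AE z in lebesgue. D z \<longrightarrow> cmod (f0 z) = cmod (f1 z) * cmod (f2 z) * cmod (f3 z)"
      using f(5) g(5) by eventually_elim simp
    moreover have "M1 f1 * M2 f2 * N3 f3 \<le> ennreal (enn2real (ennreal C2 * ennreal C1)) * N0 f0"
    proof -
      have "M1 f1 * M2 f2 * N3 f3 \<le> ennreal C2 * N1 f * N3 f3"
        by (intro mult_right_mono g(6)) simp
      also have "\<dots> \<le> ennreal C2 * (ennreal C1 * N0 f0)"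
        using f(6) by (simp add: mult.assoc mult_left_mono)
      finally show ?thesis
        by (simp add: ennreal_enn2real ennreal_mult_less_top mult.assoc)
    qed
    ultimately show "\<exists>f1 f2 f3. f1 \<in> borel_measurable lebesgue \<and> f2 \<in> borel_measurable lebesgue \<and>
        f3 \<in> borel_measurable lebesgue \<and> M1 f1 < top \<and> M2 f2 < top \<and> N3 f3 < top \<and>
        (AE z in lebesgue. D z \<longrightarrow> cmod (f0 z) = cmod (f1 z) * cmod (f2 z) * cmod (f3 z)) \<and>
        M1 f1 * M2 f2 * N3 f3 \<le> ennreal (enn2real (ennreal C2 * ennreal C1)) * N0 f0"
      using f(2,4) g(1-4) by (intro exI[of _ f1] exI[of _ f2] exI[of _ f3]) simp
  qed
qed

section \<open>Assembly from a choice of k\<close>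

context whitney_params begin

lemma Tnorm_eq_tent_norm_wavg:
  assumes "AE z in lborel. 0 < snd z \<longrightarrow> ennreal (cmod (f z)) = u z"
  shows "Tnorm a1 a2 p q r f = tent_norm p q (\<W> r u)"
proof -
  have "whitney_avg a1 a2 r f = \<W> r u"
    unfolding whitney_avg_eq_wavg using wavg_cong_AE[OF assms] by blast
  then show ?thesis by (simp add: Tnorm_def)
qed

text \<open>Reduces a factorization to the choice of k for a Borel representative u of |f0|. Both
  factors are finite a.e. and so become nonnegative complex functions. The first bound scales with
  the norm of f0, the second is absolute; their product gives C * C.\<close>

lemma factorizes2_by_quot:
  fixes p0 q0 r0 p1 q1 p2 q2 :: ennreal
  assumes r0: "0 < r0" and q1: "0 < q1" and C: "C < top"
    and ex: "\<And>u :: (real^'n) \<times> real \<Rightarrow> ennreal. u \<in> borel_measurable borel \<Longrightarrow> tent_norm p0 q0 (\<W> r0 u) < top \<Longrightarrow>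
      \<exists>k. (\<forall>z. 0 < snd z \<longrightarrow> 0 < \<W> r0 u z \<longrightarrow> 0 < k z) \<and>
        (AE z in lborel. 0 < snd z \<longrightarrow> S k z < top) \<and>
        tent_norm p1 q1 (H k) \<le> C * tent_norm p0 q0 (\<W> r0 u) \<and>
        tent_norm p2 q2 (\<W> r0 (quot k u)) \<le> C"
  shows "factorizes2 (Tnorm a1 a2 p0 q0 r0 :: ((real^'n) \<times> real \<Rightarrow> complex) \<Rightarrow> ennreal)
    (Tnorm a1 a2 p1 q1 top) (Tnorm a1 a2 p2 q2 r0) (\<lambda>z. 0 < snd z)"
  unfolding factorizes2_def
proof (intro exI[of _ "enn2real (C * C)"] allI impI, elim conjE)
  fix f0 :: "(real^'n) \<times> real \<Rightarrow> complex"
  assume f0 [measurable]: "f0 \<in> borel_measurable lebesgue" and fin0: "Tnorm a1 a2 p0 q0 r0 f0 < top"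
  have "(\<lambda>z. ennreal (cmod (f0 z))) \<in> borel_measurable lebesgue" by measurable
  then obtain u where u [measurable]: "u \<in> borel_measurable borel" and fu: "AE z in lborel. ennreal (cmod (f0 z)) = u z"
    using completion_ex_borel_measurable by fastforce
  have N0: "Tnorm a1 a2 p0 q0 r0 f0 = tent_norm p0 q0 (\<W> r0 u)"
    using fu by (intro Tnorm_eq_tent_norm_wavg) (auto elim!: eventually_mono)
  obtain k where pos: "\<And>z. 0 < snd z \<Longrightarrow> 0 < \<W> r0 u z \<Longrightarrow> 0 < k z"
    and fin: "AE z in lborel. 0 < snd z \<longrightarrow> S k z < top"
    and N1: "tent_norm p1 q1 (H k) \<le> C * tent_norm p0 q0 (\<W> r0 u)"
    and N2: "tent_norm p2 q2 (\<W> r0 (quot k u)) \<le> C"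
    using ex[OF u] fin0 unfolding N0 by blast
  define f1 where "f1 z = complex_of_real (enn2real (S k z))" for z
  define f2 where "f2 z = complex_of_real (enn2real (quot k u z))" for z
  have "f1 \<in> borel_measurable borel" "f2 \<in> borel_measurable borel"
    unfolding f1_def[abs_def] f2_def[abs_def] by measurable
  then have meas: "f1 \<in> borel_measurable lebesgue" "f2 \<in> borel_measurable lebesgue"
    by (auto intro: measurable_completion)
  have AE1: "AE z in lborel. 0 < snd z \<longrightarrow> ennreal (cmod (f1 z)) = S k z"
    using fin by eventually_elim (simp add: f1_def)
  have AE2: "AE z in lborel. 0 < snd z \<longrightarrow> ennreal (cmod (f2 z)) = quot k u z"
    using fu
  proof eventually_elim
    case (elim z)
    then have "u z < top" by (metis ennreal_less_top)
    then have "quot k u z < top"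
      by (auto simp: quot_def less_top[symmetric] ennreal_divide_eq_top_iff)
    then show ?case by (simp add: f2_def)
  qed
  have "AE z in lborel. 0 < snd z \<longrightarrow> u z = S k z * quot k u z"
    using pos fin by (rule AE_eq_S_mult_quot[OF u r0])
  with AE1 AE2 fu have "AE z in lborel. 0 < snd z \<longrightarrow> cmod (f0 z) = cmod (f1 z) * cmod (f2 z)"
  proof eventually_elim
    case (elim z)
    show ?case
    proof
      assume "0 < snd z"
      with elim have "ennreal (cmod (f0 z)) = ennreal (cmod (f1 z)) * ennreal (cmod (f2 z))" by simp
      then show "cmod (f0 z) = cmod (f1 z) * cmod (f2 z)"
        by (simp flip: ennreal_mult)
    qed
  qed
  then have prod: "AE z in lebesgue. 0 < snd z \<longrightarrow> cmod (f0 z) = cmod (f1 z) * cmod (f2 z)"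
    by (simp add: AE_lebesgue_iff)
  have "Tnorm a1 a2 p1 q1 top f1 = tent_norm p1 q1 (\<W> top (S k))"
    by (rule Tnorm_eq_tent_norm_wavg[OF AE1])
  also have "\<dots> \<le> tent_norm p1 q1 (H k)"
    by (intro tent_norm_mono q1 wavg_top_S_le_H)
  finally have T1: "Tnorm a1 a2 p1 q1 top f1 \<le> C * Tnorm a1 a2 p0 q0 r0 f0"
    using N1 by (simp add: N0)
  have T2: "Tnorm a1 a2 p2 q2 r0 f2 \<le> C"
    using N2 Tnorm_eq_tent_norm_wavg[OF AE2] by simp
  have "Tnorm a1 a2 p1 q1 top f1 < top"
    by (rule le_less_trans[OF T1]) (simp add: ennreal_mult_less_top C fin0)
  moreover have "Tnorm a1 a2 p2 q2 r0 f2 < top"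
    by (rule le_less_trans[OF T2 C])
  moreover have "Tnorm a1 a2 p1 q1 top f1 * Tnorm a1 a2 p2 q2 r0 f2 \<le> ennreal (enn2real (C * C)) * Tnorm a1 a2 p0 q0 r0 f0"
  proof -
    have "Tnorm a1 a2 p1 q1 top f1 * Tnorm a1 a2 p2 q2 r0 f2 \<le> C * Tnorm a1 a2 p0 q0 r0 f0 * C"
      using T1 T2 by (intro mult_mono) auto
    also have "\<dots> = ennreal (enn2real (C * C)) * Tnorm a1 a2 p0 q0 r0 f0"
      using C by (simp add: ennreal_mult_less_top mult_ac)
    finally show ?thesis .
  qed
  ultimately show "\<exists>f1 f2. f1 \<in> borel_measurable lebesgue \<and> f2 \<in> borel_measurable lebesgue \<and>
      Tnorm a1 a2 p1 q1 top f1 < top \<and> Tnorm a1 a2 p2 q2 r0 f2 < top \<and>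
      (AE z in lebesgue. 0 < snd z \<longrightarrow> cmod (f0 z) = cmod (f1 z) * cmod (f2 z)) \<and>
      Tnorm a1 a2 p1 q1 top f1 * Tnorm a1 a2 p2 q2 r0 f2 \<le> ennreal (enn2real (C * C)) * Tnorm a1 a2 p0 q0 r0 f0"
    using meas prod by blast
qed

text \<open>Writes f as 1 * f. Serves the second factorization at p0 = top, where the second target
  space is the original one.\<close>

lemma factorizes2_bounded_trivial:
  "factorizes2 (Tnorm a1 a2 p q r :: ((real^'n) \<times> real \<Rightarrow> complex) \<Rightarrow> ennreal)
    (Tnorm a1 a2 top top top) (Tnorm a1 a2 p q r) (\<lambda>z. 0 < snd z)"
  unfolding factorizes2_def
proof (intro exI[of _ 1] allI impI, elim conjE)
  fix f0 :: "(real^'n) \<times> real \<Rightarrow> complex"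
  assume f0: "f0 \<in> borel_measurable lebesgue" "Tnorm a1 a2 p q r f0 < top"
  have one: "Tnorm a1 a2 top top top (\<lambda>_ :: (real^'n) \<times> real. 1) \<le> 1"
    by (auto simp: Tnorm_def tent_norm_def whitney_avg_def ess_sup_on_le_iff intro!: AE_I2)
  show "\<exists>f1 f2. f1 \<in> borel_measurable lebesgue \<and> f2 \<in> borel_measurable lebesgue \<and>
      Tnorm a1 a2 top top top f1 < top \<and> Tnorm a1 a2 p q r f2 < top \<and>
      (AE z in lebesgue. 0 < snd z \<longrightarrow> cmod (f0 z) = cmod (f1 z) * cmod (f2 z)) \<and>
      Tnorm a1 a2 top top top f1 * Tnorm a1 a2 p q r f2 \<le> ennreal 1 * Tnorm a1 a2 p q r f0"
    using f0 mult_right_mono[OF one, of "Tnorm a1 a2 p q r f0"] le_less_trans[OF one]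
    by (intro exI[of _ "\<lambda>_. 1"] exI[of _ f0]) simp
qed

lemma factorization_F2:
  assumes "0 < p0" "0 < q0" "0 < r0"
  shows "factorizes2 (Tnorm a1 a2 p0 q0 r0 :: ((real^'n) \<times> real \<Rightarrow> complex) \<Rightarrow> ennreal)
    (Tnorm a1 a2 p0 top top) (Tnorm a1 a2 top q0 r0) (\<lambda>z. 0 < snd z)"
proof (cases "p0 = top")
  case True
  then show ?thesis using factorizes2_bounded_trivial by simp
next
  case False
  have p': "0 < enn2real p0" using enn2real_pos[OF assms(1) False] .
  define C1 where "C1 = epow (2 * ennreal (2 * (5 * (2 * (a2 * a2) + 1)) ^ CARD('n))) (1 / enn2real p0)"
  define C2 where "C2 = epow (ennreal (2 / unit_ball_vol CARD('n))) (1 / enn2real q0)"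
  \<comment> \<open>The summand 1 serves q0 = top, where the second factor is measured by a supremum
    and bounded by 1 instead of by a Carleson estimate.\<close>
  define C where "C = C1 + C2 + 1"
  have C: "C1 \<le> C" "C2 \<le> C" "1 \<le> C"
    by (simp_all add: C_def add_increasing add_increasing2)
  show ?thesis
  proof (rule factorizes2_by_quot[OF assms(3), of top C])
    show "C < top" by (simp add: C_def C1_def C2_def ennreal_mult_less_top)
    fix u :: "(real^'n) \<times> real \<Rightarrow> ennreal"
    assume u [measurable]: "u \<in> borel_measurable borel" and N0: "tent_norm p0 q0 (\<W> r0 u) < top"
    define A where "A = area q0 (\<W> r0 u)"
    have [measurable]: "A \<in> borel_measurable borel" unfolding A_def by measurable
    let ?k = "half_median A"
    have N1: "tent_norm p0 top (H ?k) \<le> C1 * tent_norm p0 q0 (\<W> r0 u)"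
      unfolding C1_def
    proof (rule tent_norm_le_of_area[OF assms(1) False assms(2)])
      show "(\<integral>\<^sup>+x. epow (area top (H ?k) x) (enn2real p0) \<partial>lborel) \<le>
        2 * ennreal (2 * (5 * (2 * (a2 * a2) + 1)) ^ CARD('n)) *
          (\<integral>\<^sup>+x. epow (area q0 (\<W> r0 u) x) (enn2real p0) \<partial>lborel)"
        using nn_integral_area_H_half_median_le[OF _ p', of A] by (simp add: A_def)
    qed simp
    have "C1 < top" by (simp add: C1_def ennreal_mult_less_top)
    then have "tent_norm p0 top (H ?k) < top"
      using N0 by (intro le_less_trans[OF N1]) (simp add: ennreal_mult_less_top)
    then have "AE z in lborel. 0 < snd z \<longrightarrow> H ?k z < top"
      using False assms(1) by (intro AE_finite_of_tent_norm_finite[of _ p0 top]) auto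
    then have fin: "AE z in lborel. 0 < snd z \<longrightarrow> S ?k z < top"
      by eventually_elim (use S_le_H[OF self_in_whitney] le_less_trans in blast)
    have pos: "0 < ?k z" if z: "0 < snd z" "0 < \<W> r0 u z" for z
    proof (cases "q0 = top")
      case True
      show ?thesis
        using less_le_trans[OF z(2) le_half_median_area_top[OF _ z(1), of "\<W> r0 u"]] by (simp add: A_def True)
    next
      case False
      then show ?thesis
        unfolding A_def using z by (intro half_median_area_pos[OF u assms(3)])
    qed
    have N2: "tent_norm top q0 (\<W> r0 (quot ?k u)) \<le> C"
    proof (cases "q0 = top")
      case True
      have "tent_norm top top (\<W> r0 (quot ?k u)) \<le> 1"
      proof (rule wavg_quot_le_1[OF u assms(3) _ fin])
        fix z :: "(real^'n) \<times> real" assume "0 < snd z"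
        then show "\<W> r0 u z \<le> ?k z"
          unfolding A_def True by (intro le_half_median_area_top) measurable
      qed
      then show ?thesis using C(3) True by simp
    next
      case q0: False
      have "(\<integral>\<^sup>+x. epow (A x) (enn2real p0) \<partial>lborel) < top"
        using N0 False assms by (simp add: tent_norm_eq_area A_def)
      then have "AE x in lborel. epow (A x) (enn2real p0) \<noteq> \<infinity>"
        by (intro nn_integral_PInf_AE) auto
      then have "AE x in lborel. area q0 (\<W> r0 u) x < top"
        by eventually_elim (simp add: less_top A_def)
      from tent_norm_quot_half_median_le[OF u assms(3) assms(2) q0 this]
      show ?thesis using C(2) by (simp add: A_def C2_def)
    qed
    show "\<exists>k. (\<forall>z. 0 < snd z \<longrightarrow> 0 < \<W> r0 u z \<longrightarrow> 0 < k z) \<and>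
        (AE z in lborel. 0 < snd z \<longrightarrow> S k z < top) \<and>
        tent_norm p0 top (H k) \<le> C * tent_norm p0 q0 (\<W> r0 u) \<and>
        tent_norm top q0 (\<W> r0 (quot k u)) \<le> C"
      using pos fin N2 order_trans[OF N1 mult_right_mono[OF C(1)]] by (intro exI[of _ ?k]) simp
  qed simp
qed

lemma factorization_F1:
  assumes "0 < p0" "0 < q0" "0 < r0"
  shows "factorizes2 (Tnorm a1 a2 p0 q0 r0 :: ((real^'n) \<times> real \<Rightarrow> complex) \<Rightarrow> ennreal)
    (Tnorm a1 a2 p0 q0 top) (Tnorm a1 a2 top top r0) (\<lambda>z. 0 < snd z)"
proof (cases "q0 = top")
  case True
  \<comment> \<open>At q0 = top both factorizations have the same target spaces.\<close>
  then show ?thesis using factorization_F2[OF assms] by simp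
next
  case False
  obtain C1 where C1: "C1 < top" "\<And>u :: (real^'n) \<times> real \<Rightarrow> ennreal. u \<in> borel_measurable borel \<Longrightarrow>
      tent_norm p0 q0 (H (\<W> r0 u)) \<le> C1 * tent_norm p0 q0 (\<W> r0 u)"
    using tent_norm_H_wavg_le[OF assms(1,2) False assms(3), where 'n='n] by blast
  show ?thesis
  proof (rule factorizes2_by_quot[OF assms(3) assms(2), of "C1 + 1"])
    show "C1 + 1 < top" using C1(1) by simp
    fix u :: "(real^'n) \<times> real \<Rightarrow> ennreal"
    assume u [measurable]: "u \<in> borel_measurable borel" and N0: "tent_norm p0 q0 (\<W> r0 u) < top"
    let ?k = "\<W> r0 u"
    have "tent_norm p0 q0 (H ?k) < top"
      using N0 C1(1) by (intro le_less_trans[OF C1(2)[OF u]]) (simp add: ennreal_mult_less_top)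
    then have "AE z in lborel. 0 < snd z \<longrightarrow> H ?k z < top"
      using False assms by (intro AE_finite_of_tent_norm_finite[of _ p0 q0]) auto
    then have fin: "AE z in lborel. 0 < snd z \<longrightarrow> S ?k z < top"
      by eventually_elim (use S_le_H[OF self_in_whitney] le_less_trans in blast)
    have "tent_norm top top (\<W> r0 (quot ?k u)) \<le> 1"
      by (rule wavg_quot_le_1[OF u assms(3) _ fin]) simp
    then have "tent_norm top top (\<W> r0 (quot ?k u)) \<le> C1 + 1"
      by (simp add: add_increasing)
    moreover have "tent_norm p0 q0 (H ?k) \<le> (C1 + 1) * tent_norm p0 q0 (\<W> r0 u)"
      by (rule order_trans[OF C1(2)[OF u] mult_right_mono]) auto
    ultimately show "\<exists>k. (\<forall>z. 0 < snd z \<longrightarrow> 0 < \<W> r0 u z \<longrightarrow> 0 < k z) \<and>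
        (AE z in lborel. 0 < snd z \<longrightarrow> S k z < top) \<and>
        tent_norm p0 q0 (H k) \<le> (C1 + 1) * tent_norm p0 q0 (\<W> r0 u) \<and>
        tent_norm top top (\<W> r0 (quot k u)) \<le> C1 + 1"
      using fin by (intro exI[of _ ?k]) simp
  qed
qed

end

theorem theorem3p2:
  fixes a1 a2 :: real and p0 q0 r0 :: ennreal
  assumes "0 < a1" "a1 < 1 / a2" "1 / a2 < 1"
    and "0 < p0" "0 < q0" "0 < r0"
  shows "factorizes2 (Tnorm a1 a2 p0 q0 r0 :: ((real^'n) \<times> real \<Rightarrow> complex) \<Rightarrow> ennreal)
            (Tnorm a1 a2 p0 q0 top) (Tnorm a1 a2 top top r0) (\<lambda>z. 0 < snd z)
       \<and> factorizes2 (Tnorm a1 a2 p0 q0 r0 :: ((real^'n) \<times> real \<Rightarrow> complex) \<Rightarrow> ennreal)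
            (Tnorm a1 a2 p0 top top) (Tnorm a1 a2 top q0 r0) (\<lambda>z. 0 < snd z)
       \<and> factorizes3 (Tnorm a1 a2 p0 q0 r0 :: ((real^'n) \<times> real \<Rightarrow> complex) \<Rightarrow> ennreal)
            (Tnorm a1 a2 p0 top top) (Tnorm a1 a2 top q0 top) (Tnorm a1 a2 top top r0) (\<lambda>z. 0 < snd z)"
proof -
  interpret whitney_params a1 a2
    using assms(1-3) by unfold_locales
  have F1: "factorizes2 (Tnorm a1 a2 p0 q0 r0 :: ((real^'n) \<times> real \<Rightarrow> complex) \<Rightarrow> ennreal)
      (Tnorm a1 a2 p0 q0 top) (Tnorm a1 a2 top top r0) (\<lambda>z. 0 < snd z)"
    using assms(4-6) by (rule factorization_F1)
  moreover have "factorizes2 (Tnorm a1 a2 p0 q0 r0 :: ((real^'n) \<times> real \<Rightarrow> complex) \<Rightarrow> ennreal)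
      (Tnorm a1 a2 p0 top top) (Tnorm a1 a2 top q0 r0) (\<lambda>z. 0 < snd z)"
    using assms(4-6) by (rule factorization_F2)
  moreover have "factorizes3 (Tnorm a1 a2 p0 q0 r0 :: ((real^'n) \<times> real \<Rightarrow> complex) \<Rightarrow> ennreal)
      (Tnorm a1 a2 p0 top top) (Tnorm a1 a2 top q0 top) (Tnorm a1 a2 top top r0) (\<lambda>z. 0 < snd z)"
    \<comment> \<open>The second splitting acts on the first factor of \<open>F1\<close>, whose
      Whitney exponent is top, so \<open>factorization_F2\<close> is instantiated with top in place
      of r0.\<close>
    using assms(4,5) by (intro factorizes3I[OF F1 factorization_F2]) simp_all
  ultimately show ?thesis by blast
qed

end
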